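(* The codomain 2-functor $\partial_1\colon\mathbf{FIB}_{\mathrm{fib}}\to\mathbf{Cat}^{\mathrm{co}}_{\mathrm{fib}}$ is a 2-opfibration (coop-2-fibration) in the sense of Buckley.
   Context: $\mathbf{Cat}^{\mathrm{co}}_{\mathrm{fib}}$ is the 2-category whose 0-cells are categories, whose 1-cells $A\to B$ are Grothendieck fibrations $p\colon A\to B$, and whose 2-cells $p\to p'$ are natural transformations $p'\Rightarrow p$ (i.e. the sub-2-category of $\mathbf{Cat}^{\mathrm{co}}$ with 1-cells restricted to fibrations). $\mathbf{FIB}_{\mathrm{fib}}$ is the following 2-category. A 0-cell is a fibration $p\colon A\to B$. A 1-cell from $p\colon A\to B$ to $q\colon C\to D$ is a triple $(f,g,\alpha)$ (often denoted $\alpha$) with $f\colon A\to C$ a functor, $g\colon B\to D$ a fibration, and $\alpha\colon g\circ p\Rightarrow q\circ f$ a natural transformation. A 2-cell from $(f,g,\alpha)$ to $(h,k,\beta)$, both from $p$ to $q$, is a pair of natural transformations $\phi\colon f\Rightarrow h$ and $\psi\colon k\Rightarrow g$ such that $\beta=(q\phi)\cdot\alpha\cdot(\psi p)$ (first $\psi p$, then $\alpha$, then $q\phi$). Identities and compositions are the evident ones, by pasting. The 2-functor $\partial_1$ sends $p\colon A\to B$ to $B$, a 1-cell $(f,g,\alpha)$ to $g$, and a 2-cell $(\phi,\psi)$ to $\psi\colon k\Rightarrow g$, regarded as a 2-cell $g\to k$ of $\mathbf{Cat}^{\mathrm{co}}_{\mathrm{fib}}$. Let $P\colon\mathcal{E}\to\mathcal{B}$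 be a 2-functor. A 1-cell $h\colon x\to y$ of $\mathcal{E}$ is opcartesian if for every $z\in\mathcal{E}$ the square with top $h^*\colon\mathcal{E}(y,z)\to\mathcal{E}(x,z)$, bottom $(Ph)^*\colon\mathcal{B}(Py,Pz)\to\mathcal{B}(Px,Pz)$, and vertical functors induced by $P$, is a (strict) pullback of categories. $P$ is a 2-opfibration (coop-2-fibration) in the sense of Buckley if (1) for every $x\in\mathcal{E}$ and $f\colon Px\to b$ there is an opcartesian 1-cell $h\colon x\to y$ with $Ph=f$; (2) for all $x,y\in\mathcal{E}$ the functor $\mathcal{E}(x,y)\to\mathcal{B}(Px,Py)$ is a Grothendieck opfibration; (3) the 2-cells of $\mathcal{E}$ that are opcartesian for these local opfibrations are closed under horizontal composition. *)

theory Defs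
  imports Main "HOL-Library.FuncSet"
begin

section \<open>Categories and functors\<close>

text \<open>
  The objects and the arrows of a category form sets over two types. All structure maps are
  required to be undefined outside their domain, so that two categories with the same objects,
  arrows, and structure are equal as records; likewise for functors and natural transformations.
\<close>

record ('o, 'm) cat =
  Obj :: "'o set"
  Arr :: "'m set"
  Dom :: "'m \<Rightarrow> 'o"
  Cod :: "'m \<Rightarrow> 'o"
  Ident :: "'o \<Rightarrow> 'm"
  Comp :: "'m \<Rightarrow> 'm \<Rightarrow> 'm"

definition hom :: "('o, 'm) cat \<Rightarrow> 'o \<Rightarrow> 'o \<Rightarrow> 'm set" where
  "hom C a b = {f \<in> Arr C. Dom C f = a \<and> Cod C f = b}"

text \<open>\<open>composable C g f\<close> says that \<open>g \<circ> f\<close>, written \<open>Comp C g f\<close>, makes sense: first \<open>f\<close>, then \<open>g\<close>.\<close>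

definition composable :: "('o, 'm) cat \<Rightarrow> 'm \<Rightarrow> 'm \<Rightarrow> bool" where
  "composable C g f \<longleftrightarrow> f \<in> Arr C \<and> g \<in> Arr C \<and> Cod C f = Dom C g"

locale category =
  fixes C :: "('o, 'm) cat"
  assumes Dom_closed: "Dom C \<in> Arr C \<rightarrow>\<^sub>E Obj C"
    and Cod_closed: "Cod C \<in> Arr C \<rightarrow>\<^sub>E Obj C"
    and Ident_ext: "Ident C \<in> extensional (Obj C)"
    and Ident_hom: "a \<in> Obj C \<Longrightarrow> Ident C a \<in> hom C a a"
    and Comp_ext: "\<not> composable C g f \<Longrightarrow> Comp C g f = undefined"
    and Comp_hom: "composable C g f \<Longrightarrow> Comp C g f \<in> hom C (Dom C f) (Cod C g)"
    and Comp_Ident_left: "f \<in> Arr C \<Longrightarrow> Comp C (Ident C (Cod C f)) f = f"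
    and Comp_Ident_right: "f \<in> Arr C \<Longrightarrow> Comp C f (Ident C (Dom C f)) = f"
    and Comp_assoc: "composable C g f \<Longrightarrow> composable C h g \<Longrightarrow>
      Comp C h (Comp C g f) = Comp C (Comp C h g) f"

record ('o1, 'm1, 'o2, 'm2) ftor =
  Src :: "('o1, 'm1) cat"
  Trg :: "('o2, 'm2) cat"
  OMap :: "'o1 \<Rightarrow> 'o2"
  AMap :: "'m1 \<Rightarrow> 'm2"

locale is_functor =
  fixes F :: "('o1, 'm1, 'o2, 'm2) ftor"
  assumes Src_category: "category (Src F)"
    and Trg_category: "category (Trg F)"
    and OMap_closed: "OMap F \<in> Obj (Src F) \<rightarrow>\<^sub>E Obj (Trg F)"
    and AMap_ext: "AMap F \<in> extensional (Arr (Src F))"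
    and AMap_hom: "f \<in> Arr (Src F) \<Longrightarrow>
      AMap F f \<in> hom (Trg F) (OMap F (Dom (Src F) f)) (OMap F (Cod (Src F) f))"
    and AMap_Ident: "a \<in> Obj (Src F) \<Longrightarrow> AMap F (Ident (Src F) a) = Ident (Trg F) (OMap F a)"
    and AMap_Comp: "composable (Src F) g f \<Longrightarrow>
      AMap F (Comp (Src F) g f) = Comp (Trg F) (AMap F g) (AMap F f)"

definition functor_from_to ::
  "('o1, 'm1, 'o2, 'm2) ftor \<Rightarrow> ('o1, 'm1) cat \<Rightarrow> ('o2, 'm2) cat \<Rightarrow> bool" where
  "functor_from_to F C D \<longleftrightarrow> is_functor F \<and> Src F = C \<and> Trg F = D"

definition id_functor :: "('o, 'm) cat \<Rightarrow> ('o, 'm, 'o, 'm) ftor" where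
  "id_functor C = \<lparr> Src = C, Trg = C, OMap = (\<lambda>a\<in>Obj C. a), AMap = (\<lambda>f\<in>Arr C. f) \<rparr>"

definition functor_comp ::
  "('o2, 'm2, 'o3, 'm3) ftor \<Rightarrow> ('o1, 'm1, 'o2, 'm2) ftor \<Rightarrow> ('o1, 'm1, 'o3, 'm3) ftor"
  (infixr "\<circ>\<^sub>F" 55) where
  "G \<circ>\<^sub>F F = \<lparr> Src = Src F, Trg = Trg G,
     OMap = (\<lambda>a\<in>Obj (Src F). OMap G (OMap F a)),
     AMap = (\<lambda>f\<in>Arr (Src F). AMap G (AMap F f)) \<rparr>"

definition iso_functor :: "('o1, 'm1, 'o2, 'm2) ftor \<Rightarrow> bool" where
  "iso_functor F \<longleftrightarrow> is_functor F \<and>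
     (\<exists>G. functor_from_to G (Trg F) (Src F) \<and>
       G \<circ>\<^sub>F F = id_functor (Src F) \<and> F \<circ>\<^sub>F G = id_functor (Trg F))"

section \<open>Natural transformations\<close>

record ('o1, 'm1, 'o2, 'm2) nt =
  NSrc :: "('o1, 'm1, 'o2, 'm2) ftor"
  NTrg :: "('o1, 'm1, 'o2, 'm2) ftor"
  NAt :: "'o1 \<Rightarrow> 'm2"

locale nat_trans =
  fixes \<sigma> :: "('o1, 'm1, 'o2, 'm2) nt"
  assumes NSrc_functor: "is_functor (NSrc \<sigma>)"
    and NTrg_functor: "is_functor (NTrg \<sigma>)"
    and Src_eq: "Src (NTrg \<sigma>) = Src (NSrc \<sigma>)"
    and Trg_eq: "Trg (NTrg \<sigma>) = Trg (NSrc \<sigma>)"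
    and NAt_ext: "NAt \<sigma> \<in> extensional (Obj (Src (NSrc \<sigma>)))"
    and NAt_hom: "a \<in> Obj (Src (NSrc \<sigma>)) \<Longrightarrow>
      NAt \<sigma> a \<in> hom (Trg (NSrc \<sigma>)) (OMap (NSrc \<sigma>) a) (OMap (NTrg \<sigma>) a)"
    and naturality: "f \<in> hom (Src (NSrc \<sigma>)) a b \<Longrightarrow>
      Comp (Trg (NSrc \<sigma>)) (NAt \<sigma> b) (AMap (NSrc \<sigma>) f) =
      Comp (Trg (NSrc \<sigma>)) (AMap (NTrg \<sigma>) f) (NAt \<sigma> a)"

definition nat_trans_from_to :: "('o1, 'm1, 'o2, 'm2) nt \<Rightarrow>
    ('o1, 'm1, 'o2, 'm2) ftor \<Rightarrow> ('o1, 'm1, 'o2, 'm2) ftor \<Rightarrow> bool" where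
  "nat_trans_from_to \<sigma> F G \<longleftrightarrow> nat_trans \<sigma> \<and> NSrc \<sigma> = F \<and> NTrg \<sigma> = G"

definition id_nt :: "('o1, 'm1, 'o2, 'm2) ftor \<Rightarrow> ('o1, 'm1, 'o2, 'm2) nt" where
  "id_nt F = \<lparr> NSrc = F, NTrg = F, NAt = (\<lambda>a\<in>Obj (Src F). Ident (Trg F) (OMap F a)) \<rparr>"

text \<open>All composites are written in applicative order: \<open>\<tau> \<cdot> \<sigma>\<close> and \<open>\<tau> \<star> \<sigma>\<close> have \<open>\<sigma>\<close> first.\<close>

definition vcomp ::
  "('o1, 'm1, 'o2, 'm2) nt \<Rightarrow> ('o1, 'm1, 'o2, 'm2) nt \<Rightarrow> ('o1, 'm1, 'o2, 'm2) nt"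
  (infixr "\<cdot>" 60) where
  "\<tau> \<cdot> \<sigma> = \<lparr> NSrc = NSrc \<sigma>, NTrg = NTrg \<tau>,
     NAt = (\<lambda>a\<in>Obj (Src (NSrc \<sigma>)). Comp (Trg (NSrc \<sigma>)) (NAt \<tau> a) (NAt \<sigma> a)) \<rparr>"

definition whisker_left ::
  "('o2, 'm2, 'o3, 'm3) ftor \<Rightarrow> ('o1, 'm1, 'o2, 'm2) nt \<Rightarrow> ('o1, 'm1, 'o3, 'm3) nt"
  (infixr "\<rhd>" 65) where
  "H \<rhd> \<sigma> = \<lparr> NSrc = H \<circ>\<^sub>F NSrc \<sigma>, NTrg = H \<circ>\<^sub>F NTrg \<sigma>,
     NAt = (\<lambda>a\<in>Obj (Src (NSrc \<sigma>)). AMap H (NAt \<sigma> a)) \<rparr>"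

definition whisker_right ::
  "('o2, 'm2, 'o3, 'm3) nt \<Rightarrow> ('o1, 'm1, 'o2, 'm2) ftor \<Rightarrow> ('o1, 'm1, 'o3, 'm3) nt"
  (infixl "\<lhd>" 65) where
  "\<sigma> \<lhd> K = \<lparr> NSrc = NSrc \<sigma> \<circ>\<^sub>F K, NTrg = NTrg \<sigma> \<circ>\<^sub>F K,
     NAt = (\<lambda>a\<in>Obj (Src K). NAt \<sigma> (OMap K a)) \<rparr>"

definition hcomp ::
  "('o2, 'm2, 'o3, 'm3) nt \<Rightarrow> ('o1, 'm1, 'o2, 'm2) nt \<Rightarrow> ('o1, 'm1, 'o3, 'm3) nt"
  (infixr "\<star>" 65) where
  "\<tau> \<star> \<sigma> = (\<tau> \<lhd> NTrg \<sigma>) \<cdot> (NSrc \<tau> \<rhd> \<sigma>)"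

section \<open>Grothendieck fibrations and opfibrations\<close>

definition cartesian_arrow :: "('o1, 'm1, 'o2, 'm2) ftor \<Rightarrow> 'm1 \<Rightarrow> bool" where
  "cartesian_arrow p f \<longleftrightarrow> f \<in> Arr (Src p) \<and>
     (\<forall>g u. g \<in> Arr (Src p) \<and> Cod (Src p) g = Cod (Src p) f \<and>
        u \<in> hom (Trg p) (OMap p (Dom (Src p) g)) (OMap p (Dom (Src p) f)) \<and>
        Comp (Trg p) (AMap p f) u = AMap p g \<longrightarrow>
        (\<exists>!v. v \<in> hom (Src p) (Dom (Src p) g) (Dom (Src p) f) \<and>
           AMap p v = u \<and> Comp (Src p) f v = g))"

definition fibration :: "('o1, 'm1, 'o2, 'm2) ftor \<Rightarrow> bool" where
  "fibration p \<longleftrightarrow> is_functor p \<and>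
     (\<forall>a \<in> Obj (Src p). \<forall>f \<in> Arr (Trg p). Cod (Trg p) f = OMap p a \<longrightarrow>
        (\<exists>f'. cartesian_arrow p f' \<and> Cod (Src p) f' = a \<and> AMap p f' = f))"

definition opcartesian_arrow :: "('o1, 'm1, 'o2, 'm2) ftor \<Rightarrow> 'm1 \<Rightarrow> bool" where
  "opcartesian_arrow p f \<longleftrightarrow> f \<in> Arr (Src p) \<and>
     (\<forall>g u. g \<in> Arr (Src p) \<and> Dom (Src p) g = Dom (Src p) f \<and>
        u \<in> hom (Trg p) (OMap p (Cod (Src p) f)) (OMap p (Cod (Src p) g)) \<and>
        Comp (Trg p) u (AMap p f) = AMap p g \<longrightarrow>
        (\<exists>!v. v \<in> hom (Src p) (Cod (Src p) f) (Cod (Src p) g) \<and>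
           AMap p v = u \<and> Comp (Src p) v f = g))"

definition opfibration :: "('o1, 'm1, 'o2, 'm2) ftor \<Rightarrow> bool" where
  "opfibration p \<longleftrightarrow> is_functor p \<and>
     (\<forall>a \<in> Obj (Src p). \<forall>f \<in> Arr (Trg p). Dom (Trg p) f = OMap p a \<longrightarrow>
        (\<exists>f'. opcartesian_arrow p f' \<and> Dom (Src p) f' = a \<and> AMap p f' = f))"

section \<open>Products and strict pullbacks of categories\<close>

definition prod_cat ::
  "('o1, 'm1) cat \<Rightarrow> ('o2, 'm2) cat \<Rightarrow> ('o1 \<times> 'o2, 'm1 \<times> 'm2) cat" where
  "prod_cat C D = \<lparr> Obj = Obj C \<times> Obj D, Arr = Arr C \<times> Arr D,
     Dom = (\<lambda>(f, g)\<in>Arr C \<times> Arr D. (Dom C f, Dom D g)),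
     Cod = (\<lambda>(f, g)\<in>Arr C \<times> Arr D. (Cod C f, Cod D g)),
     Ident = (\<lambda>(a, b)\<in>Obj C \<times> Obj D. (Ident C a, Ident D b)),
     Comp = (\<lambda>(f', g') (f, g). if composable C f' f \<and> composable D g' g
               then (Comp C f' f, Comp D g' g) else undefined) \<rparr>"

definition fibre_prod ::
  "('o1, 'm1, 'o3, 'm3) ftor \<Rightarrow> ('o2, 'm2, 'o3, 'm3) ftor \<Rightarrow> ('o1 \<times> 'o2, 'm1 \<times> 'm2) cat" where
  "fibre_prod F G =
    (let Ob = {(a, b). a \<in> Obj (Src F) \<and> b \<in> Obj (Src G) \<and> OMap F a = OMap G b};
         Ar = {(f, g). f \<in> Arr (Src F) \<and> g \<in> Arr (Src G) \<and> AMap F f = AMap G g}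
     in \<lparr> Obj = Ob, Arr = Ar,
          Dom = restrict (Dom (prod_cat (Src F) (Src G))) Ar,
          Cod = restrict (Cod (prod_cat (Src F) (Src G))) Ar,
          Ident = restrict (Ident (prod_cat (Src F) (Src G))) Ob,
          Comp = (\<lambda>x y. if x \<in> Ar \<and> y \<in> Ar then Comp (prod_cat (Src F) (Src G)) x y
                        else undefined) \<rparr>)"

definition pairing :: "('o1, 'm1, 'o2, 'm2) ftor \<Rightarrow> ('o1, 'm1, 'o3, 'm3) ftor \<Rightarrow>
    ('o2 \<times> 'o3, 'm2 \<times> 'm3) cat \<Rightarrow> ('o1, 'm1, 'o2 \<times> 'o3, 'm2 \<times> 'm3) ftor" where
  "pairing T L D = \<lparr> Src = Src T, Trg = D,
     OMap = (\<lambda>a\<in>Obj (Src T). (OMap T a, OMap L a)),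
     AMap = (\<lambda>f\<in>Arr (Src T). (AMap T f, AMap L f)) \<rparr>"

text \<open>
  The square with top \<open>T\<close>, left \<open>L\<close>, right \<open>R\<close>, and bottom \<open>B\<close> commutes, and the comparison
  functor into the standard pullback of \<open>R\<close> and \<open>B\<close> is an isomorphism of categories. The
  universal property with respect to categories over arbitrary types is derived below.
\<close>

definition strict_pullback :: "('o, 'm, 'o1, 'm1) ftor \<Rightarrow> ('o, 'm, 'o2, 'm2) ftor \<Rightarrow>
    ('o1, 'm1, 'o3, 'm3) ftor \<Rightarrow> ('o2, 'm2, 'o3, 'm3) ftor \<Rightarrow> bool" where
  "strict_pullback T L R B \<longleftrightarrow>
     is_functor T \<and> is_functor L \<and> is_functor R \<and> is_functor B \<and>
     Src T = Src L \<and> Trg T = Src R \<and> Trg L = Src B \<and> Trg R = Trg B \<and>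
     R \<circ>\<^sub>F T = B \<circ>\<^sub>F L \<and> iso_functor (pairing T L (fibre_prod R B))"

lemma functor_comp_is_functor:
  assumes F: "is_functor F" and G: "is_functor G" and eq: "Trg F = Src G"
  shows "is_functor (G \<circ>\<^sub>F F)"
proof -
  interpret F: is_functor F by (rule F)
  interpret G: is_functor G by (rule G)
  interpret S: category "Src F" by (rule F.Src_category)
  have O: "OMap F a \<in> Obj (Src G)" if "a \<in> Obj (Src F)" for a
    using F.OMap_closed that eq by auto
  have A: "AMap F f \<in> Arr (Src G)" "Dom (Src G) (AMap F f) = OMap F (Dom (Src F) f)"
      "Cod (Src G) (AMap F f) = OMap F (Cod (Src F) f)" if "f \<in> Arr (Src F)" for f
    using F.AMap_hom[OF that] eq by (auto simp: hom_def)
  have D: "Dom (Src F) f \<in> Obj (Src F)" "Cod (Src F) f \<in> Obj (Src F)" if "f \<in> Arr (Src F)" for f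
    using that S.Dom_closed S.Cod_closed by auto
  show ?thesis
  proof (rule is_functor.intro, goal_cases)
    case 1 show ?case using F.Src_category by (simp add: functor_comp_def)
  next
    case 2 show ?case using G.Trg_category by (simp add: functor_comp_def)
  next
    case 3 show ?case using G.OMap_closed O by (auto simp: functor_comp_def)
  next
    case 4 show ?case by (simp add: functor_comp_def)
  next
    case (5 f)
    then have f: "f \<in> Arr (Src F)" by (simp add: functor_comp_def)
    show ?case using G.AMap_hom[OF A(1)[OF f]] f A[OF f] D[OF f] by (simp add: functor_comp_def)
  next
    case (6 a)
    then have a: "a \<in> Obj (Src F)" by (simp add: functor_comp_def)
    have "Ident (Src F) a \<in> Arr (Src F)" using S.Ident_hom[OF a] by (simp add: hom_def)
    then show ?case using F.AMap_Ident[OF a] G.AMap_Ident[OF O[OF a]] a eq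
      by (simp add: functor_comp_def)
  next
    case (7 g f)
    then have c: "composable (Src F) g f" by (simp add: functor_comp_def)
    then have gf: "f \<in> Arr (Src F)" "g \<in> Arr (Src F)" by (auto simp: composable_def)
    have "Comp (Src F) g f \<in> Arr (Src F)" using S.Comp_hom[OF c] by (simp add: hom_def)
    moreover have "composable (Src G) (AMap F g) (AMap F f)"
      using c A gf by (simp add: composable_def)
    ultimately show ?case using F.AMap_Comp[OF c] G.AMap_Comp gf eq
      by (simp add: functor_comp_def)
  qed
qed

lemma functor_comp_assoc:
  assumes "is_functor F" and "Trg F = Src G"
  shows "(H \<circ>\<^sub>F G) \<circ>\<^sub>F F = H \<circ>\<^sub>F (G \<circ>\<^sub>F F)"
proof -
  interpret is_functor F by (rule assms(1))
  have O: "OMap F a \<in> Obj (Src G)" if "a \<in> Obj (Src F)" for a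
    using OMap_closed that assms(2) by auto
  have A: "AMap F f \<in> Arr (Src G)" if "f \<in> Arr (Src F)" for f
    using AMap_hom[OF that] assms(2) by (auto simp: hom_def)
  show ?thesis using O A by (auto simp: functor_comp_def intro!: restrict_ext)
qed

lemma id_functor_comp:
  assumes "is_functor F" and "Trg F = C"
  shows "id_functor C \<circ>\<^sub>F F = F"
proof -
  interpret is_functor F by (rule assms(1))
  have O: "OMap F a \<in> Obj C" if "a \<in> Obj (Src F)" for a
    using OMap_closed that assms(2) by auto
  have A: "AMap F f \<in> Arr C" if "f \<in> Arr (Src F)" for f
    using AMap_hom[OF that] assms(2) by (auto simp: hom_def)
  have "(\<lambda>a\<in>Obj (Src F). OMap (id_functor C) (OMap F a)) = OMap F"
    using O OMap_closed by (auto simp: id_functor_def fun_eq_iff restrict_def PiE_def extensional_def)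
  moreover have "(\<lambda>f\<in>Arr (Src F). AMap (id_functor C) (AMap F f)) = AMap F"
    using A AMap_ext by (auto simp: id_functor_def fun_eq_iff restrict_def extensional_def)
  ultimately show ?thesis using assms(2) by (simp add: functor_comp_def id_functor_def)
qed

lemma pairing_is_functor:
  assumes H: "is_functor H" and K: "is_functor K" and S: "Src H = Src K"
    and HR: "Trg H = Src R" and KB: "Trg K = Src B" and sq: "R \<circ>\<^sub>F H = B \<circ>\<^sub>F K"
    and Q: "category (fibre_prod R B)"
  shows "is_functor (pairing H K (fibre_prod R B))"
proof -
  interpret H: is_functor H by (rule H)
  interpret K: is_functor K by (rule K)
  interpret S: category "Src H" by (rule H.Src_category)
  have D: "Dom (Src H) f \<in> Obj (Src H)" "Cod (Src H) f \<in> Obj (Src H)" if "f \<in> Arr (Src H)" for f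
    using that S.Dom_closed S.Cod_closed by auto
  have sqO: "OMap R (OMap H a) = OMap B (OMap K a)" if "a \<in> Obj (Src H)" for a
  proof -
    have "OMap (R \<circ>\<^sub>F H) a = OMap (B \<circ>\<^sub>F K) a" using sq by simp
    then show ?thesis using that S by (simp add: functor_comp_def)
  qed
  have sqA: "AMap R (AMap H f) = AMap B (AMap K f)" if "f \<in> Arr (Src H)" for f
  proof -
    have "AMap (R \<circ>\<^sub>F H) f = AMap (B \<circ>\<^sub>F K) f" using sq by simp
    then show ?thesis using that S by (simp add: functor_comp_def)
  qed
  have O: "OMap H a \<in> Obj (Src R)" "OMap K a \<in> Obj (Src B)" if "a \<in> Obj (Src H)" for a
    using H.OMap_closed K.OMap_closed that S HR KB by auto
  have AH: "AMap H f \<in> Arr (Src R)" "Dom (Src R) (AMap H f) = OMap H (Dom (Src H) f)"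
      "Cod (Src R) (AMap H f) = OMap H (Cod (Src H) f)" if "f \<in> Arr (Src H)" for f
    using H.AMap_hom[OF that] HR by (auto simp: hom_def)
  have AK: "AMap K f \<in> Arr (Src B)" "Dom (Src B) (AMap K f) = OMap K (Dom (Src H) f)"
      "Cod (Src B) (AMap K f) = OMap K (Cod (Src H) f)" if "f \<in> Arr (Src H)" for f
    using K.AMap_hom[of f] that S KB by (auto simp: hom_def)
  note defs = pairing_def fibre_prod_def prod_cat_def Let_def
  show ?thesis
  proof (rule is_functor.intro, goal_cases)
    case 1 show ?case using H.Src_category by (simp add: pairing_def)
  next
    case 2 show ?case using Q by (simp add: pairing_def)
  next
    case 3 show ?case using O sqO by (auto simp: defs)
  next
    case 4 show ?case by (simp add: pairing_def)
  next
    case (5 f)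
    then have f: "f \<in> Arr (Src H)" by (simp add: pairing_def)
    show ?case using AH[OF f] AK[OF f] D[OF f] f sqA[OF f] by (simp add: defs hom_def)
  next
    case (6 a)
    then have a: "a \<in> Obj (Src H)" by (simp add: pairing_def)
    have "Ident (Src H) a \<in> Arr (Src H)" using S.Ident_hom[OF a] by (simp add: hom_def)
    then show ?case using H.AMap_Ident[OF a] K.AMap_Ident[of a] a S HR KB O[OF a] sqO[OF a]
      by (simp add: defs)
  next
    case (7 g f)
    then have c: "composable (Src H) g f" by (simp add: pairing_def)
    then have gf: "f \<in> Arr (Src H)" "g \<in> Arr (Src H)" by (auto simp: composable_def)
    have "Comp (Src H) g f \<in> Arr (Src H)" using S.Comp_hom[OF c] by (simp add: hom_def)
    moreover have "composable (Src R) (AMap H g) (AMap H f)" "composable (Src B) (AMap K g) (AMap K f)"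
      using c AH AK gf by (simp_all add: composable_def)
    ultimately show ?case
      using H.AMap_Comp[OF c] K.AMap_Comp[of g f] c gf S HR KB AH(1) AK(1) sqA by (simp add: defs)
  qed
qed

lemma strict_pullback_universal:
  fixes H :: "('p, 'n, 'o1, 'm1) ftor" and K :: "('p, 'n, 'o2, 'm2) ftor"
  assumes pb: "strict_pullback T L R B"
    and H: "functor_from_to H X (Src R)" and K: "functor_from_to K X (Src B)"
    and sq: "R \<circ>\<^sub>F H = B \<circ>\<^sub>F K"
  shows "\<exists>!U. functor_from_to U X (Src T) \<and> T \<circ>\<^sub>F U = H \<and> L \<circ>\<^sub>F U = K"
proof -
  let ?Q = "fibre_prod R B"
  let ?C = "pairing T L ?Q"
  let ?V = "pairing H K ?Q"
  have T: "is_functor T" and L: "is_functor L" and SL: "Src L = Src T"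
    and TT: "Trg T = Src R" and TL: "Trg L = Src B"
    and C: "is_functor ?C"
    using pb by (auto simp: strict_pullback_def iso_functor_def)
  obtain G where G: "is_functor G" "Src G = ?Q" "Trg G = Src T"
    and GC: "G \<circ>\<^sub>F ?C = id_functor (Src T)" and CG: "?C \<circ>\<^sub>F G = id_functor ?Q"
    using pb by (auto simp: strict_pullback_def iso_functor_def functor_from_to_def pairing_def)
  have H': "is_functor H" "Src H = X" "Trg H = Src R"
    and K': "is_functor K" "Src K = X" "Trg K = Src B"
    using H K by (auto simp: functor_from_to_def)
  have Q: "category ?Q" using is_functor.Trg_category[OF C] by (simp add: pairing_def)
  have V: "is_functor ?V" by (rule pairing_is_functor) (use H' K' sq Q in simp_all)
  have Vs: "Src ?V = X" "Trg ?V = ?Q" and Cs: "Src ?C = Src T" "Trg ?C = ?Q"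
    using H' by (simp_all add: pairing_def)
  have comp: "?C \<circ>\<^sub>F U = ?V \<longleftrightarrow> T \<circ>\<^sub>F U = H \<and> L \<circ>\<^sub>F U = K"
    if U: "functor_from_to U X (Src T)" for U
  proof -
    have U': "is_functor U" "Src U = X" "Trg U = Src T" using U by (auto simp: functor_from_to_def)
    have O: "OMap U a \<in> Obj (Src T)" if "a \<in> Obj X" for a
      using is_functor.OMap_closed[OF U'(1)] that U' by auto
    have A: "AMap U f \<in> Arr (Src T)" if "f \<in> Arr X" for f
      using is_functor.AMap_hom[OF U'(1)] that U' by (auto simp: hom_def)
    have ext: "OMap H \<in> extensional (Obj X)" "AMap H \<in> extensional (Arr X)"
        "OMap K \<in> extensional (Obj X)" "AMap K \<in> extensional (Arr X)"
      using is_functor.OMap_closed[OF H'(1)] is_functor.AMap_ext[OF H'(1)]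
        is_functor.OMap_closed[OF K'(1)] is_functor.AMap_ext[OF K'(1)] H' K'
      by (auto simp: PiE_def)
    have r: "restrict g S = h \<longleftrightarrow> (\<forall>x\<in>S. g x = h x)" if "h \<in> extensional S" for g h S
      using that by (auto simp: fun_eq_iff restrict_def extensional_def)
    have r': "restrict g S = restrict h S \<longleftrightarrow> (\<forall>x\<in>S. g x = h x)" for g h S
      by (auto simp: fun_eq_iff restrict_def)
    have eqI: "F = F' \<longleftrightarrow> Src F = Src F' \<and> Trg F = Trg F' \<and> OMap F = OMap F' \<and> AMap F = AMap F'"
      for F F' :: "('x, 'y, 'z, 'w) ftor" by (cases F; cases F'; auto)
    have 1: "?C \<circ>\<^sub>F U = ?V \<longleftrightarrow>
        (\<forall>a\<in>Obj X. OMap T (OMap U a) = OMap H a \<and> OMap L (OMap U a) = OMap K a) \<and>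
        (\<forall>f\<in>Arr X. AMap T (AMap U f) = AMap H f \<and> AMap L (AMap U f) = AMap K f)"
      using O A U' H' by (auto simp: functor_comp_def pairing_def r')
    have 2: "T \<circ>\<^sub>F U = H \<longleftrightarrow> (\<forall>a\<in>Obj X. OMap T (OMap U a) = OMap H a) \<and>
        (\<forall>f\<in>Arr X. AMap T (AMap U f) = AMap H f)"
      using ext U' H' TT by (auto simp: functor_comp_def eqI r)
    have 3: "L \<circ>\<^sub>F U = K \<longleftrightarrow> (\<forall>a\<in>Obj X. OMap L (OMap U a) = OMap K a) \<and>
        (\<forall>f\<in>Arr X. AMap L (AMap U f) = AMap K f)"
      using ext U' K' TL by (auto simp: functor_comp_def eqI r)
    show ?thesis unfolding 1 2 3 by blast
  qed
  show ?thesis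
  proof (rule ex1I)
    have W: "functor_from_to (G \<circ>\<^sub>F ?V) X (Src T)"
      using functor_comp_is_functor[OF V G(1)] G Vs
      by (simp add: functor_from_to_def) (simp add: functor_comp_def)
    have "?C \<circ>\<^sub>F (G \<circ>\<^sub>F ?V) = (?C \<circ>\<^sub>F G) \<circ>\<^sub>F ?V"
      by (rule functor_comp_assoc[symmetric]) (use V Vs G in simp_all)
    also have "\<dots> = ?V" unfolding CG by (rule id_functor_comp) (use V Vs in simp_all)
    finally show "functor_from_to (G \<circ>\<^sub>F ?V) X (Src T) \<and>
        T \<circ>\<^sub>F (G \<circ>\<^sub>F ?V) = H \<and> L \<circ>\<^sub>F (G \<circ>\<^sub>F ?V) = K"
      using comp[OF W] W by simp
  next
    fix U assume U: "functor_from_to U X (Src T) \<and> T \<circ>\<^sub>F U = H \<and> L \<circ>\<^sub>F U = K"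
    then have U': "is_functor U" "Trg U = Src T" by (auto simp: functor_from_to_def)
    have "U = (G \<circ>\<^sub>F ?C) \<circ>\<^sub>F U" unfolding GC by (rule id_functor_comp[symmetric]) (use U' in simp_all)
    also have "\<dots> = G \<circ>\<^sub>F (?C \<circ>\<^sub>F U)" by (rule functor_comp_assoc) (use U' Cs in simp_all)
    also have "?C \<circ>\<^sub>F U = ?V" using comp U by blast
    finally show "U = G \<circ>\<^sub>F ?V" .
  qed
qed

section \<open>Strict 2-categories and 2-functors\<close>

text \<open>
  A 2-category is a category enriched in categories. The objects and arrows of \<open>Hom2 E x y\<close> are
  the 1-cells \<open>x \<rightarrow> y\<close> and the 2-cells between them, composed vertically; \<open>Comp2 E x y z\<close> is the
  functor \<open>Hom2 E y z \<times> Hom2 E x y \<rightarrow> Hom2 E x z\<close> of horizontal composition, in applicative order.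
\<close>

record ('o, 'a, 'c) two_cat =
  Obj2 :: "'o set"
  Hom2 :: "'o \<Rightarrow> 'o \<Rightarrow> ('a, 'c) cat"
  Unit2 :: "'o \<Rightarrow> 'a"
  Comp2 :: "'o \<Rightarrow> 'o \<Rightarrow> 'o \<Rightarrow> ('a \<times> 'a, 'c \<times> 'c, 'a, 'c) ftor"

definition comp1 :: "('o, 'a, 'c) two_cat \<Rightarrow> 'o \<Rightarrow> 'o \<Rightarrow> 'o \<Rightarrow> 'a \<Rightarrow> 'a \<Rightarrow> 'a" where
  "comp1 E x y z g f = OMap (Comp2 E x y z) (g, f)"

definition comp2 :: "('o, 'a, 'c) two_cat \<Rightarrow> 'o \<Rightarrow> 'o \<Rightarrow> 'o \<Rightarrow> 'c \<Rightarrow> 'c \<Rightarrow> 'c" where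
  "comp2 E x y z \<tau> \<sigma> = AMap (Comp2 E x y z) (\<tau>, \<sigma>)"

definition unit_cell :: "('o, 'a, 'c) two_cat \<Rightarrow> 'o \<Rightarrow> 'c" where
  "unit_cell E x = Ident (Hom2 E x x) (Unit2 E x)"

locale two_category =
  fixes E :: "('o, 'a, 'c) two_cat"
  assumes Hom2_category: "x \<in> Obj2 E \<Longrightarrow> y \<in> Obj2 E \<Longrightarrow> category (Hom2 E x y)"
    and Unit2_closed: "x \<in> Obj2 E \<Longrightarrow> Unit2 E x \<in> Obj (Hom2 E x x)"
    and Comp2_functor: "x \<in> Obj2 E \<Longrightarrow> y \<in> Obj2 E \<Longrightarrow> z \<in> Obj2 E \<Longrightarrow>
      functor_from_to (Comp2 E x y z) (prod_cat (Hom2 E y z) (Hom2 E x y)) (Hom2 E x z)"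
    and comp1_assoc: "w \<in> Obj2 E \<Longrightarrow> x \<in> Obj2 E \<Longrightarrow> y \<in> Obj2 E \<Longrightarrow> z \<in> Obj2 E \<Longrightarrow>
      f \<in> Obj (Hom2 E w x) \<Longrightarrow> g \<in> Obj (Hom2 E x y) \<Longrightarrow> h \<in> Obj (Hom2 E y z) \<Longrightarrow>
      comp1 E w y z h (comp1 E w x y g f) = comp1 E w x z (comp1 E x y z h g) f"
    and comp2_assoc: "w \<in> Obj2 E \<Longrightarrow> x \<in> Obj2 E \<Longrightarrow> y \<in> Obj2 E \<Longrightarrow> z \<in> Obj2 E \<Longrightarrow>
      \<rho> \<in> Arr (Hom2 E w x) \<Longrightarrow> \<sigma> \<in> Arr (Hom2 E x y) \<Longrightarrow> \<tau> \<in> Arr (Hom2 E y z) \<Longrightarrow>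
      comp2 E w y z \<tau> (comp2 E w x y \<sigma> \<rho>) = comp2 E w x z (comp2 E x y z \<tau> \<sigma>) \<rho>"
    and comp1_unit_left: "x \<in> Obj2 E \<Longrightarrow> y \<in> Obj2 E \<Longrightarrow> f \<in> Obj (Hom2 E x y) \<Longrightarrow>
      comp1 E x y y (Unit2 E y) f = f"
    and comp1_unit_right: "x \<in> Obj2 E \<Longrightarrow> y \<in> Obj2 E \<Longrightarrow> f \<in> Obj (Hom2 E x y) \<Longrightarrow>
      comp1 E x x y f (Unit2 E x) = f"
    and comp2_unit_left: "x \<in> Obj2 E \<Longrightarrow> y \<in> Obj2 E \<Longrightarrow> \<sigma> \<in> Arr (Hom2 E x y) \<Longrightarrow>
      comp2 E x y y (unit_cell E y) \<sigma> = \<sigma>"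
    and comp2_unit_right: "x \<in> Obj2 E \<Longrightarrow> y \<in> Obj2 E \<Longrightarrow> \<sigma> \<in> Arr (Hom2 E x y) \<Longrightarrow>
      comp2 E x x y \<sigma> (unit_cell E x) = \<sigma>"

record ('o, 'a, 'c, 'p, 'b, 'd) two_ftor =
  OMap2 :: "'o \<Rightarrow> 'p"
  HomMap2 :: "'o \<Rightarrow> 'o \<Rightarrow> ('a, 'c, 'b, 'd) ftor"

locale two_functor =
  fixes E :: "('o, 'a, 'c) two_cat"
    and B :: "('p, 'b, 'd) two_cat"
    and P :: "('o, 'a, 'c, 'p, 'b, 'd) two_ftor"
  assumes E_two_category: "two_category E"
    and B_two_category: "two_category B"
    and OMap2_closed: "x \<in> Obj2 E \<Longrightarrow> OMap2 P x \<in> Obj2 B"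
    and HomMap2_functor: "x \<in> Obj2 E \<Longrightarrow> y \<in> Obj2 E \<Longrightarrow>
      functor_from_to (HomMap2 P x y) (Hom2 E x y) (Hom2 B (OMap2 P x) (OMap2 P y))"
    and HomMap2_Unit2: "x \<in> Obj2 E \<Longrightarrow> OMap (HomMap2 P x x) (Unit2 E x) = Unit2 B (OMap2 P x)"
    and HomMap2_comp1: "x \<in> Obj2 E \<Longrightarrow> y \<in> Obj2 E \<Longrightarrow> z \<in> Obj2 E \<Longrightarrow>
      f \<in> Obj (Hom2 E x y) \<Longrightarrow> g \<in> Obj (Hom2 E y z) \<Longrightarrow>
      OMap (HomMap2 P x z) (comp1 E x y z g f) =
      comp1 B (OMap2 P x) (OMap2 P y) (OMap2 P z) (OMap (HomMap2 P y z) g) (OMap (HomMap2 P x y) f)"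
    and HomMap2_comp2: "x \<in> Obj2 E \<Longrightarrow> y \<in> Obj2 E \<Longrightarrow> z \<in> Obj2 E \<Longrightarrow>
      \<sigma> \<in> Arr (Hom2 E x y) \<Longrightarrow> \<tau> \<in> Arr (Hom2 E y z) \<Longrightarrow>
      AMap (HomMap2 P x z) (comp2 E x y z \<tau> \<sigma>) =
      comp2 B (OMap2 P x) (OMap2 P y) (OMap2 P z) (AMap (HomMap2 P y z) \<tau>) (AMap (HomMap2 P x y) \<sigma>)"

section \<open>2-opfibrations\<close>

text \<open>The functor \<open>h\<^sup>*\<close> from \<open>E(y,z)\<close> to \<open>E(x,z)\<close> for a 1-cell \<open>h\<close> from \<open>x\<close> to \<open>y\<close>.\<close>

definition precomp ::
  "('o, 'a, 'c) two_cat \<Rightarrow> 'o \<Rightarrow> 'o \<Rightarrow> 'o \<Rightarrow> 'a \<Rightarrow> ('a, 'c, 'a, 'c) ftor" where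
  "precomp E x y z h = \<lparr> Src = Hom2 E y z, Trg = Hom2 E x z,
     OMap = (\<lambda>g\<in>Obj (Hom2 E y z). comp1 E x y z g h),
     AMap = (\<lambda>\<tau>\<in>Arr (Hom2 E y z). comp2 E x y z \<tau> (Ident (Hom2 E x y) h)) \<rparr>"

definition opcartesian_1cell :: "('o, 'a, 'c) two_cat \<Rightarrow> ('p, 'b, 'd) two_cat \<Rightarrow>
    ('o, 'a, 'c, 'p, 'b, 'd) two_ftor \<Rightarrow> 'o \<Rightarrow> 'o \<Rightarrow> 'a \<Rightarrow> bool" where
  "opcartesian_1cell E B P x y h \<longleftrightarrow> h \<in> Obj (Hom2 E x y) \<and>
     (\<forall>z \<in> Obj2 E. strict_pullback
        (precomp E x y z h)
        (HomMap2 P y z)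
        (HomMap2 P x z)
        (precomp B (OMap2 P x) (OMap2 P y) (OMap2 P z) (OMap (HomMap2 P x y) h)))"

definition two_opfibration :: "('o, 'a, 'c) two_cat \<Rightarrow> ('p, 'b, 'd) two_cat \<Rightarrow>
    ('o, 'a, 'c, 'p, 'b, 'd) two_ftor \<Rightarrow> bool" where
  "two_opfibration E B P \<longleftrightarrow> two_functor E B P \<and>
     (\<forall>x \<in> Obj2 E. \<forall>b \<in> Obj2 B. \<forall>f \<in> Obj (Hom2 B (OMap2 P x) b).
        \<exists>y \<in> Obj2 E. \<exists>h. opcartesian_1cell E B P x y h \<and>
          OMap2 P y = b \<and> OMap (HomMap2 P x y) h = f) \<and>
     (\<forall>x \<in> Obj2 E. \<forall>y \<in> Obj2 E. opfibration (HomMap2 P x y)) \<and>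
     (\<forall>x \<in> Obj2 E. \<forall>y \<in> Obj2 E. \<forall>z \<in> Obj2 E. \<forall>\<sigma> \<tau>.
        opcartesian_arrow (HomMap2 P x y) \<sigma> \<and> opcartesian_arrow (HomMap2 P y z) \<tau> \<longrightarrow>
        opcartesian_arrow (HomMap2 P x z) (comp2 E x y z \<tau> \<sigma>))"

section \<open>The 2-category of categories and fibrations, with 2-cells reversed\<close>

text \<open>
  A 2-cell from \<open>p\<close> to \<open>p'\<close> is a natural transformation from \<open>p'\<close> to \<open>p\<close>; hence \<open>Dom\<close> is \<open>NTrg\<close>,
  \<open>Cod\<close> is \<open>NSrc\<close>, and vertical composition is reversed.
\<close>

definition Cat_co_fib_hom ::
  "('o, 'm) cat \<Rightarrow> ('o, 'm) cat \<Rightarrow> (('o, 'm, 'o, 'm) ftor, ('o, 'm, 'o, 'm) nt) cat" where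
  "Cat_co_fib_hom A B =
    (let Ob = {p. fibration p \<and> Src p = A \<and> Trg p = B};
         Ar = {\<sigma>. nat_trans \<sigma> \<and> NSrc \<sigma> \<in> Ob \<and> NTrg \<sigma> \<in> Ob}
     in \<lparr> Obj = Ob, Arr = Ar,
          Dom = (\<lambda>\<sigma>\<in>Ar. NTrg \<sigma>), Cod = (\<lambda>\<sigma>\<in>Ar. NSrc \<sigma>),
          Ident = (\<lambda>p\<in>Ob. id_nt p),
          Comp = (\<lambda>\<tau> \<sigma>. if \<sigma> \<in> Ar \<and> \<tau> \<in> Ar \<and> NSrc \<sigma> = NTrg \<tau> then \<sigma> \<cdot> \<tau> else undefined) \<rparr>)"

definition Cat_co_fib ::
  "(('o, 'm) cat, ('o, 'm, 'o, 'm) ftor, ('o, 'm, 'o, 'm) nt) two_cat" where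
  "Cat_co_fib = \<lparr> Obj2 = {A. category A}, Hom2 = Cat_co_fib_hom, Unit2 = id_functor,
     Comp2 = (\<lambda>A B C.
       let D = prod_cat (Cat_co_fib_hom B C) (Cat_co_fib_hom A B)
       in \<lparr> Src = D, Trg = Cat_co_fib_hom A C,
            OMap = (\<lambda>(q, p)\<in>Obj D. q \<circ>\<^sub>F p),
            AMap = (\<lambda>(\<tau>, \<sigma>)\<in>Arr D. \<tau> \<star> \<sigma>) \<rparr>) \<rparr>"

section \<open>The 2-category of fibrations and lax squares\<close>

text \<open>The 1-cell \<open>(f, g, \<alpha>)\<close> has \<open>Upper = f\<close>, \<open>Lower = g\<close>, and \<open>Filler = \<alpha>\<close>.\<close>

record ('o, 'm) lax_square =
  Upper :: "('o, 'm, 'o, 'm) ftor"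
  Lower :: "('o, 'm, 'o, 'm) ftor"
  Filler :: "('o, 'm, 'o, 'm) nt"

definition is_lax_square :: "('o, 'm, 'o, 'm) ftor \<Rightarrow> ('o, 'm, 'o, 'm) ftor \<Rightarrow>
    ('o, 'm) lax_square \<Rightarrow> bool" where
  "is_lax_square p q s \<longleftrightarrow>
     functor_from_to (Upper s) (Src p) (Src q) \<and>
     fibration (Lower s) \<and> Src (Lower s) = Trg p \<and> Trg (Lower s) = Trg q \<and>
     nat_trans_from_to (Filler s) (Lower s \<circ>\<^sub>F p) (q \<circ>\<^sub>F Upper s)"

definition id_square :: "('o, 'm, 'o, 'm) ftor \<Rightarrow> ('o, 'm) lax_square" where
  "id_square p = \<lparr> Upper = id_functor (Src p), Lower = id_functor (Trg p), Filler = id_nt p \<rparr>"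

definition paste_square ::
  "('o, 'm) lax_square \<Rightarrow> ('o, 'm) lax_square \<Rightarrow> ('o, 'm) lax_square" where
  "paste_square t s = \<lparr> Upper = Upper t \<circ>\<^sub>F Upper s, Lower = Lower t \<circ>\<^sub>F Lower s,
     Filler = (Filler t \<lhd> Upper s) \<cdot> (Lower t \<rhd> Filler s) \<rparr>"

text \<open>
  The 2-cell \<open>(\<phi>, \<psi>)\<close> has \<open>UpperCell = \<phi>\<close> and \<open>LowerCell = \<psi>\<close>. The fillers of its source and
  target are not determined by \<open>\<phi>\<close> and \<open>\<psi>\<close>, so both 1-cells are recorded.
\<close>

record ('o, 'm) square_cell =
  CSrc :: "('o, 'm) lax_square"
  CTrg :: "('o, 'm) lax_square"
  UpperCell :: "('o, 'm, 'o, 'm) nt"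
  LowerCell :: "('o, 'm, 'o, 'm) nt"

definition is_square_cell :: "('o, 'm, 'o, 'm) ftor \<Rightarrow> ('o, 'm, 'o, 'm) ftor \<Rightarrow>
    ('o, 'm) square_cell \<Rightarrow> bool" where
  "is_square_cell p q c \<longleftrightarrow>
     is_lax_square p q (CSrc c) \<and> is_lax_square p q (CTrg c) \<and>
     nat_trans_from_to (UpperCell c) (Upper (CSrc c)) (Upper (CTrg c)) \<and>
     nat_trans_from_to (LowerCell c) (Lower (CTrg c)) (Lower (CSrc c)) \<and>
     Filler (CTrg c) = (q \<rhd> UpperCell c) \<cdot> Filler (CSrc c) \<cdot> (LowerCell c \<lhd> p)"

definition id_cell :: "('o, 'm) lax_square \<Rightarrow> ('o, 'm) square_cell" where
  "id_cell s = \<lparr> CSrc = s, CTrg = s, UpperCell = id_nt (Upper s), LowerCell = id_nt (Lower s) \<rparr>"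

definition vcomp_cell ::
  "('o, 'm) square_cell \<Rightarrow> ('o, 'm) square_cell \<Rightarrow> ('o, 'm) square_cell" where
  "vcomp_cell d c = \<lparr> CSrc = CSrc c, CTrg = CTrg d,
     UpperCell = UpperCell d \<cdot> UpperCell c, LowerCell = LowerCell c \<cdot> LowerCell d \<rparr>"

definition hcomp_cell ::
  "('o, 'm) square_cell \<Rightarrow> ('o, 'm) square_cell \<Rightarrow> ('o, 'm) square_cell" where
  "hcomp_cell d c = \<lparr> CSrc = paste_square (CSrc d) (CSrc c), CTrg = paste_square (CTrg d) (CTrg c),
     UpperCell = UpperCell d \<star> UpperCell c, LowerCell = LowerCell d \<star> LowerCell c \<rparr>"

definition FIB_fib_hom :: "('o, 'm, 'o, 'm) ftor \<Rightarrow> ('o, 'm, 'o, 'm) ftor \<Rightarrow>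
    (('o, 'm) lax_square, ('o, 'm) square_cell) cat" where
  "FIB_fib_hom p q =
    (let Ob = {s. is_lax_square p q s};
         Ar = {c. is_square_cell p q c}
     in \<lparr> Obj = Ob, Arr = Ar,
          Dom = (\<lambda>c\<in>Ar. CSrc c), Cod = (\<lambda>c\<in>Ar. CTrg c),
          Ident = (\<lambda>s\<in>Ob. id_cell s),
          Comp = (\<lambda>d c. if c \<in> Ar \<and> d \<in> Ar \<and> CTrg c = CSrc d then vcomp_cell d c
                        else undefined) \<rparr>)"

definition FIB_fib ::
  "(('o, 'm, 'o, 'm) ftor, ('o, 'm) lax_square, ('o, 'm) square_cell) two_cat" where
  "FIB_fib = \<lparr> Obj2 = {p. fibration p}, Hom2 = FIB_fib_hom, Unit2 = id_square,
     Comp2 = (\<lambda>p q r.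
       let D = prod_cat (FIB_fib_hom q r) (FIB_fib_hom p q)
       in \<lparr> Src = D, Trg = FIB_fib_hom p r,
            OMap = (\<lambda>(t, s)\<in>Obj D. paste_square t s),
            AMap = (\<lambda>(d, c)\<in>Arr D. hcomp_cell d c) \<rparr>) \<rparr>"

section \<open>The codomain 2-functor\<close>

definition cod_2functor :: "(('o, 'm, 'o, 'm) ftor, ('o, 'm) lax_square, ('o, 'm) square_cell,
    ('o, 'm) cat, ('o, 'm, 'o, 'm) ftor, ('o, 'm, 'o, 'm) nt) two_ftor" where
  "cod_2functor = \<lparr> OMap2 = Trg,
     HomMap2 = (\<lambda>p q. \<lparr> Src = FIB_fib_hom p q, Trg = Cat_co_fib_hom (Trg p) (Trg q),
       OMap = (\<lambda>s\<in>Obj (FIB_fib_hom p q). Lower s),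
       AMap = (\<lambda>c\<in>Arr (FIB_fib_hom p q). LowerCell c) \<rparr>) \<rparr>"

end

theory Submission
  imports Defs
begin

text \<open>
  Two observations carry the proof. An opcartesian lift of a fibration \<open>f : B \<rightarrow> D\<close> at the object
  \<open>p : A \<rightarrow> B\<close> is the lax square \<open>(id, f, id)\<close> from \<open>p\<close> to \<open>f \<circ>\<^sub>F p\<close>, and its target is again a
  0-cell because fibrations compose. Pasting this square in front of \<open>(u, g, \<alpha>)\<close> yields
  \<open>(u, g \<circ>\<^sub>F f, \<alpha>)\<close>: upper part and filler stay literally the same, since \<open>(g \<circ>\<^sub>F f) \<circ>\<^sub>F p\<close> and
  \<open>g \<circ>\<^sub>F (f \<circ>\<^sub>F p)\<close> are equal functors. A lax square out of \<open>f \<circ>\<^sub>F p\<close> is therefore the same thing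
  as a lax square out of \<open>p\<close> together with a factorization of its lower functor through \<open>f\<close>; the
  same holds for 2-cells, and this is the strict pullback property
  (\<open>pushforward_square_opcartesian\<close>).

  In a hom-category, a 2-cell \<open>\<psi>\<close> out of the lower part of \<open>(u, g, \<alpha>)\<close> is a transformation from
  some \<open>k\<close> to \<open>g\<close>. It lifts to \<open>(id, \<psi>)\<close> with target \<open>(u, k, \<alpha> \<cdot> (\<psi> \<lhd> p))\<close>: the filler of the
  target is forced, and the upper part need not move. More generally \<open>(\<phi>, \<psi>)\<close> is opcartesian exactly
  when \<open>\<phi>\<close> is invertible (\<open>opcartesian_if_invertible\<close>, \<open>invertible_if_opcartesian\<close>). A factorization
  through \<open>(\<phi>, \<psi>)\<close> must precompose the upper part with the inverse of \<open>\<phi>\<close>; conversely, an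
  opcartesian cell differs from the lift \<open>(id, \<psi>)\<close> by an isomorphism over the identity. Since
  horizontal composites of invertible transformations are invertible, opcartesian 2-cells are
  closed under horizontal composition.

  The remaining work is to see that both structures are 2-categories. An identity between pasted
  transformations is checked at each object separately, where it is an identity between composites
  of arrows. Most of these need only associativity and functoriality; naturality enters in the
  interchange law and in its analogue for lax squares (\<open>hcomp_cell_square\<close>).
\<close>

section \<open>Calculating with arrows, functors and transformations\<close>

lemma in_homD:
  assumes "f \<in> hom C a b"
  shows "f \<in> Arr C" "Dom C f = a" "Cod C f = b"
  using assms by (auto simp: hom_def)

lemma in_homI: "f \<in> Arr C \<Longrightarrow> f \<in> hom C (Dom C f) (Cod C f)"
  by (simp add: hom_def)

context category
begin

lemma Dom_in_Obj: "f \<in> Arr C \<Longrightarrow> Dom C f \<in> Obj C"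
  using Dom_closed by auto

lemma Cod_in_Obj: "f \<in> Arr C \<Longrightarrow> Cod C f \<in> Obj C"
  using Cod_closed by auto

lemma hom_Obj:
  assumes "f \<in> hom C a b"
  shows "a \<in> Obj C" "b \<in> Obj C"
  using assms Dom_in_Obj Cod_in_Obj by (auto simp: hom_def)

lemma Comp_in_hom: "f \<in> hom C a b \<Longrightarrow> g \<in> hom C b c \<Longrightarrow> Comp C g f \<in> hom C a c"
  using Comp_hom[of g f] by (auto simp: hom_def composable_def)

lemma hom_assoc:
  "f \<in> hom C a b \<Longrightarrow> g \<in> hom C b c \<Longrightarrow> h \<in> hom C c d \<Longrightarrow>
    Comp C (Comp C h g) f = Comp C h (Comp C g f)"
  using Comp_assoc[of g f h] by (auto simp: hom_def composable_def)

lemma hom_Ident_left: "f \<in> hom C a b \<Longrightarrow> Comp C (Ident C b) f = f"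
  using Comp_Ident_left[of f] by (auto simp: hom_def)

lemma hom_Ident_right: "f \<in> hom C a b \<Longrightarrow> Comp C f (Ident C a) = f"
  using Comp_Ident_right[of f] by (auto simp: hom_def)

end

text \<open>
  Every category below is described by its typed arrows, so its axioms are best checked for elements
  of hom-sets rather than through domains and codomains of composable pairs.
\<close>

lemma categoryI:
  assumes "Dom C \<in> extensional (Arr C)" "Cod C \<in> extensional (Arr C)"
    and "Ident C \<in> extensional (Obj C)"
    and "\<And>f a b. f \<in> hom C a b \<Longrightarrow> a \<in> Obj C \<and> b \<in> Obj C"
    and "\<And>a. a \<in> Obj C \<Longrightarrow> Ident C a \<in> hom C a a"
    and "\<And>f g. \<not> composable C g f \<Longrightarrow> Comp C g f = undefined"
    and "\<And>f g a b c. f \<in> hom C a b \<Longrightarrow> g \<in> hom C b c \<Longrightarrow> Comp C g f \<in> hom C a c"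
    and "\<And>f a b. f \<in> hom C a b \<Longrightarrow> Comp C (Ident C b) f = f"
    and "\<And>f a b. f \<in> hom C a b \<Longrightarrow> Comp C f (Ident C a) = f"
    and "\<And>f g h a b c d. f \<in> hom C a b \<Longrightarrow> g \<in> hom C b c \<Longrightarrow> h \<in> hom C c d \<Longrightarrow>
      Comp C h (Comp C g f) = Comp C (Comp C h g) f"
  shows "category C"
proof
  show "Dom C \<in> Arr C \<rightarrow>\<^sub>E Obj C" "Cod C \<in> Arr C \<rightarrow>\<^sub>E Obj C"
    using assms(1,2) assms(4)[OF in_homI] by (auto simp: PiE_def)
  show "Comp C g f \<in> hom C (Dom C f) (Cod C g)" if "composable C g f" for g f
    using that assms(7)[OF in_homI, of f g "Cod C g"] by (auto simp: composable_def hom_def)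
  show "Comp C h (Comp C g f) = Comp C (Comp C h g) f"
    if "composable C g f" "composable C h g" for f g h
    using that assms(10)[OF in_homI, of f g "Cod C g" h "Cod C h"]
    by (auto simp: composable_def hom_def)
qed (use assms(3,5,6) assms(8,9)[OF in_homI] in auto)

lemma functor_from_toD:
  assumes "functor_from_to F A B"
  shows "is_functor F" "Src F = A" "Trg F = B" "category A" "category B"
  using assms is_functor.Src_category is_functor.Trg_category by (auto simp: functor_from_to_def)

lemma functor_OMap: "functor_from_to F A B \<Longrightarrow> a \<in> Obj A \<Longrightarrow> OMap F a \<in> Obj B"
  using is_functor.OMap_closed[of F] by (auto simp: functor_from_to_def)

lemma functor_AMap:
  "functor_from_to F A B \<Longrightarrow> f \<in> hom A a b \<Longrightarrow> AMap F f \<in> hom B (OMap F a) (OMap F b)"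
  using is_functor.AMap_hom[of F f] by (auto simp: functor_from_to_def hom_def)

lemma functor_Ident:
  "functor_from_to F A B \<Longrightarrow> a \<in> Obj A \<Longrightarrow> AMap F (Ident A a) = Ident B (OMap F a)"
  using is_functor.AMap_Ident[of F a] by (auto simp: functor_from_to_def)

lemma functor_Comp:
  "functor_from_to F A B \<Longrightarrow> f \<in> hom A a b \<Longrightarrow> g \<in> hom A b c \<Longrightarrow>
    AMap F (Comp A g f) = Comp B (AMap F g) (AMap F f)"
  using is_functor.AMap_Comp[of F g f] by (auto simp: functor_from_to_def hom_def composable_def)

text \<open>
  Composition functors, precomposition functors and the action of a 2-functor on hom-categories are
  all given by restricting two maps, which is why the rule is stated for restrictions.
\<close>

lemma functor_from_to_restrictI:
  assumes C: "category C" and D: "category D"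
    and O: "\<And>a. a \<in> Obj C \<Longrightarrow> ob a \<in> Obj D"
    and A: "\<And>f a b. f \<in> hom C a b \<Longrightarrow> ar f \<in> hom D (ob a) (ob b)"
    and I: "\<And>a. a \<in> Obj C \<Longrightarrow> ar (Ident C a) = Ident D (ob a)"
    and M: "\<And>f g a b c. f \<in> hom C a b \<Longrightarrow> g \<in> hom C b c \<Longrightarrow>
      ar (Comp C g f) = Comp D (ar g) (ar f)"
  shows "functor_from_to \<lparr> Src = C, Trg = D, OMap = restrict ob (Obj C),
    AMap = restrict ar (Arr C) \<rparr> C D"
proof -
  interpret C: category C by (rule C)
  have "is_functor \<lparr> Src = C, Trg = D, OMap = restrict ob (Obj C), AMap = restrict ar (Arr C) \<rparr>"
    using C D O A[OF in_homI] C.Ident_hom I M[OF in_homI] C.Comp_hom C.Dom_in_Obj C.Cod_in_Obj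
    by (intro is_functor.intro) (auto simp: hom_def composable_def)
  then show ?thesis by (simp add: functor_from_to_def)
qed

lemma functor_eqI:
  assumes F: "functor_from_to F A B" and G: "functor_from_to G A B"
    and O: "\<And>a. a \<in> Obj A \<Longrightarrow> OMap F a = OMap G a"
    and M: "\<And>f. f \<in> Arr A \<Longrightarrow> AMap F f = AMap G f"
  shows "F = G"
proof -
  have "OMap F = OMap G"
    using is_functor.OMap_closed[of F] is_functor.OMap_closed[of G] F G O
    by (intro extensionalityI[of _ "Obj A"]) (auto simp: functor_from_to_def PiE_def)
  moreover have "AMap F = AMap G"
    using is_functor.AMap_ext[of F] is_functor.AMap_ext[of G] F G M
    by (intro extensionalityI[of _ "Arr A"]) (auto simp: functor_from_to_def)
  ultimately show ?thesis using F G by (simp add: functor_from_to_def)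
qed

lemma functor_comp_from_to:
  "functor_from_to F A B \<Longrightarrow> functor_from_to G B C \<Longrightarrow> functor_from_to (G \<circ>\<^sub>F F) A C"
  using functor_comp_is_functor[of F G] by (auto simp: functor_from_to_def functor_comp_def)

lemma functor_comp_assoc_from_to:
  "functor_from_to F A B \<Longrightarrow> functor_from_to G B C \<Longrightarrow> (H \<circ>\<^sub>F G) \<circ>\<^sub>F F = H \<circ>\<^sub>F (G \<circ>\<^sub>F F)"
  by (rule functor_comp_assoc) (auto simp: functor_from_to_def)

lemma OMap_functor_comp: "functor_from_to F A B \<Longrightarrow> a \<in> Obj A \<Longrightarrow> OMap (G \<circ>\<^sub>F F) a = OMap G (OMap F a)"
  by (simp add: functor_from_to_def functor_comp_def)

lemma AMap_functor_comp: "functor_from_to F A B \<Longrightarrow> f \<in> hom A a b \<Longrightarrow> AMap (G \<circ>\<^sub>F F) f = AMap G (AMap F f)"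
  by (simp add: functor_from_to_def functor_comp_def hom_def)

lemma id_functor_from_to: "category A \<Longrightarrow> functor_from_to (id_functor A) A A"
  unfolding id_functor_def
  by (rule functor_from_to_restrictI) (auto simp: hom_def)

lemma id_functor_left: "functor_from_to F A B \<Longrightarrow> id_functor B \<circ>\<^sub>F F = F"
  by (rule id_functor_comp) (auto simp: functor_from_to_def)

lemma OMap_id: "a \<in> Obj A \<Longrightarrow> OMap (id_functor A) a = a"
  by (simp add: id_functor_def)

lemma AMap_id: "f \<in> hom A a b \<Longrightarrow> AMap (id_functor A) f = f"
  by (simp add: id_functor_def hom_def)

lemma id_functor_right:
  assumes F: "functor_from_to F A B" shows "F \<circ>\<^sub>F id_functor A = F"
proof (rule functor_eqI)
  note A = functor_from_toD(4)[OF F]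
  show "functor_from_to (F \<circ>\<^sub>F id_functor A) A B" "functor_from_to F A B"
    using functor_comp_from_to[OF id_functor_from_to[OF A] F] F by auto
qed (use F in \<open>auto simp: functor_comp_def id_functor_def\<close>)

text \<open>
  A 2-cell of the ambient 2-category of categories. Recording the two categories as well as the
  two functors makes the pointwise typing of components available to every later calculation.
\<close>

definition nat_cell :: "('o1, 'm1, 'o2, 'm2) nt \<Rightarrow> ('o1, 'm1, 'o2, 'm2) ftor \<Rightarrow>
    ('o1, 'm1, 'o2, 'm2) ftor \<Rightarrow> ('o1, 'm1) cat \<Rightarrow> ('o2, 'm2) cat \<Rightarrow> bool" where
  "nat_cell \<sigma> F G A B \<longleftrightarrow>
     functor_from_to F A B \<and> functor_from_to G A B \<and> nat_trans_from_to \<sigma> F G"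

lemma nat_cellD:
  assumes "nat_cell \<sigma> F G A B"
  shows "functor_from_to F A B" "functor_from_to G A B" "nat_trans_from_to \<sigma> F G"
    "nat_trans \<sigma>" "NSrc \<sigma> = F" "NTrg \<sigma> = G"
  using assms by (auto simp: nat_cell_def nat_trans_from_to_def)

lemma nat_cell_iff_src:
  "functor_from_to F A B \<Longrightarrow> nat_cell \<sigma> F G A B \<longleftrightarrow> nat_trans_from_to \<sigma> F G"
  by (auto simp: nat_cell_def nat_trans_from_to_def functor_from_to_def
      nat_trans.NTrg_functor nat_trans.Src_eq nat_trans.Trg_eq)

lemma nat_cell_at:
  "nat_cell \<sigma> F G A B \<Longrightarrow> a \<in> Obj A \<Longrightarrow> NAt \<sigma> a \<in> hom B (OMap F a) (OMap G a)"
  using nat_trans.NAt_hom[of \<sigma> a] by (auto simp: nat_cell_def nat_trans_from_to_def functor_from_to_def)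

lemma nat_cell_natural:
  "nat_cell \<sigma> F G A B \<Longrightarrow> f \<in> hom A a b \<Longrightarrow>
    Comp B (NAt \<sigma> b) (AMap F f) = Comp B (AMap G f) (NAt \<sigma> a)"
  using nat_trans.naturality[of \<sigma> f a b]
  by (auto simp: nat_cell_def nat_trans_from_to_def functor_from_to_def)

lemma nat_cellI:
  assumes F: "functor_from_to F A B" and G: "functor_from_to G A B"
    and at: "\<And>a. a \<in> Obj A \<Longrightarrow> t a \<in> hom B (OMap F a) (OMap G a)"
    and nat: "\<And>f a b. f \<in> hom A a b \<Longrightarrow> Comp B (t b) (AMap F f) = Comp B (AMap G f) (t a)"
  shows "nat_cell \<lparr> NSrc = F, NTrg = G, NAt = restrict t (Obj A) \<rparr> F G A B"
proof -
  interpret A: category A by (rule functor_from_toD(4)[OF F])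
  have "nat_trans \<lparr> NSrc = F, NTrg = G, NAt = restrict t (Obj A) \<rparr>"
    using F G at nat by (auto simp: nat_trans_def functor_from_to_def A.hom_Obj)
  then show ?thesis using F G by (simp add: nat_cell_def nat_trans_from_to_def)
qed

lemma nat_cell_eqI:
  assumes s: "nat_cell \<sigma> F G A B" and t: "nat_cell \<tau> F G A B"
    and at: "\<And>a. a \<in> Obj A \<Longrightarrow> NAt \<sigma> a = NAt \<tau> a"
  shows "\<sigma> = \<tau>"
proof -
  have "NAt \<sigma> = NAt \<tau>"
    using nat_trans.NAt_ext[of \<sigma>] nat_trans.NAt_ext[of \<tau>] s t at
    by (intro extensionalityI[of _ "Obj A"]) (auto simp: nat_cell_def nat_trans_from_to_def
        functor_from_to_def)
  then show ?thesis using nat_cellD(5,6)[OF s] nat_cellD(5,6)[OF t] by simp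
qed

lemma nat_cell_id:
  assumes F: "functor_from_to F A B" shows "nat_cell (id_nt F) F F A B"
proof -
  interpret B: category B by (rule functor_from_toD(5)[OF F])
  have S: "Src F = A" "Trg F = B" using F by (simp_all add: functor_from_to_def)
  show ?thesis
    unfolding id_nt_def S
    by (rule nat_cellI[OF F F])
      (use functor_OMap[OF F] functor_AMap[OF F] in
        \<open>simp_all add: B.Ident_hom B.hom_Ident_left[OF functor_AMap[OF F]]
          B.hom_Ident_right[OF functor_AMap[OF F]]\<close>)
qed

lemma NAt_id_nt: "functor_from_to F A B \<Longrightarrow> a \<in> Obj A \<Longrightarrow> NAt (id_nt F) a = Ident B (OMap F a)"
  by (simp add: id_nt_def functor_from_to_def)

lemma NAt_vcomp: "nat_cell \<sigma> F G A B \<Longrightarrow> a \<in> Obj A \<Longrightarrow> NAt (\<tau> \<cdot> \<sigma>) a = Comp B (NAt \<tau> a) (NAt \<sigma> a)"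
  by (auto simp: vcomp_def nat_cell_def nat_trans_from_to_def functor_from_to_def)

lemma NAt_whisker_left:
  "nat_cell \<sigma> F G A B \<Longrightarrow> a \<in> Obj A \<Longrightarrow> NAt (H \<rhd> \<sigma>) a = AMap H (NAt \<sigma> a)"
  by (auto simp: whisker_left_def nat_cell_def nat_trans_from_to_def functor_from_to_def)

lemma NAt_whisker_right:
  "functor_from_to K A B \<Longrightarrow> a \<in> Obj A \<Longrightarrow> NAt (\<sigma> \<lhd> K) a = NAt \<sigma> (OMap K a)"
  by (auto simp: whisker_right_def functor_from_to_def)

lemma nat_cell_vcomp:
  assumes s: "nat_cell \<sigma> F G A B" and t: "nat_cell \<tau> G H A B"
  shows "nat_cell (\<tau> \<cdot> \<sigma>) F H A B"
proof -
  note F = nat_cellD(1)[OF s] and G = nat_cellD(2)[OF s] and H = nat_cellD(2)[OF t]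
  interpret A: category A by (rule functor_from_toD(4)[OF F])
  interpret B: category B by (rule functor_from_toD(5)[OF F])
  have "nat_cell \<lparr> NSrc = F, NTrg = H, NAt = (\<lambda>a\<in>Obj A. Comp B (NAt \<tau> a) (NAt \<sigma> a)) \<rparr> F H A B"
  proof (rule nat_cellI[OF F H])
    fix f a b assume f: "f \<in> hom A a b"
    note ab = A.hom_Obj[OF f]
    note h = nat_cell_at[OF s ab(1)] nat_cell_at[OF s ab(2)] nat_cell_at[OF t ab(1)]
      nat_cell_at[OF t ab(2)] functor_AMap[OF F f] functor_AMap[OF G f] functor_AMap[OF H f]
    have "Comp B (Comp B (NAt \<tau> b) (NAt \<sigma> b)) (AMap F f)
        = Comp B (NAt \<tau> b) (Comp B (AMap G f) (NAt \<sigma> a))"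
      using B.hom_assoc[OF h(5,2,4)] nat_cell_natural[OF s f] by simp
    also have "\<dots> = Comp B (Comp B (AMap H f) (NAt \<tau> a)) (NAt \<sigma> a)"
      using B.hom_assoc[OF h(1,6,4)] nat_cell_natural[OF t f] by simp
    also have "\<dots> = Comp B (AMap H f) (Comp B (NAt \<tau> a) (NAt \<sigma> a))"
      by (rule B.hom_assoc[OF h(1,3,7)])
    finally show "Comp B (Comp B (NAt \<tau> b) (NAt \<sigma> b)) (AMap F f)
        = Comp B (AMap H f) (Comp B (NAt \<tau> a) (NAt \<sigma> a))" .
  qed (rule B.Comp_in_hom[OF nat_cell_at[OF s] nat_cell_at[OF t]])
  moreover have "NSrc \<sigma> = F" "NTrg \<tau> = H" "Src F = A" "Trg F = B"
    using s t by (auto simp: nat_cell_def nat_trans_from_to_def functor_from_to_def)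
  ultimately show ?thesis by (simp add: vcomp_def)
qed

lemma nat_cell_whisker_left:
  assumes s: "nat_cell \<sigma> F G A B" and H: "functor_from_to H B C"
  shows "nat_cell (H \<rhd> \<sigma>) (H \<circ>\<^sub>F F) (H \<circ>\<^sub>F G) A C"
proof -
  note F = nat_cellD(1)[OF s] and G = nat_cellD(2)[OF s]
  interpret A: category A by (rule functor_from_toD(4)[OF F])
  have S: "NSrc \<sigma> = F" "NTrg \<sigma> = G" "Src F = A"
    using s by (auto simp: nat_cell_def nat_trans_from_to_def functor_from_to_def)
  show ?thesis unfolding whisker_left_def S
  proof (rule nat_cellI[OF functor_comp_from_to[OF F H] functor_comp_from_to[OF G H]])
    fix a assume a: "a \<in> Obj A"
    show "AMap H (NAt \<sigma> a) \<in> hom C (OMap (H \<circ>\<^sub>F F) a) (OMap (H \<circ>\<^sub>F G) a)"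
      using functor_AMap[OF H nat_cell_at[OF s a]] a
      by (simp add: OMap_functor_comp[OF F] OMap_functor_comp[OF G])
  next
    fix f a b assume f: "f \<in> hom A a b"
    note ab = A.hom_Obj[OF f]
    show "Comp C (AMap H (NAt \<sigma> b)) (AMap (H \<circ>\<^sub>F F) f) = Comp C (AMap (H \<circ>\<^sub>F G) f) (AMap H (NAt \<sigma> a))"
      using functor_Comp[OF H functor_AMap[OF F f] nat_cell_at[OF s ab(2)]]
        functor_Comp[OF H nat_cell_at[OF s ab(1)] functor_AMap[OF G f]] nat_cell_natural[OF s f] f
      by (simp add: AMap_functor_comp[OF F] AMap_functor_comp[OF G])
  qed
qed

lemma nat_cell_whisker_right:
  assumes K: "functor_from_to K A B" and s: "nat_cell \<sigma> F G B C"
  shows "nat_cell (\<sigma> \<lhd> K) (F \<circ>\<^sub>F K) (G \<circ>\<^sub>F K) A C"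
proof -
  note F = nat_cellD(1)[OF s] and G = nat_cellD(2)[OF s]
  interpret A: category A by (rule functor_from_toD(4)[OF K])
  have S: "NSrc \<sigma> = F" "NTrg \<sigma> = G" "Src K = A"
    using s K by (auto simp: nat_cell_def nat_trans_from_to_def functor_from_to_def)
  show ?thesis unfolding whisker_right_def S
    by (rule nat_cellI[OF functor_comp_from_to[OF K F] functor_comp_from_to[OF K G]])
      (use nat_cell_at[OF s functor_OMap[OF K]] nat_cell_natural[OF s functor_AMap[OF K]] in
        \<open>auto simp: OMap_functor_comp[OF K] AMap_functor_comp[OF K]\<close>)
qed

lemma nat_cell_hcomp:
  assumes s: "nat_cell \<sigma> F F' A B" and t: "nat_cell \<tau> G G' B C"
  shows "nat_cell (\<tau> \<star> \<sigma>) (G \<circ>\<^sub>F F) (G' \<circ>\<^sub>F F') A C"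
proof -
  have S: "NTrg \<sigma> = F'" "NSrc \<tau> = G" using nat_cellD[OF s] nat_cellD[OF t] by simp_all
  show ?thesis unfolding hcomp_def S
    by (rule nat_cell_vcomp[OF nat_cell_whisker_left[OF s nat_cellD(1)[OF t]]
          nat_cell_whisker_right[OF nat_cellD(2)[OF s] t]])
qed

lemma NAt_hcomp:
  assumes s: "nat_cell \<sigma> F F' A B" and t: "nat_cell \<tau> G G' B C" and a: "a \<in> Obj A"
  shows "NAt (\<tau> \<star> \<sigma>) a = Comp C (NAt \<tau> (OMap F' a)) (AMap G (NAt \<sigma> a))"
proof -
  have S: "NTrg \<sigma> = F'" "NSrc \<tau> = G" using nat_cellD[OF s] nat_cellD[OF t] by simp_all
  show ?thesis unfolding hcomp_def S
    using a by (simp add: NAt_vcomp[OF nat_cell_whisker_left[OF s nat_cellD(1)[OF t]]]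
      NAt_whisker_left[OF s] NAt_whisker_right[OF nat_cellD(2)[OF s]])
qed

section \<open>The 2-category laws for natural transformations\<close>

lemma vcomp_assoc:
  assumes s: "nat_cell \<sigma> F G A B" and t: "nat_cell \<tau> G H A B" and u: "nat_cell \<upsilon> H K A B"
  shows "(\<upsilon> \<cdot> \<tau>) \<cdot> \<sigma> = \<upsilon> \<cdot> \<tau> \<cdot> \<sigma>"
proof -
  interpret B: category B by (rule functor_from_toD(5)[OF nat_cellD(1)[OF s]])
  show ?thesis
    by (rule nat_cell_eqI[OF nat_cell_vcomp[OF s nat_cell_vcomp[OF t u]]
          nat_cell_vcomp[OF nat_cell_vcomp[OF s t] u]])
      (simp add: NAt_vcomp[OF s] NAt_vcomp[OF t] NAt_vcomp[OF nat_cell_vcomp[OF s t]]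
        B.hom_assoc[OF nat_cell_at[OF s] nat_cell_at[OF t] nat_cell_at[OF u]])
qed

lemma vcomp_id_left:
  assumes s: "nat_cell \<sigma> F G A B" shows "id_nt G \<cdot> \<sigma> = \<sigma>"
proof -
  note G = nat_cellD(2)[OF s]
  interpret B: category B by (rule functor_from_toD(5)[OF G])
  show ?thesis
    by (rule nat_cell_eqI[OF nat_cell_vcomp[OF s nat_cell_id[OF G]] s])
      (simp add: NAt_vcomp[OF s] NAt_id_nt[OF G] B.hom_Ident_left[OF nat_cell_at[OF s]])
qed

lemma vcomp_id_right:
  assumes s: "nat_cell \<sigma> F G A B" shows "\<sigma> \<cdot> id_nt F = \<sigma>"
proof -
  note F = nat_cellD(1)[OF s]
  interpret B: category B by (rule functor_from_toD(5)[OF F])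
  show ?thesis
    by (rule nat_cell_eqI[OF nat_cell_vcomp[OF nat_cell_id[OF F] s] s])
      (simp add: NAt_vcomp[OF nat_cell_id[OF F]] NAt_id_nt[OF F] B.hom_Ident_right[OF nat_cell_at[OF
          s]])
qed

lemma hcomp_id_nt:
  assumes F: "functor_from_to F A B" and G: "functor_from_to G B C"
  shows "id_nt G \<star> id_nt F = id_nt (G \<circ>\<^sub>F F)"
proof -
  note i = nat_cell_id[OF F] and j = nat_cell_id[OF G] and GF = functor_comp_from_to[OF F G]
  interpret C: category C by (rule functor_from_toD(5)[OF G])
  show ?thesis
  proof (rule nat_cell_eqI[OF nat_cell_hcomp[OF i j] nat_cell_id[OF GF]])
    fix a assume a: "a \<in> Obj A"
    note Fa = functor_OMap[OF F a]
    show "NAt (id_nt G \<star> id_nt F) a = NAt (id_nt (G \<circ>\<^sub>F F)) a"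
      using a Fa C.hom_Ident_left[OF C.Ident_hom[OF functor_OMap[OF G Fa]]]
      by (simp add: NAt_hcomp[OF i j] NAt_id_nt[OF F] NAt_id_nt[OF G] NAt_id_nt[OF GF]
          functor_Ident[OF G] OMap_functor_comp[OF F])
  qed
qed

lemma hcomp_unit_left:
  assumes s: "nat_cell \<sigma> F G A B" shows "id_nt (id_functor B) \<star> \<sigma> = \<sigma>"
proof -
  interpret B: category B by (rule functor_from_toD(5)[OF nat_cellD(1)[OF s]])
  note I = id_functor_from_to[OF B.category_axioms]
  note ic = nat_cell_id[OF I]
  have c: "nat_cell (id_nt (id_functor B) \<star> \<sigma>) F G A B"
    using nat_cell_hcomp[OF s ic] by (simp add: id_functor_left[OF nat_cellD(1)[OF s]]
        id_functor_left[OF nat_cellD(2)[OF s]])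
  show ?thesis
  proof (rule nat_cell_eqI[OF c s])
    fix a assume a: "a \<in> Obj A"
    note h = nat_cell_at[OF s a]
    show "NAt (id_nt (id_functor B) \<star> \<sigma>) a = NAt \<sigma> a"
      by (simp add: NAt_hcomp[OF s ic a] AMap_id[OF h] NAt_id_nt[OF I] B.hom_Obj[OF h] OMap_id
          B.hom_Ident_left[OF h])
  qed
qed

lemma hcomp_id_right:
  assumes F: "functor_from_to F A B" and t: "nat_cell \<tau> G H B C"
  shows "\<tau> \<star> id_nt F = \<tau> \<lhd> F"
proof -
  note ic = nat_cell_id[OF F]
  interpret C: category C by (rule functor_from_toD(5)[OF nat_cellD(1)[OF t]])
  show ?thesis
  proof (rule nat_cell_eqI[OF nat_cell_hcomp[OF ic t] nat_cell_whisker_right[OF F t]])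
    fix a assume a: "a \<in> Obj A"
    note Fa = functor_OMap[OF F a]
    show "NAt (\<tau> \<star> id_nt F) a = NAt (\<tau> \<lhd> F) a"
      using a Fa C.hom_Ident_right[OF nat_cell_at[OF t Fa]]
      by (simp add: NAt_hcomp[OF ic t] NAt_id_nt[OF F] functor_Ident[OF nat_cellD(1)[OF t]]
          NAt_whisker_right[OF F])
  qed
qed

lemma whisker_right_unit:
  assumes t: "nat_cell \<tau> G H A B" shows "\<tau> \<lhd> id_functor A = \<tau>"
proof -
  note G = nat_cellD(1)[OF t] and H = nat_cellD(2)[OF t]
  note I = id_functor_from_to[OF functor_from_toD(4)[OF G]]
  have c: "nat_cell (\<tau> \<lhd> id_functor A) G H A B"
    using nat_cell_whisker_right[OF I t] by (simp add: id_functor_right[OF G] id_functor_right[OF H])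
  show ?thesis by (rule nat_cell_eqI[OF c t]) (simp add: NAt_whisker_right[OF I] OMap_id)
qed

lemma hcomp_unit_right:
  assumes s: "nat_cell \<sigma> F G A B" shows "\<sigma> \<star> id_nt (id_functor A) = \<sigma>"
  using hcomp_id_right[OF id_functor_from_to s] whisker_right_unit[OF s]
    functor_from_toD(4)[OF nat_cellD(1)[OF s]] by simp

lemma whisker_left_id_nt:
  assumes F: "functor_from_to F A B" and G: "functor_from_to G B C"
  shows "G \<rhd> id_nt F = id_nt (G \<circ>\<^sub>F F)"
  by (rule nat_cell_eqI[OF nat_cell_whisker_left[OF nat_cell_id[OF F] G] nat_cell_id[OF
      functor_comp_from_to[OF F G]]])
    (simp add: NAt_whisker_left[OF nat_cell_id[OF F]] NAt_id_nt[OF F] functor_OMap[OF F]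
        functor_Ident[OF G]
      NAt_id_nt[OF functor_comp_from_to[OF F G]] OMap_functor_comp[OF F])

lemma whisker_right_id_nt:
  assumes F: "functor_from_to F A B" and G: "functor_from_to G B C"
  shows "id_nt G \<lhd> F = id_nt (G \<circ>\<^sub>F F)"
  using hcomp_id_right[OF F nat_cell_id[OF G]] hcomp_id_nt[OF F G] by simp

lemma hcomp_assoc:
  assumes r: "nat_cell \<rho> F F' A B" and s: "nat_cell \<sigma> G G' B C" and t: "nat_cell \<tau> H H' C D"
  shows "\<tau> \<star> \<sigma> \<star> \<rho> = (\<tau> \<star> \<sigma>) \<star> \<rho>"
proof -
  note F' = nat_cellD(2)[OF r] and G = nat_cellD(1)[OF s] and G' = nat_cellD(2)[OF s]
  note H = nat_cellD(1)[OF t]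
  note sr = nat_cell_hcomp[OF r s] and ts = nat_cell_hcomp[OF s t]
  interpret D: category D by (rule functor_from_toD(5)[OF nat_cellD(1)[OF t]])
  have c: "nat_cell (\<tau> \<star> \<sigma> \<star> \<rho>) ((H \<circ>\<^sub>F G) \<circ>\<^sub>F F) ((H' \<circ>\<^sub>F G') \<circ>\<^sub>F F') A D"
    using nat_cell_hcomp[OF sr t]
    by (simp add: functor_comp_assoc_from_to[OF nat_cellD(1)[OF r] G] functor_comp_assoc_from_to[OF
        F' G'])
  show ?thesis
  proof (rule nat_cell_eqI[OF c nat_cell_hcomp[OF r ts]])
    fix a assume a: "a \<in> Obj A"
    note ra = nat_cell_at[OF r a]
    note b = functor_OMap[OF F' a]
    note sb = nat_cell_at[OF s b] and Gr = functor_AMap[OF G ra]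
    have 1: "NAt (\<tau> \<star> \<sigma> \<star> \<rho>) a = Comp D (NAt \<tau> (OMap G' (OMap F' a)))
        (Comp D (AMap H (NAt \<sigma> (OMap F' a))) (AMap H (AMap G (NAt \<rho> a))))"
      using a by (simp add: NAt_hcomp[OF sr t] OMap_functor_comp[OF F'] NAt_hcomp[OF r s]
          functor_Comp[OF H Gr sb])
    have 2: "NAt ((\<tau> \<star> \<sigma>) \<star> \<rho>) a = Comp D (Comp D (NAt \<tau> (OMap G' (OMap F' a)))
        (AMap H (NAt \<sigma> (OMap F' a)))) (AMap H (AMap G (NAt \<rho> a)))"
      using a b by (simp add: NAt_hcomp[OF r ts] NAt_hcomp[OF s t] AMap_functor_comp[OF G ra])
    show "NAt (\<tau> \<star> \<sigma> \<star> \<rho>) a = NAt ((\<tau> \<star> \<sigma>) \<star> \<rho>) a"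
      unfolding 1 2
      by (rule D.hom_assoc[OF functor_AMap[OF H Gr] functor_AMap[OF H sb]
            nat_cell_at[OF t functor_OMap[OF G' b]], symmetric])
  qed
qed

text \<open>
  At an object the two sides differ only in their two middle arrows, which are the two ways around
  the naturality square of \<open>\<tau>\<close> at a component of \<open>\<sigma>'\<close>.
\<close>

lemma interchange:
  assumes s: "nat_cell \<sigma> F F' A B" and s': "nat_cell \<sigma>' F' F'' A B"
    and t: "nat_cell \<tau> G G' B C" and t': "nat_cell \<tau>' G' G'' B C"
  shows "(\<tau>' \<cdot> \<tau>) \<star> (\<sigma>' \<cdot> \<sigma>) = (\<tau>' \<star> \<sigma>') \<cdot> (\<tau> \<star> \<sigma>)"
proof -
  note F' = nat_cellD(2)[OF s] and F'' = nat_cellD(2)[OF s'] and G = nat_cellD(1)[OF t]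
    and G' = nat_cellD(2)[OF t]
  note ss = nat_cell_vcomp[OF s s'] and tt = nat_cell_vcomp[OF t t']
    and ts = nat_cell_hcomp[OF s t] and ts' = nat_cell_hcomp[OF s' t']
  interpret C: category C by (rule functor_from_toD(5)[OF G])
  show ?thesis
  proof (rule nat_cell_eqI[OF nat_cell_hcomp[OF ss tt] nat_cell_vcomp[OF ts ts']])
    fix a assume a: "a \<in> Obj A"
    note sa = nat_cell_at[OF s a] and sa' = nat_cell_at[OF s' a]
    note b = functor_OMap[OF F' a] and b' = functor_OMap[OF F'' a]
    note t1 = nat_cell_at[OF t b] and t2 = nat_cell_at[OF t b'] and t3 = nat_cell_at[OF t' b']
    note g1 = functor_AMap[OF G sa] and g2 = functor_AMap[OF G sa'] and g3 = functor_AMap[OF G' sa']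
    have "NAt ((\<tau>' \<cdot> \<tau>) \<star> (\<sigma>' \<cdot> \<sigma>)) a =
        Comp C (Comp C (NAt \<tau>' (OMap F'' a)) (NAt \<tau> (OMap F'' a)))
          (Comp C (AMap G (NAt \<sigma>' a)) (AMap G (NAt \<sigma> a)))"
      using a b' by (simp add: NAt_hcomp[OF ss tt] NAt_vcomp[OF s] NAt_vcomp[OF t] functor_Comp[OF G
          sa sa'])
    also have "\<dots> = Comp C (NAt \<tau>' (OMap F'' a)) (Comp C (Comp C (NAt \<tau> (OMap F'' a))
        (AMap G (NAt \<sigma>' a))) (AMap G (NAt \<sigma> a)))"
      by (simp add: C.hom_assoc[OF C.Comp_in_hom[OF g1 g2] t2 t3] C.hom_assoc[OF g1 g2 t2])
    also have "\<dots> = Comp C (NAt \<tau>' (OMap F'' a)) (Comp C (Comp C (AMap G' (NAt \<sigma>' a))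
        (NAt \<tau> (OMap F' a))) (AMap G (NAt \<sigma> a)))"
      by (simp add: nat_cell_natural[OF t sa'])
    also have "\<dots> = Comp C (Comp C (NAt \<tau>' (OMap F'' a)) (AMap G' (NAt \<sigma>' a)))
        (Comp C (NAt \<tau> (OMap F' a)) (AMap G (NAt \<sigma> a)))"
      by (simp add: C.hom_assoc[OF C.Comp_in_hom[OF g1 t1] g3 t3] C.hom_assoc[OF g1 t1 g3])
    also have "\<dots> = NAt ((\<tau>' \<star> \<sigma>') \<cdot> (\<tau> \<star> \<sigma>)) a"
      using a by (simp add: NAt_vcomp[OF ts] NAt_hcomp[OF s t] NAt_hcomp[OF s' t'])
    finally show "NAt ((\<tau>' \<cdot> \<tau>) \<star> (\<sigma>' \<cdot> \<sigma>)) a = NAt ((\<tau>' \<star> \<sigma>') \<cdot> (\<tau> \<star> \<sigma>)) a" .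
  qed
qed

lemma whisker_left_vcomp:
  assumes s: "nat_cell \<sigma> F G A B" and t: "nat_cell \<tau> G H A B" and K: "functor_from_to K B C"
  shows "K \<rhd> (\<tau> \<cdot> \<sigma>) = (K \<rhd> \<tau>) \<cdot> (K \<rhd> \<sigma>)"
  by (rule nat_cell_eqI[OF nat_cell_whisker_left[OF nat_cell_vcomp[OF s t] K]
        nat_cell_vcomp[OF nat_cell_whisker_left[OF s K] nat_cell_whisker_left[OF t K]]])
    (simp add: NAt_whisker_left[OF nat_cell_vcomp[OF s t]] NAt_vcomp[OF s]
      NAt_vcomp[OF nat_cell_whisker_left[OF s K]] NAt_whisker_left[OF s] NAt_whisker_left[OF t]
      functor_Comp[OF K nat_cell_at[OF s] nat_cell_at[OF t]])

lemma whisker_right_vcomp: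
  assumes K: "functor_from_to K A B" and s: "nat_cell \<sigma> F G B C" and t: "nat_cell \<tau> G H B C"
  shows "(\<tau> \<cdot> \<sigma>) \<lhd> K = (\<tau> \<lhd> K) \<cdot> (\<sigma> \<lhd> K)"
  by (rule nat_cell_eqI[OF nat_cell_whisker_right[OF K nat_cell_vcomp[OF s t]]
        nat_cell_vcomp[OF nat_cell_whisker_right[OF K s] nat_cell_whisker_right[OF K t]]])
    (simp add: NAt_whisker_right[OF K] NAt_vcomp[OF s] NAt_vcomp[OF nat_cell_whisker_right[OF K s]]
      functor_OMap[OF K])

lemma whisker_left_unit:
  assumes s: "nat_cell \<sigma> F G A B" shows "id_functor B \<rhd> \<sigma> = \<sigma>"
proof -
  note F = nat_cellD(1)[OF s] and G = nat_cellD(2)[OF s]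
  note I = id_functor_from_to[OF functor_from_toD(5)[OF F]]
  have c: "nat_cell (id_functor B \<rhd> \<sigma>) F G A B"
    using nat_cell_whisker_left[OF s I] by (simp add: id_functor_left[OF F] id_functor_left[OF G])
  show ?thesis
    by (rule nat_cell_eqI[OF c s]) (simp add: NAt_whisker_left[OF s] AMap_id[OF nat_cell_at[OF s]])
qed

lemma whisker_right_comp:
  assumes F: "functor_from_to F A B" and G: "functor_from_to G B C" and s: "nat_cell \<sigma> H K C D"
  shows "\<sigma> \<lhd> (G \<circ>\<^sub>F F) = \<sigma> \<lhd> G \<lhd> F"
proof (rule nat_cell_eqI[OF nat_cell_whisker_right[OF functor_comp_from_to[OF F G] s]])
  show "nat_cell (\<sigma> \<lhd> G \<lhd> F) (H \<circ>\<^sub>F G \<circ>\<^sub>F F) (K \<circ>\<^sub>F G \<circ>\<^sub>F F) A D"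
    using nat_cell_whisker_right[OF F nat_cell_whisker_right[OF G s]]
    by (simp add: functor_comp_assoc_from_to[OF F G])
qed (simp add: NAt_whisker_right[OF functor_comp_from_to[OF F G]] NAt_whisker_right[OF F]
    NAt_whisker_right[OF G] OMap_functor_comp[OF F] functor_OMap[OF F])

section \<open>Fibrations are closed under composition\<close>

lemma cartesian_arrowD:
  assumes "cartesian_arrow p f" and "functor_from_to p A B"
    and "f \<in> hom A a b" "g \<in> hom A c b" "u \<in> hom B (OMap p c) (OMap p a)"
    and "Comp B (AMap p f) u = AMap p g"
  shows "\<exists>!v. v \<in> hom A c a \<and> AMap p v = u \<and> Comp A f v = g"
proof -
  have "\<forall>g u. g \<in> Arr A \<and> Cod A g = Cod A f \<and> u \<in> hom B (OMap p (Dom A g)) (OMap p (Dom A f)) \<and>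
        Comp B (AMap p f) u = AMap p g \<longrightarrow>
        (\<exists>!v. v \<in> hom A (Dom A g) (Dom A f) \<and> AMap p v = u \<and> Comp A f v = g)"
    using assms(1,2) by (simp add: cartesian_arrow_def functor_from_to_def)
  from this[rule_format, of g u] show ?thesis using assms(3-6) by (auto simp: hom_def)
qed

lemma cartesian_arrowI:
  assumes "functor_from_to p A B" and "f \<in> hom A a b"
    and "\<And>g c u. g \<in> hom A c b \<Longrightarrow> u \<in> hom B (OMap p c) (OMap p a) \<Longrightarrow>
      Comp B (AMap p f) u = AMap p g \<Longrightarrow> \<exists>!v. v \<in> hom A c a \<and> AMap p v = u \<and> Comp A f v = g"
  shows "cartesian_arrow p f"
proof -
  have "\<exists>!v. v \<in> hom A (Dom A g) a \<and> AMap p v = u \<and> Comp A f v = g"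
    if "g \<in> Arr A" "Cod A g = b" "u \<in> hom B (OMap p (Dom A g)) (OMap p a)"
      "Comp B (AMap p f) u = AMap p g" for g u
    using that assms(3)[of g "Dom A g" u] by (simp add: hom_def)
  then show ?thesis using assms(1,2) in_homD[OF assms(2)]
    by (simp add: cartesian_arrow_def functor_from_to_def)
qed

text \<open>
  A factorization problem over the base of \<open>q\<close> is lifted in two stages: \<open>q\<close> gives the only possible
  image under \<open>p\<close>, and \<open>p\<close> then gives the only arrow with that image.
\<close>

lemma cartesian_arrow_functor_comp:
  assumes p: "functor_from_to p A B" and q: "functor_from_to q B C"
    and f: "f \<in> hom A a b" and cp: "cartesian_arrow p f" and cq: "cartesian_arrow q (AMap p f)"
  shows "cartesian_arrow (q \<circ>\<^sub>F p) f"
proof (rule cartesian_arrowI[OF functor_comp_from_to[OF p q] f])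
  interpret A: category A by (rule functor_from_toD(4)[OF p])
  note pf = functor_AMap[OF p f]
  fix g c u
  assume g: "g \<in> hom A c b" and u: "u \<in> hom C (OMap (q \<circ>\<^sub>F p) c) (OMap (q \<circ>\<^sub>F p) a)"
    and eq: "Comp C (AMap (q \<circ>\<^sub>F p) f) u = AMap (q \<circ>\<^sub>F p) g"
  have u': "u \<in> hom C (OMap q (OMap p c)) (OMap q (OMap p a))"
    using u by (simp add: OMap_functor_comp[OF p] A.hom_Obj[OF f] A.hom_Obj[OF g])
  have eq': "Comp C (AMap q (AMap p f)) u = AMap q (AMap p g)"
    using eq by (simp add: AMap_functor_comp[OF p f] AMap_functor_comp[OF p g])
  obtain w where w: "w \<in> hom B (OMap p c) (OMap p a)" "AMap q w = u" "Comp B (AMap p f) w = AMap p g"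
    and w_unique: "\<And>w'. w' \<in> hom B (OMap p c) (OMap p a) \<and> AMap q w' = u \<and>
      Comp B (AMap p f) w' = AMap p g \<Longrightarrow> w' = w"
    using cartesian_arrowD[OF cq q pf functor_AMap[OF p g] u' eq'] by blast
  have "\<exists>!v. v \<in> hom A c a \<and> AMap p v = w \<and> Comp A f v = g"
    by (rule cartesian_arrowD[OF cp p f g w(1,3)])
  moreover have "AMap (q \<circ>\<^sub>F p) v = u \<longleftrightarrow> AMap p v = w" if v: "v \<in> hom A c a" and fv: "Comp A f v = g"
      for v
  proof -
    have "Comp B (AMap p f) (AMap p v) = AMap p g" using functor_Comp[OF p v f] fv by simp
    then show ?thesis using w(2) w_unique[of "AMap p v"] functor_AMap[OF p v]
      by (auto simp: AMap_functor_comp[OF p v])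
  qed
  ultimately show "\<exists>!v. v \<in> hom A c a \<and> AMap (q \<circ>\<^sub>F p) v = u \<and> Comp A f v = g"
    by (simp only: Ex1_def) blast
qed

lemma fibration_functor: "fibration p \<Longrightarrow> functor_from_to p (Src p) (Trg p)"
  by (simp add: fibration_def functor_from_to_def)

lemma fibration_lift:
  assumes "fibration p" and "functor_from_to p A B" and "a \<in> Obj A" "f \<in> hom B b (OMap p a)"
  obtains a' f' where "cartesian_arrow p f'" "f' \<in> hom A a' a" "AMap p f' = f"
proof -
  obtain f' where f': "cartesian_arrow p f'" "Cod A f' = a" "AMap p f' = f"
    using assms by (auto simp: fibration_def functor_from_to_def hom_def)
  then have "f' \<in> hom A (Dom A f') a"
    using assms(2) by (auto simp: cartesian_arrow_def functor_from_to_def hom_def)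
  then show thesis using f' that by blast
qed

lemma fibrationI:
  assumes p: "functor_from_to p A B"
    and "\<And>a b f. a \<in> Obj A \<Longrightarrow> f \<in> hom B b (OMap p a) \<Longrightarrow>
      \<exists>a' f'. cartesian_arrow p f' \<and> f' \<in> hom A a' a \<and> AMap p f' = f"
  shows "fibration p"
  unfolding fibration_def functor_from_toD(2,3)[OF p]
proof (intro conjI ballI impI)
  fix a f assume "a \<in> Obj A" "f \<in> Arr B" "Cod B f = OMap p a"
  then obtain a' f' where "cartesian_arrow p f'" "f' \<in> hom A a' a" "AMap p f' = f"
    using assms(2)[of a f "Dom B f"] by (auto simp: hom_def)
  then show "\<exists>f'. cartesian_arrow p f' \<and> Cod A f' = a \<and> AMap p f' = f"
    by (auto simp: hom_def)
qed (rule functor_from_toD(1)[OF p])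

lemma fibration_functor_comp:
  assumes p: "fibration p" and q: "fibration q" and eq: "Trg p = Src q"
  shows "fibration (q \<circ>\<^sub>F p)"
proof -
  note fp = fibration_functor[OF p] and fq = fibration_functor[OF q, folded eq]
  show ?thesis
  proof (rule fibrationI[OF functor_comp_from_to[OF fp fq]])
    fix a b f assume a: "a \<in> Obj (Src p)" and f: "f \<in> hom (Trg q) b (OMap (q \<circ>\<^sub>F p) a)"
    have "f \<in> hom (Trg q) b (OMap q (OMap p a))" using f a by (simp add: OMap_functor_comp[OF fp])
    then obtain b' f' where f': "cartesian_arrow q f'" "f' \<in> hom (Trg p) b' (OMap p a)" "AMap q f' = f"
      by (rule fibration_lift[OF q fq functor_OMap[OF fp a]])
    obtain a' f'' where f'': "cartesian_arrow p f''" "f'' \<in> hom (Src p) a' a" "AMap p f'' = f'"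
      by (rule fibration_lift[OF p fp a f'(2)])
    have "cartesian_arrow (q \<circ>\<^sub>F p) f''"
      by (rule cartesian_arrow_functor_comp[OF fp fq f''(2,1)]) (simp add: f'' f')
    then show "\<exists>a' f'. cartesian_arrow (q \<circ>\<^sub>F p) f' \<and> f' \<in> hom (Src p) a' a \<and> AMap (q \<circ>\<^sub>F p) f' = f"
      using f'' f'(3) AMap_functor_comp[OF fp f''(2)] by auto
  qed
qed

lemma fibration_comp:
  "fibration p \<Longrightarrow> functor_from_to p A B \<Longrightarrow> fibration q \<Longrightarrow> functor_from_to q B C \<Longrightarrow>
    fibration (q \<circ>\<^sub>F p)"
  by (rule fibration_functor_comp) (simp_all add: functor_from_to_def)

lemma fibration_id_functor:
  assumes "category A" shows "fibration (id_functor A)"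
proof -
  interpret category A by (rule assms)
  note I = id_functor_from_to[OF assms]
  show ?thesis
  proof (rule fibrationI[OF I])
    fix a b f assume "a \<in> Obj A" and "f \<in> hom A b (OMap (id_functor A) a)"
    then have f: "f \<in> hom A b a" by (simp add: OMap_id)
    have "\<exists>!v. v \<in> hom A c b \<and> AMap (id_functor A) v = u \<and> Comp A f v = g"
      if g: "g \<in> hom A c a" and u: "u \<in> hom A (OMap (id_functor A) c) (OMap (id_functor A) b)"
        and eq: "Comp A (AMap (id_functor A) f) u = AMap (id_functor A) g" for g c u
    proof (rule ex1I)
      have "u \<in> hom A c b" using u hom_Obj(1)[OF f] hom_Obj(1)[OF g] by (simp add: OMap_id)
      then show "u \<in> hom A c b \<and> AMap (id_functor A) u = u \<and> Comp A f u = g"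
        using eq by (simp only: AMap_id[OF f] AMap_id[OF g] AMap_id[of u A c b] simp_thms)
    qed (use AMap_id[of _ A c b] in force)
    then have "cartesian_arrow (id_functor A) f" by (rule cartesian_arrowI[OF I f])
    then show "\<exists>a' f'. cartesian_arrow (id_functor A) f' \<and> f' \<in> hom A a' a \<and> AMap (id_functor A) f' = f"
      using f AMap_id[OF f] by blast
  qed
qed

section \<open>Product categories and strict pullbacks\<close>

lemma prod_cat_simps:
  "Obj (prod_cat C D) = Obj C \<times> Obj D"
  "Arr (prod_cat C D) = Arr C \<times> Arr D"
  by (simp_all add: prod_cat_def)

lemma prod_cat_hom:
  "(f, g) \<in> hom (prod_cat C D) (a, a') (b, b') \<longleftrightarrow> f \<in> hom C a b \<and> g \<in> hom D a' b'"
  by (auto simp: prod_cat_def hom_def)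

lemma prod_cat_Ident:
  "a \<in> Obj C \<Longrightarrow> b \<in> Obj D \<Longrightarrow> Ident (prod_cat C D) (a, b) = (Ident C a, Ident D b)"
  by (simp add: prod_cat_def)

lemma prod_cat_Comp:
  "f \<in> hom C a b \<Longrightarrow> f' \<in> hom C b c \<Longrightarrow> g \<in> hom D a' b' \<Longrightarrow> g' \<in> hom D b' c' \<Longrightarrow>
    Comp (prod_cat C D) (f', g') (f, g) = (Comp C f' f, Comp D g' g)"
  by (simp add: prod_cat_def composable_def hom_def)

lemma prod_cat_category:
  assumes C: "category C" and D: "category D"
  shows "category (prod_cat C D)"
proof -
  interpret C: category C by (rule C)
  interpret D: category D by (rule D)
  show ?thesis
  proof (rule categoryI, goal_cases)
    case 6 then show ?case
      by (auto simp: prod_cat_def composable_def split: prod.splits)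
  next
    case (7 f g x y z)
    then show ?case
      by (cases f; cases g; cases x; cases y; cases z)
        (auto simp: prod_cat_hom prod_cat_Comp intro: C.Comp_in_hom D.Comp_in_hom)
  next
    case (8 f x y)
    obtain f1 f2 a a' b b' where e: "f = (f1, f2)" "x = (a, a')" "y = (b, b')"
      by (metis surj_pair)
    have h: "f1 \<in> hom C a b" "f2 \<in> hom D a' b'" using 8 by (simp_all add: e prod_cat_hom)
    show ?case
      using prod_cat_Comp[OF h(1) C.Ident_hom h(2) D.Ident_hom]
      by (simp add: e C.hom_Obj[OF h(1)] D.hom_Obj[OF h(2)] prod_cat_Ident
          C.hom_Ident_left[OF h(1)] D.hom_Ident_left[OF h(2)])
  next
    case (9 f x y)
    obtain f1 f2 a a' b b' where e: "f = (f1, f2)" "x = (a, a')" "y = (b, b')"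
      by (metis surj_pair)
    have h: "f1 \<in> hom C a b" "f2 \<in> hom D a' b'" using 9 by (simp_all add: e prod_cat_hom)
    show ?case
      using prod_cat_Comp[OF C.Ident_hom h(1) D.Ident_hom h(2)]
      by (simp add: e C.hom_Obj[OF h(1)] D.hom_Obj[OF h(2)] prod_cat_Ident
          C.hom_Ident_right[OF h(1)] D.hom_Ident_right[OF h(2)])
  next
    case (10 f g h x y z w)
    obtain f1 f2 a a' b b' g1 g2 c c' h1 h2 d d'
      where e: "f = (f1, f2)" "x = (a, a')" "y = (b, b')" "g = (g1, g2)" "z = (c, c')"
        "h = (h1, h2)" "w = (d, d')"
      by (metis surj_pair)
    have f: "f1 \<in> hom C a b" "f2 \<in> hom D a' b'" and g: "g1 \<in> hom C b c" "g2 \<in> hom D b' c'"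
      and h: "h1 \<in> hom C c d" "h2 \<in> hom D c' d'"
      using 10 by (simp_all add: e prod_cat_hom)
    show ?case
      by (simp add: e prod_cat_Comp[OF f(1) g(1) f(2) g(2)] prod_cat_Comp[OF g(1) h(1) g(2) h(2)]
          prod_cat_Comp[OF C.Comp_in_hom[OF f(1) g(1)] h(1) D.Comp_in_hom[OF f(2) g(2)] h(2)]
          prod_cat_Comp[OF f(1) C.Comp_in_hom[OF g(1) h(1)] f(2) D.Comp_in_hom[OF g(2) h(2)]]
          C.hom_assoc[OF f(1) g(1) h(1)] D.hom_assoc[OF f(2) g(2) h(2)])
  qed (auto simp: prod_cat_def hom_def C.Dom_in_Obj C.Cod_in_Obj D.Dom_in_Obj D.Cod_in_Obj
      C.Ident_hom[unfolded hom_def, simplified] D.Ident_hom[unfolded hom_def, simplified])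
qed

lemma fibre_prod_simps:
  assumes "functor_from_to F A C" "functor_from_to G B C"
  shows "Obj (fibre_prod F G) = {(a, b). a \<in> Obj A \<and> b \<in> Obj B \<and> OMap F a = OMap G b}"
    and "Arr (fibre_prod F G) = {(f, g). f \<in> Arr A \<and> g \<in> Arr B \<and> AMap F f = AMap G g}"
  using assms by (auto simp: fibre_prod_def functor_from_to_def Let_def)

lemma fibre_prod_hom:
  assumes "functor_from_to F A C" "functor_from_to G B C"
  shows "(f, g) \<in> hom (fibre_prod F G) (a, a') (b, b') \<longleftrightarrow>
    f \<in> hom A a b \<and> g \<in> hom B a' b' \<and> AMap F f = AMap G g"
  using assms by (auto simp: fibre_prod_def functor_from_to_def Let_def hom_def prod_cat_def)

lemma fibre_prod_Ident:
  assumes "functor_from_to F A C" "functor_from_to G B C"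
    and "a \<in> Obj A" "b \<in> Obj B" "OMap F a = OMap G b"
  shows "Ident (fibre_prod F G) (a, b) = (Ident A a, Ident B b)"
  using assms by (simp add: fibre_prod_def functor_from_to_def Let_def prod_cat_def)

lemma fibre_prod_Comp:
  assumes "functor_from_to F A C" "functor_from_to G B C"
    and "f \<in> hom A a b" "f' \<in> hom A b c" "g \<in> hom B a' b'" "g' \<in> hom B b' c'"
    and "AMap F f = AMap G g" "AMap F f' = AMap G g'"
  shows "Comp (fibre_prod F G) (f', g') (f, g) = (Comp A f' f, Comp B g' g)"
  using assms
  by (simp add: fibre_prod_def functor_from_to_def Let_def prod_cat_def hom_def composable_def)

lemma fibre_prod_category:
  assumes F: "functor_from_to F A C" and G: "functor_from_to G B C"
  shows "category (fibre_prod F G)"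
proof -
  interpret A: category A by (rule functor_from_toD(4)[OF F])
  interpret B: category B by (rule functor_from_toD(4)[OF G])
  note simps = fibre_prod_simps[OF F G] fibre_prod_hom[OF F G]
    fibre_prod_Ident[OF F G] fibre_prod_Comp[OF F G]
  show ?thesis
  proof (rule categoryI, goal_cases)
    case (4 f x y)
    obtain f1 f2 a a' b b' where e: "f = (f1, f2)" "x = (a, a')" "y = (b, b')"
      by (metis surj_pair)
    have h: "f1 \<in> hom A a b" "f2 \<in> hom B a' b'" "AMap F f1 = AMap G f2"
      using 4 by (simp_all add: e simps)
    have "OMap F a = OMap G a'" "OMap F b = OMap G b'"
      using functor_AMap[OF F h(1)] functor_AMap[OF G h(2)] h(3) by (auto simp: hom_def)
    then show ?case using A.hom_Obj[OF h(1)] B.hom_Obj[OF h(2)] by (simp add: e simps)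
  next
    case (5 x)
    then show ?case
      by (auto simp: simps A.Ident_hom B.Ident_hom functor_Ident[OF F] functor_Ident[OF G])
  next
    case 6 then show ?case
      using F G by (auto simp: fibre_prod_def functor_from_to_def Let_def prod_cat_def composable_def
          split: prod.splits)
  next
    case (7 f g x y z)
    obtain f1 f2 a a' b b' g1 g2 c c'
      where e: "f = (f1, f2)" "x = (a, a')" "y = (b, b')" "g = (g1, g2)" "z = (c, c')"
      by (metis surj_pair)
    have f: "f1 \<in> hom A a b" "f2 \<in> hom B a' b'" "AMap F f1 = AMap G f2"
      and g: "g1 \<in> hom A b c" "g2 \<in> hom B b' c'" "AMap F g1 = AMap G g2"
      using 7 by (simp_all add: e simps)
    show ?case
      using f g by (simp add: e simps(3) simps(5)[OF f(1) g(1) f(2) g(2)] A.Comp_in_hom[OF f(1) g(1)]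
          B.Comp_in_hom[OF f(2) g(2)] functor_Comp[OF F f(1) g(1)] functor_Comp[OF G f(2) g(2)])
  next
    case (8 f x y)
    obtain f1 f2 a a' b b' where e: "f = (f1, f2)" "x = (a, a')" "y = (b, b')"
      by (metis surj_pair)
    have h: "f1 \<in> hom A a b" "f2 \<in> hom B a' b'" "AMap F f1 = AMap G f2"
      using 8 by (simp_all add: e simps)
    have o: "OMap F b = OMap G b'"
      using functor_AMap[OF F h(1)] functor_AMap[OF G h(2)] h(3) by (auto simp: hom_def)
    note b = A.hom_Obj(2)[OF h(1)] B.hom_Obj(2)[OF h(2)]
    show ?case
      using simps(5)[OF h(1) A.Ident_hom[OF b(1)] h(2) B.Ident_hom[OF b(2)] h(3)] o b
      by (simp add: e simps(4) functor_Ident[OF F] functor_Ident[OF G] A.hom_Ident_left[OF h(1)]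
          B.hom_Ident_left[OF h(2)])
  next
    case (9 f x y)
    obtain f1 f2 a a' b b' where e: "f = (f1, f2)" "x = (a, a')" "y = (b, b')"
      by (metis surj_pair)
    have h: "f1 \<in> hom A a b" "f2 \<in> hom B a' b'" "AMap F f1 = AMap G f2"
      using 9 by (simp_all add: e simps)
    have o: "OMap F a = OMap G a'"
      using functor_AMap[OF F h(1)] functor_AMap[OF G h(2)] h(3) by (auto simp: hom_def)
    note a = A.hom_Obj(1)[OF h(1)] B.hom_Obj(1)[OF h(2)]
    show ?case
      using simps(5)[OF A.Ident_hom[OF a(1)] h(1) B.Ident_hom[OF a(2)] h(2) _ h(3)] o a
      by (simp add: e simps(4) functor_Ident[OF F] functor_Ident[OF G] A.hom_Ident_right[OF h(1)]
          B.hom_Ident_right[OF h(2)])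
  next
    case (10 f g h x y z w)
    obtain f1 f2 a a' b b' g1 g2 c c' h1 h2 d d'
      where e: "f = (f1, f2)" "x = (a, a')" "y = (b, b')" "g = (g1, g2)" "z = (c, c')"
        "h = (h1, h2)" "w = (d, d')"
      by (metis surj_pair)
    have f: "f1 \<in> hom A a b" "f2 \<in> hom B a' b'" "AMap F f1 = AMap G f2"
      and g: "g1 \<in> hom A b c" "g2 \<in> hom B b' c'" "AMap F g1 = AMap G g2"
      and h: "h1 \<in> hom A c d" "h2 \<in> hom B c' d'" "AMap F h1 = AMap G h2"
      using 10 by (simp_all add: e simps)
    have gf: "AMap F (Comp A g1 f1) = AMap G (Comp B g2 f2)"
      and hg: "AMap F (Comp A h1 g1) = AMap G (Comp B h2 g2)"
      using f g h functor_Comp[OF F f(1) g(1)] functor_Comp[OF G f(2) g(2)]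
        functor_Comp[OF F g(1) h(1)] functor_Comp[OF G g(2) h(2)] by simp_all
    show ?case
      using f(3) g(3) h(3) gf hg
      by (simp add: e simps(5)[OF f(1) g(1) f(2) g(2)] simps(5)[OF g(1) h(1) g(2) h(2)]
          simps(5)[OF A.Comp_in_hom[OF f(1) g(1)] h(1) B.Comp_in_hom[OF f(2) g(2)] h(2)]
          simps(5)[OF f(1) A.Comp_in_hom[OF g(1) h(1)] f(2) B.Comp_in_hom[OF g(2) h(2)]]
          A.hom_assoc[OF f(1) g(1) h(1)] B.hom_assoc[OF f(2) g(2) h(2)])
  qed (use F G in \<open>auto simp: fibre_prod_def functor_from_to_def Let_def\<close>)
qed

text \<open>
  The inverse maps on objects and on arrows automatically form a functor, because \<open>F\<close> reflects
  domains, codomains and composites as soon as it is injective on both.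
\<close>

lemma iso_functorI:
  assumes F: "functor_from_to F A B"
    and O: "bij_betw (OMap F) (Obj A) (Obj B)" and M: "bij_betw (AMap F) (Arr A) (Arr B)"
  shows "iso_functor F"
proof -
  interpret A: category A by (rule functor_from_toD(4)[OF F])
  interpret B: category B by (rule functor_from_toD(5)[OF F])
  let ?ob = "inv_into (Obj A) (OMap F)" and ?ar = "inv_into (Arr A) (AMap F)"
  define G where "G = \<lparr> Src = B, Trg = A, OMap = restrict ?ob (Obj B), AMap = restrict ?ar (Arr B) \<rparr>"
  have ob: "?ob b \<in> Obj A" "OMap F (?ob b) = b" if "b \<in> Obj B" for b
    using that O bij_betw_inv_into_right[OF O] inv_into_into[of b "OMap F" "Obj A"]
    by (auto simp: bij_betw_def)
  have ob_eq: "?ob (OMap F a) = a" if "a \<in> Obj A" for a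
    using bij_betw_inv_into_left[OF O that] .
  have ar_eq: "?ar (AMap F f) = f" if "f \<in> hom A a b" for f a b
    using bij_betw_inv_into_left[OF M] that by (simp add: hom_def)
  have ar: "?ar f \<in> hom A (?ob a) (?ob b)" "AMap F (?ar f) = f" if f: "f \<in> hom B a b" for f a b
  proof -
    have g: "?ar f \<in> Arr A" "AMap F (?ar f) = f"
      using f M bij_betw_inv_into_right[OF M] inv_into_into[of f "AMap F" "Arr A"]
      by (auto simp: bij_betw_def hom_def)
    have "f \<in> hom B (OMap F (Dom A (?ar f))) (OMap F (Cod A (?ar f)))"
      using functor_AMap[OF F in_homI[OF g(1)]] g(2) by simp
    then have "?ob a = Dom A (?ar f)" "?ob b = Cod A (?ar f)"
      using f ob_eq[OF A.Dom_in_Obj[OF g(1)]] ob_eq[OF A.Cod_in_Obj[OF g(1)]]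
      by (auto simp: hom_def)
    then show "?ar f \<in> hom A (?ob a) (?ob b)" "AMap F (?ar f) = f" using g by (simp_all add: hom_def)
  qed
  have G: "functor_from_to G B A"
    unfolding G_def
  proof (rule functor_from_to_restrictI[OF B.category_axioms A.category_axioms])
    fix a assume a: "a \<in> Obj B"
    show "?ar (Ident B a) = Ident A (?ob a)"
      using ar_eq[OF A.Ident_hom[OF ob(1)[OF a]]] functor_Ident[OF F ob(1)[OF a]] ob(2)[OF a] by simp
  next
    fix f g a b c assume f: "f \<in> hom B a b" and g: "g \<in> hom B b c"
    show "?ar (Comp B g f) = Comp A (?ar g) (?ar f)"
      using ar_eq[OF A.Comp_in_hom[OF ar(1)[OF f] ar(1)[OF g]]]
        functor_Comp[OF F ar(1)[OF f] ar(1)[OF g]] ar(2)[OF f] ar(2)[OF g] by simp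
  qed (use ob ar in auto)
  have GO: "OMap G b = ?ob b" if "b \<in> Obj B" for b using that by (simp add: G_def)
  have GA: "AMap G f = ?ar f" if "f \<in> Arr B" for f using that by (simp add: G_def)
  have "G \<circ>\<^sub>F F = id_functor A"
  proof (rule functor_eqI[OF functor_comp_from_to[OF F G] id_functor_from_to[OF A.category_axioms]])
    fix a assume "a \<in> Obj A"
    then show "OMap (G \<circ>\<^sub>F F) a = OMap (id_functor A) a"
      by (simp add: OMap_functor_comp[OF F] GO functor_OMap[OF F] ob_eq OMap_id)
  next
    fix f assume "f \<in> Arr A"
    note f = in_homI[OF this]
    show "AMap (G \<circ>\<^sub>F F) f = AMap (id_functor A) f"
      by (simp add: AMap_functor_comp[OF F f] GA in_homD(1)[OF functor_AMap[OF F f]] ar_eq[OF f]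
          AMap_id[OF f])
  qed
  moreover have "F \<circ>\<^sub>F G = id_functor B"
  proof (rule functor_eqI[OF functor_comp_from_to[OF G F] id_functor_from_to[OF B.category_axioms]])
    fix b assume "b \<in> Obj B"
    then show "OMap (F \<circ>\<^sub>F G) b = OMap (id_functor B) b"
      by (simp add: OMap_functor_comp[OF G] GO ob OMap_id)
  next
    fix f assume f: "f \<in> Arr B"
    note h = in_homI[OF f]
    show "AMap (F \<circ>\<^sub>F G) f = AMap (id_functor B) f"
      using f by (simp add: AMap_functor_comp[OF G h] GA ar(2)[OF h] AMap_id[OF h])
  qed
  ultimately show ?thesis
    using F G by (auto simp: iso_functor_def functor_from_to_def)
qed

text \<open>
  The comparison functor into the standard pullback is bijective on objects and arrows exactly when
  every compatible pair has exactly one preimage, so no inverse functor has to be written down.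
\<close>

lemma strict_pullbackI:
  assumes T: "functor_from_to T X Y" and L: "functor_from_to L X Y'"
    and R: "functor_from_to R Y Z" and B: "functor_from_to B Y' Z"
    and sqO: "\<And>x. x \<in> Obj X \<Longrightarrow> OMap R (OMap T x) = OMap B (OMap L x)"
    and sqA: "\<And>f. f \<in> Arr X \<Longrightarrow> AMap R (AMap T f) = AMap B (AMap L f)"
    and O: "\<And>a b. a \<in> Obj Y \<Longrightarrow> b \<in> Obj Y' \<Longrightarrow> OMap R a = OMap B b \<Longrightarrow>
      \<exists>!x. x \<in> Obj X \<and> OMap T x = a \<and> OMap L x = b"
    and A: "\<And>f g. f \<in> Arr Y \<Longrightarrow> g \<in> Arr Y' \<Longrightarrow> AMap R f = AMap B g \<Longrightarrow>
      \<exists>!x. x \<in> Arr X \<and> AMap T x = f \<and> AMap L x = g"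
  shows "strict_pullback T L R B"
proof -
  let ?Q = "fibre_prod R B"
  have sq: "R \<circ>\<^sub>F T = B \<circ>\<^sub>F L"
    by (rule functor_eqI[OF functor_comp_from_to[OF T R] functor_comp_from_to[OF L B]])
      (simp_all add: OMap_functor_comp[OF T] OMap_functor_comp[OF L] sqO sqA
        AMap_functor_comp[OF T in_homI] AMap_functor_comp[OF L in_homI])
  note Q = fibre_prod_category[OF R B]
  have P: "functor_from_to (pairing T L ?Q) X ?Q"
    using pairing_is_functor[OF functor_from_toD(1)[OF T] functor_from_toD(1)[OF L] _ _ _ sq Q]
      functor_from_toD(2,3)[OF T] functor_from_toD(2,3)[OF L] functor_from_toD(2,3)[OF R]
      functor_from_toD(2,3)[OF B]
    by (simp add: functor_from_to_def pairing_def)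
  have TO: "OMap T x \<in> Obj Y" "OMap L x \<in> Obj Y'" if "x \<in> Obj X" for x
    using that functor_OMap[OF T] functor_OMap[OF L] by auto
  have TA: "AMap T f \<in> Arr Y" "AMap L f \<in> Arr Y'" if "f \<in> Arr X" for f
    using in_homD(1)[OF functor_AMap[OF T in_homI[OF that]]]
      in_homD(1)[OF functor_AMap[OF L in_homI[OF that]]] by auto
  have "bij_betw (\<lambda>x. (OMap T x, OMap L x)) (Obj X) (Obj ?Q)"
    unfolding bij_betw_def inj_on_def fibre_prod_simps[OF R B]
    using O TO sqO by (auto simp: image_iff) metis+
  then have 1: "bij_betw (OMap (pairing T L ?Q)) (Obj X) (Obj ?Q)"
    using functor_from_toD(2)[OF T]
    by (subst bij_betw_cong[where g = "\<lambda>x. (OMap T x, OMap L x)"]) (auto simp: pairing_def)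
  have "bij_betw (\<lambda>f. (AMap T f, AMap L f)) (Arr X) (Arr ?Q)"
    unfolding bij_betw_def inj_on_def fibre_prod_simps[OF R B]
    using A TA sqA by (auto simp: image_iff) metis+
  then have 2: "bij_betw (AMap (pairing T L ?Q)) (Arr X) (Arr ?Q)"
    using functor_from_toD(2)[OF T]
    by (subst bij_betw_cong[where g = "\<lambda>x. (AMap T x, AMap L x)"]) (auto simp: pairing_def)
  show ?thesis
    using iso_functorI[OF P 1 2] sq T L R B by (simp add: strict_pullback_def functor_from_to_def)
qed

section \<open>The 2-category of categories and fibrations\<close>

lemma Cat_co_fib_Obj:
  "p \<in> Obj (Cat_co_fib_hom A B) \<longleftrightarrow> fibration p \<and> functor_from_to p A B"
  by (auto simp: Cat_co_fib_hom_def Let_def fibration_def functor_from_to_def)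

lemma Cat_co_fib_in_hom:
  "\<sigma> \<in> hom (Cat_co_fib_hom A B) p p' \<longleftrightarrow> fibration p \<and> fibration p' \<and> nat_cell \<sigma> p' p A B"
proof -
  have "\<sigma> \<in> hom (Cat_co_fib_hom A B) p p' \<longleftrightarrow>
      nat_trans \<sigma> \<and> NSrc \<sigma> = p' \<and> NTrg \<sigma> = p \<and> p \<in> Obj (Cat_co_fib_hom A B) \<and> p' \<in> Obj
          (Cat_co_fib_hom A B)"
    by (simp add: Cat_co_fib_hom_def Let_def hom_def) blast
  then show ?thesis by (simp add: Cat_co_fib_Obj nat_cell_def nat_trans_from_to_def) blast
qed

lemma Cat_co_fib_Ident:
  "p \<in> Obj (Cat_co_fib_hom A B) \<Longrightarrow> Ident (Cat_co_fib_hom A B) p = id_nt p"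
  by (simp add: Cat_co_fib_hom_def Let_def)

lemma Cat_co_fib_Comp:
  "\<sigma> \<in> hom (Cat_co_fib_hom A B) p p' \<Longrightarrow> \<tau> \<in> hom (Cat_co_fib_hom A B) p' p'' \<Longrightarrow>
    Comp (Cat_co_fib_hom A B) \<tau> \<sigma> = \<sigma> \<cdot> \<tau>"
  by (auto simp: Cat_co_fib_hom_def Let_def hom_def)

lemma Cat_co_fib_hom_category: "category (Cat_co_fib_hom A B)"
proof (rule categoryI, goal_cases)
  case (6 \<sigma> \<tau>)
  then have "\<not> (\<sigma> \<in> Arr (Cat_co_fib_hom A B) \<and> \<tau> \<in> Arr (Cat_co_fib_hom A B) \<and> NSrc \<sigma> = NTrg \<tau>)"
    by (auto simp: composable_def Cat_co_fib_hom_def Let_def)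
  moreover have "Comp (Cat_co_fib_hom A B) \<tau> \<sigma> = (if \<sigma> \<in> Arr (Cat_co_fib_hom A B) \<and>
      \<tau> \<in> Arr (Cat_co_fib_hom A B) \<and> NSrc \<sigma> = NTrg \<tau> then \<sigma> \<cdot> \<tau> else undefined)"
    by (simp add: Cat_co_fib_hom_def Let_def)
  ultimately show ?case by (simp only: if_False)
next
  case (7 f g a b c)
  then show ?case
    unfolding Cat_co_fib_Comp[OF 7] Cat_co_fib_in_hom using nat_cell_vcomp by blast
next
  case (8 f a b)
  then have f: "fibration a" "fibration b" "nat_cell f b a A B" by (simp_all add: Cat_co_fib_in_hom)
  note b = nat_cellD(1)[OF f(3)]
  have "id_nt b \<in> hom (Cat_co_fib_hom A B) b b"
    using f nat_cell_id[OF b] by (simp add: Cat_co_fib_in_hom)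
  then show ?case
    using 8 f b by (simp add: Cat_co_fib_Ident Cat_co_fib_Obj Cat_co_fib_Comp vcomp_id_right)
next
  case (9 f a b)
  then have f: "fibration a" "fibration b" "nat_cell f b a A B" by (simp_all add: Cat_co_fib_in_hom)
  note a = nat_cellD(2)[OF f(3)]
  have "id_nt a \<in> hom (Cat_co_fib_hom A B) a a"
    using f nat_cell_id[OF a] by (simp add: Cat_co_fib_in_hom)
  then show ?case
    using 9 f a by (simp add: Cat_co_fib_Ident Cat_co_fib_Obj Cat_co_fib_Comp vcomp_id_left)
next
  case (10 f g h a b c d)
  have c: "nat_cell f b a A B" "nat_cell g c b A B" "nat_cell h d c A B" "fibration a" "fibration b"
    "fibration c" "fibration d"
    using 10 by (simp_all add: Cat_co_fib_in_hom)
  have "f \<cdot> g \<in> hom (Cat_co_fib_hom A B) a c" "g \<cdot> h \<in> hom (Cat_co_fib_hom A B) b d"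
    using nat_cell_vcomp[OF c(2,1)] nat_cell_vcomp[OF c(3,2)] c by (simp_all add: Cat_co_fib_in_hom)
  then show ?case
    using Cat_co_fib_Comp[OF 10(1,2)] Cat_co_fib_Comp[OF 10(2,3)] Cat_co_fib_Comp[OF 10(1)]
      Cat_co_fib_Comp[OF _ 10(3)] vcomp_assoc[OF c(3,2,1)]
    by simp
qed (auto simp: Cat_co_fib_in_hom Cat_co_fib_Obj Cat_co_fib_Ident nat_cell_id nat_cellD,
    auto simp: Cat_co_fib_hom_def Let_def)

lemma Cat_co_fib_simps:
  "Obj2 Cat_co_fib = {A. category A}" "Hom2 Cat_co_fib = Cat_co_fib_hom"
  "Unit2 Cat_co_fib = id_functor"
  by (simp_all add: Cat_co_fib_def)

lemma Cat_co_fib_comp1: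
  "p \<in> Obj (Cat_co_fib_hom A B) \<Longrightarrow> q \<in> Obj (Cat_co_fib_hom B C) \<Longrightarrow>
    comp1 Cat_co_fib A B C q p = q \<circ>\<^sub>F p"
  by (simp add: comp1_def Cat_co_fib_def Let_def prod_cat_simps)

lemma Cat_co_fib_comp2:
  "\<sigma> \<in> Arr (Cat_co_fib_hom A B) \<Longrightarrow> \<tau> \<in> Arr (Cat_co_fib_hom B C) \<Longrightarrow>
    comp2 Cat_co_fib A B C \<tau> \<sigma> = \<tau> \<star> \<sigma>"
  by (simp add: comp2_def Cat_co_fib_def Let_def prod_cat_simps)

lemma Cat_co_fib_Arr:
  assumes "\<sigma> \<in> Arr (Cat_co_fib_hom A B)"
  shows "\<exists>p p'. fibration p \<and> fibration p' \<and> nat_cell \<sigma> p' p A B"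
  using in_homI[OF assms] by (auto simp: Cat_co_fib_in_hom)

lemma Cat_co_fib_Comp2_functor:
  "functor_from_to (Comp2 Cat_co_fib A B C)
    (prod_cat (Cat_co_fib_hom B C) (Cat_co_fib_hom A B)) (Cat_co_fib_hom A C)"
  unfolding Cat_co_fib_def Let_def two_cat.simps
proof (rule functor_from_to_restrictI[OF prod_cat_category[OF Cat_co_fib_hom_category
        Cat_co_fib_hom_category] Cat_co_fib_hom_category], goal_cases)
  case (1 x)
  then show ?case
    by (auto simp: prod_cat_simps Cat_co_fib_Obj intro: functor_comp_from_to fibration_comp)
next
  case (2 f x y)
  obtain \<tau> \<sigma> q p q' p' where e: "f = (\<tau>, \<sigma>)" "x = (q, p)" "y = (q', p')" by (metis surj_pair)
  have c: "fibration q" "fibration q'" "nat_cell \<tau> q' q B C"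
    "fibration p" "fibration p'" "nat_cell \<sigma> p' p A B"
    using 2 by (simp_all add: e prod_cat_hom Cat_co_fib_in_hom)
  have "Trg p = Src q" "Trg p' = Src q'"
    using nat_cellD(1,2)[OF c(3)] nat_cellD(1,2)[OF c(6)] by (simp_all add: functor_from_to_def)
  then show ?case
    using nat_cell_hcomp[OF c(6,3)] c by (simp add: e Cat_co_fib_in_hom fibration_functor_comp)
next
  case (3 x)
  obtain q p where e: "x = (q, p)" by (metis surj_pair)
  have c: "q \<in> Obj (Cat_co_fib_hom B C)" "p \<in> Obj (Cat_co_fib_hom A B)"
    using 3 by (simp_all add: e prod_cat_simps)
  then have f: "functor_from_to p A B" "functor_from_to q B C" "fibration p" "fibration q"
    by (simp_all add: Cat_co_fib_Obj)
  have "q \<circ>\<^sub>F p \<in> Obj (Cat_co_fib_hom A C)"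
    using f functor_comp_from_to[OF f(1,2)] fibration_functor_comp[OF f(3,4)]
    by (simp add: Cat_co_fib_Obj functor_from_to_def)
  then show ?case
    using c hcomp_id_nt[OF f(1,2)] by (simp add: e prod_cat_Ident Cat_co_fib_Ident)
next
  case (4 f g x y z)
  obtain \<tau> \<sigma> q p q' p' \<tau>' \<sigma>' q'' p''
    where e: "f = (\<tau>, \<sigma>)" "x = (q, p)" "y = (q', p')" "g = (\<tau>', \<sigma>')" "z = (q'', p'')"
    by (metis surj_pair)
  have h: "\<tau> \<in> hom (Cat_co_fib_hom B C) q q'" "\<sigma> \<in> hom (Cat_co_fib_hom A B) p p'"
    "\<tau>' \<in> hom (Cat_co_fib_hom B C) q' q''" "\<sigma>' \<in> hom (Cat_co_fib_hom A B) p' p''"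
    using 4 by (simp_all add: e prod_cat_hom)
  then have c: "nat_cell \<tau> q' q B C" "nat_cell \<sigma> p' p A B" "nat_cell \<tau>' q'' q' B C"
    "nat_cell \<sigma>' p'' p' A B" and fib: "fibration q" "fibration q'" "fibration q''" "fibration p"
    "fibration p'" "fibration p''"
    by (simp_all add: Cat_co_fib_in_hom)
  have "Trg p = Src q" "Trg p' = Src q'" "Trg p'' = Src q''"
    using nat_cellD(1,2)[OF c(1)] nat_cellD(1,2)[OF c(2)] nat_cellD(1,2)[OF c(3)]
      nat_cellD(1,2)[OF c(4)] by (simp_all add: functor_from_to_def)
  then have "\<tau> \<star> \<sigma> \<in> hom (Cat_co_fib_hom A C) (q \<circ>\<^sub>F p) (q' \<circ>\<^sub>F p')"
    "\<tau>' \<star> \<sigma>' \<in> hom (Cat_co_fib_hom A C) (q' \<circ>\<^sub>F p') (q'' \<circ>\<^sub>F p'')"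
    using nat_cell_hcomp[OF c(2,1)] nat_cell_hcomp[OF c(4,3)] fib
    by (simp_all add: Cat_co_fib_in_hom fibration_functor_comp)
  then show ?case
    using interchange[OF c(4,2) c(3,1)]
    by (simp add: e prod_cat_Comp[OF h(1,3) h(2,4)] Cat_co_fib_Comp[OF h(1,3)]
        Cat_co_fib_Comp[OF h(2,4)] Cat_co_fib_Comp)
qed

lemma Cat_co_fib_two_category: "two_category Cat_co_fib"
proof (rule two_category.intro, goal_cases)
  case 1 show ?case by (simp add: Cat_co_fib_simps Cat_co_fib_hom_category)
next
  case 2 then show ?case
    by (simp add: Cat_co_fib_simps Cat_co_fib_Obj fibration_id_functor id_functor_from_to)
next
  case 3 show ?case by (simp add: Cat_co_fib_simps Cat_co_fib_Comp2_functor)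
next
  case (4 w x y z f g h)
  then have o: "f \<in> Obj (Cat_co_fib_hom w x)" "g \<in> Obj (Cat_co_fib_hom x y)"
    "h \<in> Obj (Cat_co_fib_hom y z)" by (simp_all add: Cat_co_fib_simps)
  have "g \<circ>\<^sub>F f \<in> Obj (Cat_co_fib_hom w y)" "h \<circ>\<^sub>F g \<in> Obj (Cat_co_fib_hom x z)"
    using o by (auto simp: Cat_co_fib_Obj intro: functor_comp_from_to fibration_comp)
  then show ?case
    using o functor_comp_assoc_from_to[of f w x g y h] by (simp add: Cat_co_fib_comp1 Cat_co_fib_Obj)
next
  case (5 w x y z \<rho> \<sigma> \<tau>)
  then have o: "\<rho> \<in> Arr (Cat_co_fib_hom w x)" "\<sigma> \<in> Arr (Cat_co_fib_hom x y)"
    "\<tau> \<in> Arr (Cat_co_fib_hom y z)" by (simp_all add: Cat_co_fib_simps)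
  have closed: "\<tau> \<star> \<sigma> \<in> Arr (Cat_co_fib_hom A C)"
    if st: "\<sigma> \<in> Arr (Cat_co_fib_hom A B)" "\<tau> \<in> Arr (Cat_co_fib_hom B C)" for \<sigma> \<tau> and A B C :: "('a,
        'b) cat"
  proof -
    obtain p p' q q' where c: "nat_cell \<sigma> p' p A B" "nat_cell \<tau> q' q B C"
      and "fibration p" "fibration p'" "fibration q" "fibration q'"
      using Cat_co_fib_Arr[OF st(1)] Cat_co_fib_Arr[OF st(2)] by blast
    then have "\<tau> \<star> \<sigma> \<in> hom (Cat_co_fib_hom A C) (q \<circ>\<^sub>F p) (q' \<circ>\<^sub>F p')"
      using nat_cell_hcomp[OF c] nat_cellD(1,2)[OF c(1)] nat_cellD(1,2)[OF c(2)]
      by (auto simp: Cat_co_fib_in_hom intro: fibration_comp)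
    then show ?thesis by (rule in_homD)
  qed
  show ?case
    using o closed[OF o(1,2)] closed[OF o(2,3)] Cat_co_fib_Arr[OF o(1)] Cat_co_fib_Arr[OF o(2)]
      Cat_co_fib_Arr[OF o(3)]
    by (auto simp: Cat_co_fib_comp2 hcomp_assoc)
next
  case (6 x y f)
  then show ?case
    using id_functor_left[of f x y]
    by (simp add: Cat_co_fib_simps Cat_co_fib_comp1 Cat_co_fib_Obj fibration_id_functor
        id_functor_from_to)
next
  case (7 x y f)
  then show ?case
    using id_functor_right[of f x y]
    by (simp add: Cat_co_fib_simps Cat_co_fib_comp1 Cat_co_fib_Obj fibration_id_functor
        id_functor_from_to)
next
  case (8 x y \<sigma>)
  then have o: "id_functor y \<in> Obj (Cat_co_fib_hom y y)" and s: "\<sigma> \<in> Arr (Cat_co_fib_hom x y)"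
    by (simp_all add: Cat_co_fib_simps Cat_co_fib_Obj fibration_id_functor id_functor_from_to)
  have "id_nt (id_functor y) \<in> Arr (Cat_co_fib_hom y y)"
    using category.Ident_hom[OF Cat_co_fib_hom_category o] Cat_co_fib_Ident[OF o] by (simp add: hom_def)
  then show ?case
    using s o Cat_co_fib_Arr[OF s]
    by (auto simp: Cat_co_fib_simps unit_cell_def Cat_co_fib_Ident Cat_co_fib_comp2 hcomp_unit_left)
next
  case (9 x y \<sigma>)
  then have o: "id_functor x \<in> Obj (Cat_co_fib_hom x x)" and s: "\<sigma> \<in> Arr (Cat_co_fib_hom x y)"
    by (simp_all add: Cat_co_fib_simps Cat_co_fib_Obj fibration_id_functor id_functor_from_to)
  have "id_nt (id_functor x) \<in> Arr (Cat_co_fib_hom x x)"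
    using category.Ident_hom[OF Cat_co_fib_hom_category o] Cat_co_fib_Ident[OF o] by (simp add: hom_def)
  then show ?case
    using s o Cat_co_fib_Arr[OF s]
    by (auto simp: Cat_co_fib_simps unit_cell_def Cat_co_fib_Ident Cat_co_fib_comp2 hcomp_unit_right)
qed

section \<open>The 2-category of fibrations and lax squares\<close>

lemma is_lax_square_iff:
  assumes p: "functor_from_to p A B" and q: "functor_from_to q C D"
  shows "is_lax_square p q s \<longleftrightarrow> functor_from_to (Upper s) A C \<and>
    fibration (Lower s) \<and> functor_from_to (Lower s) B D \<and>
    nat_cell (Filler s) (Lower s \<circ>\<^sub>F p) (q \<circ>\<^sub>F Upper s) A D"
  using nat_cell_iff_src[OF functor_comp_from_to[OF p, of "Lower s" D], of "Filler s" "q \<circ>\<^sub>F Upper s"]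
    functor_from_toD(2,3)[OF p] functor_from_toD(2,3)[OF q] fibration_functor[of "Lower s"]
    functor_from_toD(2,3)[of "Lower s" B D]
  by (auto simp: is_lax_square_def)

lemma lax_squareD:
  assumes "is_lax_square p q s" and "functor_from_to p A B" and "functor_from_to q C D"
  shows "functor_from_to (Upper s) A C" "functor_from_to (Lower s) B D" "fibration (Lower s)"
    "nat_cell (Filler s) (Lower s \<circ>\<^sub>F p) (q \<circ>\<^sub>F Upper s) A D"
  using assms is_lax_square_iff[OF assms(2,3)] by auto

lemma is_square_cell_iff:
  assumes p: "functor_from_to p A B" and q: "functor_from_to q C D"
  shows "is_square_cell p q c \<longleftrightarrow> is_lax_square p q (CSrc c) \<and> is_lax_square p q (CTrg c) \<and>
    nat_cell (UpperCell c) (Upper (CSrc c)) (Upper (CTrg c)) A C \<and>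
    nat_cell (LowerCell c) (Lower (CTrg c)) (Lower (CSrc c)) B D \<and>
    Filler (CTrg c) = (q \<rhd> UpperCell c) \<cdot> Filler (CSrc c) \<cdot> (LowerCell c \<lhd> p)"
  using lax_squareD[OF _ p q, of "CSrc c"] lax_squareD[OF _ p q, of "CTrg c"]
  by (auto simp: is_square_cell_def nat_cell_iff_src)

lemma square_cellD:
  assumes "is_square_cell p q c" and "functor_from_to p A B" and "functor_from_to q C D"
  shows "is_lax_square p q (CSrc c)" "is_lax_square p q (CTrg c)"
    "nat_cell (UpperCell c) (Upper (CSrc c)) (Upper (CTrg c)) A C"
    "nat_cell (LowerCell c) (Lower (CTrg c)) (Lower (CSrc c)) B D"
    "Filler (CTrg c) = (q \<rhd> UpperCell c) \<cdot> Filler (CSrc c) \<cdot> (LowerCell c \<lhd> p)"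
  using assms is_square_cell_iff[OF assms(2,3)] by auto

lemma whiskered_filler_cell:
  assumes p: "functor_from_to p A B" and q: "functor_from_to q C D" and s: "is_lax_square p q s"
    and u: "nat_cell \<phi> (Upper s) f A C" and l: "nat_cell \<psi> g (Lower s) B D"
  shows "nat_cell ((q \<rhd> \<phi>) \<cdot> Filler s \<cdot> (\<psi> \<lhd> p)) (g \<circ>\<^sub>F p) (q \<circ>\<^sub>F f) A D"
  by (rule nat_cell_vcomp[OF nat_cell_vcomp[OF nat_cell_whisker_right[OF p l] lax_squareD(4)[OF s p q]]
        nat_cell_whisker_left[OF u q]])

text \<open>
  With this formula the defining equation of a 2-cell between lax squares is an equation between
  composites of three arrows, one for each object of the domain of \<open>p\<close>.
\<close>

lemma NAt_whiskered_filler: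
  assumes p: "functor_from_to p A B" and q: "functor_from_to q C D" and s: "is_lax_square p q s"
    and u: "nat_cell \<phi> (Upper s) f A C" and l: "nat_cell \<psi> g (Lower s) B D" and a: "a \<in> Obj A"
  shows "NAt ((q \<rhd> \<phi>) \<cdot> Filler s \<cdot> (\<psi> \<lhd> p)) a =
    Comp D (AMap q (NAt \<phi> a)) (Comp D (NAt (Filler s) a) (NAt \<psi> (OMap p a)))"
  using a by (simp add: NAt_vcomp[OF nat_cell_vcomp[OF nat_cell_whisker_right[OF p l]
      lax_squareD(4)[OF s p q]]]
      NAt_vcomp[OF nat_cell_whisker_right[OF p l]] NAt_whisker_left[OF u] NAt_whisker_right[OF p])

lemma filler_at:
  assumes p: "functor_from_to p A B" and q: "functor_from_to q C D" and s: "is_lax_square p q s"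
    and a: "a \<in> Obj A"
  shows "NAt (Filler s) a \<in> hom D (OMap (Lower s) (OMap p a)) (OMap q (OMap (Upper s) a))"
  using nat_cell_at[OF lax_squareD(4)[OF s p q] a] a
  by (simp add: OMap_functor_comp[OF p] OMap_functor_comp[OF lax_squareD(1)[OF s p q]])

lemma filler_natural:
  assumes p: "functor_from_to p A B" and q: "functor_from_to q C D" and s: "is_lax_square p q s"
    and f: "f \<in> hom A a b"
  shows "Comp D (NAt (Filler s) b) (AMap (Lower s) (AMap p f)) =
    Comp D (AMap q (AMap (Upper s) f)) (NAt (Filler s) a)"
  using nat_cell_natural[OF lax_squareD(4)[OF s p q] f]
  by (simp add: AMap_functor_comp[OF p f] AMap_functor_comp[OF lax_squareD(1)[OF s p q] f])

lemma lax_square_eqI: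
  assumes p: "functor_from_to p A B" and q: "functor_from_to q C D"
    and s: "is_lax_square p q s" and t: "is_lax_square p q t"
    and "Upper s = Upper t" "Lower s = Lower t"
    and "\<And>a. a \<in> Obj A \<Longrightarrow> NAt (Filler s) a = NAt (Filler t) a"
  shows "s = t"
proof -
  have "Filler s = Filler t"
    using nat_cell_eqI[OF lax_squareD(4)[OF s p q], of "Filler t"] lax_squareD(4)[OF t p q] assms(5-7)
    by simp
  then show ?thesis using assms(5,6) by simp
qed

lemma id_square_lax:
  assumes p: "fibration p" "functor_from_to p A B" shows "is_lax_square p p (id_square p)"
  unfolding is_lax_square_iff[OF p(2) p(2)]
  using id_functor_from_to[OF functor_from_toD(4)[OF p(2)]]
    id_functor_from_to[OF functor_from_toD(5)[OF p(2)]]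
    fibration_id_functor[OF functor_from_toD(5)[OF p(2)]] nat_cell_id[OF p(2)]
        functor_from_toD(2,3)[OF p(2)]
  by (simp add: id_square_def id_functor_left[OF p(2)] id_functor_right[OF p(2)])

lemma paste_filler_cells:
  assumes p: "functor_from_to p A B" and q: "functor_from_to q C D" and r: "functor_from_to r X Y"
    and s: "is_lax_square p q s" and t: "is_lax_square q r t"
  shows "nat_cell (Lower t \<rhd> Filler s) ((Lower t \<circ>\<^sub>F Lower s) \<circ>\<^sub>F p) ((Lower t \<circ>\<^sub>F q) \<circ>\<^sub>F Upper s) A Y"
    and "nat_cell (Filler t \<lhd> Upper s) ((Lower t \<circ>\<^sub>F q) \<circ>\<^sub>F Upper s) (r \<circ>\<^sub>F Upper t \<circ>\<^sub>F Upper s) A Y"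
  using nat_cell_whisker_left[OF lax_squareD(4)[OF s p q] lax_squareD(2)[OF t q r]]
    nat_cell_whisker_right[OF lax_squareD(1)[OF s p q] lax_squareD(4)[OF t q r]]
    functor_comp_assoc_from_to[OF p lax_squareD(2)[OF s p q], of "Lower t"]
    functor_comp_assoc_from_to[OF lax_squareD(1)[OF s p q] q, of "Lower t"]
    functor_comp_assoc_from_to[OF lax_squareD(1)[OF s p q] lax_squareD(1)[OF t q r], of r]
  by simp_all

lemma paste_square_lax:
  assumes p: "functor_from_to p A B" and q: "functor_from_to q C D" and r: "functor_from_to r X Y"
    and s: "is_lax_square p q s" and t: "is_lax_square q r t"
  shows "is_lax_square p r (paste_square t s)"
proof -
  note S = lax_squareD[OF s p q] and T = lax_squareD[OF t q r]
  show ?thesis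
    unfolding is_lax_square_iff[OF p r] paste_square_def lax_square.simps
    by (intro conjI functor_comp_from_to[OF S(1) T(1)] functor_comp_from_to[OF S(2) T(2)]
        fibration_comp[OF S(3,2) T(3,2)] nat_cell_vcomp[OF paste_filler_cells[OF p q r s t]])
qed

lemma NAt_paste_square:
  assumes p: "functor_from_to p A B" and q: "functor_from_to q C D" and r: "functor_from_to r X Y"
    and s: "is_lax_square p q s" and t: "is_lax_square q r t" and a: "a \<in> Obj A"
  shows "NAt (Filler (paste_square t s)) a =
    Comp Y (NAt (Filler t) (OMap (Upper s) a)) (AMap (Lower t) (NAt (Filler s) a))"
  using a by (simp add: paste_square_def NAt_vcomp[OF paste_filler_cells(1)[OF p q r s t]]
      NAt_whisker_left[OF lax_squareD(4)[OF s p q]] NAt_whisker_right[OF lax_squareD(1)[OF s p q]])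

lemma paste_square_assoc:
  assumes p: "functor_from_to p A B" and q: "functor_from_to q C D" and r: "functor_from_to r X Y"
    and v: "functor_from_to v U V"
    and s: "is_lax_square p q s" and t: "is_lax_square q r t" and u: "is_lax_square r v u"
  shows "paste_square u (paste_square t s) = paste_square (paste_square u t) s"
proof (rule lax_square_eqI[OF p v])
  note ts = paste_square_lax[OF p q r s t] and ut = paste_square_lax[OF q r v t u]
  note S = lax_squareD[OF s p q] and T = lax_squareD[OF t q r] and U = lax_squareD[OF u r v]
  interpret V: category V by (rule functor_from_toD(5)[OF v])
  show "is_lax_square p v (paste_square u (paste_square t s))"
    "is_lax_square p v (paste_square (paste_square u t) s)"
    by (rule paste_square_lax[OF p r v ts u], rule paste_square_lax[OF p q v s ut])
  show "Upper (paste_square u (paste_square t s)) = Upper (paste_square (paste_square u t) s)"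
    "Lower (paste_square u (paste_square t s)) = Lower (paste_square (paste_square u t) s)"
    by (simp_all add: paste_square_def functor_comp_assoc_from_to[OF S(1) T(1)]
        functor_comp_assoc_from_to[OF S(2) T(2)])
  fix a assume a: "a \<in> Obj A"
  note b = functor_OMap[OF S(1) a]
  note c = functor_OMap[OF T(1) b]
  note sa = functor_AMap[OF T(2) filler_at[OF p q s a]] and tb = filler_at[OF q r t b]
    and uc = filler_at[OF r v u c]
  have 1: "NAt (Filler (paste_square u (paste_square t s))) a =
      Comp V (NAt (Filler u) (OMap (Upper t) (OMap (Upper s) a)))
        (Comp V (AMap (Lower u) (NAt (Filler t) (OMap (Upper s) a)))
          (AMap (Lower u) (AMap (Lower t) (NAt (Filler s) a))))"
    using functor_Comp[OF U(2) sa tb] OMap_functor_comp[OF S(1) a, of "Upper t"]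
    by (simp add: NAt_paste_square[OF p r v ts u a] NAt_paste_square[OF p q r s t a])
      (simp add: paste_square_def)
  have 2: "NAt (Filler (paste_square (paste_square u t) s)) a =
      Comp V (Comp V (NAt (Filler u) (OMap (Upper t) (OMap (Upper s) a)))
        (AMap (Lower u) (NAt (Filler t) (OMap (Upper s) a))))
          (AMap (Lower u) (AMap (Lower t) (NAt (Filler s) a)))"
    using AMap_functor_comp[OF T(2) filler_at[OF p q s a], of "Lower u"]
    by (simp add: NAt_paste_square[OF p q v s ut a] NAt_paste_square[OF q r v t u b])
      (simp add: paste_square_def)
  show "NAt (Filler (paste_square u (paste_square t s))) a =
      NAt (Filler (paste_square (paste_square u t) s)) a"
    unfolding 1 2
    by (rule V.hom_assoc[OF functor_AMap[OF U(2) sa] functor_AMap[OF U(2) tb] uc, symmetric])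
qed

lemma paste_id_square_left:
  assumes p: "functor_from_to p A B" and q: "functor_from_to q C D" and s: "is_lax_square p q s"
  shows "paste_square (id_square q) s = s"
proof -
  note S = lax_squareD[OF s p q]
  show ?thesis
    using id_functor_left[OF S(1)] id_functor_left[OF S(2)] whisker_left_unit[OF S(4)]
      whisker_right_id_nt[OF S(1) q] vcomp_id_left[OF S(4)] functor_from_toD(2,3)[OF q]
    by (simp add: paste_square_def id_square_def)
qed

lemma paste_id_square_right:
  assumes p: "functor_from_to p A B" and q: "functor_from_to q C D" and s: "is_lax_square p q s"
  shows "paste_square s (id_square p) = s"
proof -
  note S = lax_squareD[OF s p q]
  show ?thesis
    using id_functor_right[OF S(1)] id_functor_right[OF S(2)] whisker_right_unit[OF S(4)]
      whisker_left_id_nt[OF p S(2)] vcomp_id_right[OF S(4)] functor_from_toD(2,3)[OF p]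
    by (simp add: paste_square_def id_square_def)
qed

lemma id_cell_square:
  assumes p: "functor_from_to p A B" and q: "functor_from_to q C D" and s: "is_lax_square p q s"
  shows "is_square_cell p q (id_cell s)"
proof -
  note S = lax_squareD[OF s p q]
  show ?thesis
    unfolding is_square_cell_iff[OF p q]
    using s nat_cell_id[OF S(1)] nat_cell_id[OF S(2)] vcomp_id_right[OF S(4)] vcomp_id_left[OF S(4)]
      whisker_left_id_nt[OF S(1) q] whisker_right_id_nt[OF p S(2)]
    by (simp add: id_cell_def)
qed

text \<open>
  Substituting the equation of \<open>c\<close> into that of \<open>d\<close> puts both upper cells on the left and both lower
  cells on the right of the filler of \<open>CSrc c\<close>. Whiskering preserves vertical composites, so each
  pair merges into one whiskered transformation.
\<close>

lemma vcomp_cell_square: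
  assumes p: "functor_from_to p A B" and q: "functor_from_to q C D"
    and c: "is_square_cell p q c" and d: "is_square_cell p q d" and cd: "CTrg c = CSrc d"
  shows "is_square_cell p q (vcomp_cell d c)"
proof -
  note C = square_cellD[OF c p q] and D = square_cellD[OF d p q, folded cd]
  note F = lax_squareD(4)[OF C(1) p q]
  note uc = nat_cell_whisker_left[OF C(3) q] and ud = nat_cell_whisker_left[OF D(3) q]
    and lc = nat_cell_whisker_right[OF p C(4)] and ld = nat_cell_whisker_right[OF p D(4)]
  have "Filler (CTrg d) = (q \<rhd> UpperCell d) \<cdot> ((q \<rhd> UpperCell c) \<cdot> Filler (CSrc c) \<cdot> (LowerCell c \<lhd> p))
      \<cdot> (LowerCell d \<lhd> p)"
    using D(5) C(5) by simp
  also have "\<dots> = ((q \<rhd> UpperCell d) \<cdot> (q \<rhd> UpperCell c)) \<cdot> Filler (CSrc c)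
      \<cdot> (LowerCell c \<lhd> p) \<cdot> (LowerCell d \<lhd> p)"
    by (simp add: vcomp_assoc[OF ld nat_cell_vcomp[OF lc F] uc] vcomp_assoc[OF ld lc F]
        vcomp_assoc[OF nat_cell_vcomp[OF nat_cell_vcomp[OF ld lc] F] uc ud])
  also have "\<dots> = (q \<rhd> (UpperCell d \<cdot> UpperCell c)) \<cdot> Filler (CSrc c) \<cdot> ((LowerCell c \<cdot> LowerCell d)
      \<lhd> p)"
    by (simp add: whisker_left_vcomp[OF C(3) D(3) q] whisker_right_vcomp[OF p D(4) C(4)])
  finally show ?thesis
    unfolding is_square_cell_iff[OF p q] vcomp_cell_def square_cell.simps
    using C(1) D(2) nat_cell_vcomp[OF C(3) D(3)] nat_cell_vcomp[OF D(4) C(4)] by simp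
qed

text \<open>
  At an object, the filler of the target pasting is a row of six arrows. Naturality of the lower
  cell moves it to the right past the image of the inner square, and naturality of the source
  filler moves the inner upper cell to the left; what results is the source filler whiskered by
  the horizontal composites.
\<close>

lemma hcomp_cell_square:
  assumes p: "functor_from_to p A B" and q: "functor_from_to q C D" and r: "functor_from_to r X Y"
    and c: "is_square_cell p q c" and d: "is_square_cell q r d"
  shows "is_square_cell p r (hcomp_cell d c)"
proof -
  define s s' t t' \<phi> \<psi> \<chi> \<omega> where defs: "s = CSrc c" "s' = CTrg c" "t = CSrc d" "t' = CTrg d"
    "\<phi> = UpperCell c" "\<psi> = LowerCell c" "\<chi> = UpperCell d" "\<omega> = LowerCell d"
  note C = square_cellD[OF c p q, folded defs] and D = square_cellD[OF d q r, folded defs]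
  note S = lax_squareD[OF C(1) p q] and S' = lax_squareD[OF C(2) p q]
    and T = lax_squareD[OF D(1) q r] and T' = lax_squareD[OF D(2) q r]
  note ts = paste_square_lax[OF p q r C(1) D(1)] and ts' = paste_square_lax[OF p q r C(2) D(2)]
  have u: "nat_cell (\<chi> \<star> \<phi>) (Upper (paste_square t s)) (Upper (paste_square t' s')) A X"
    and l: "nat_cell (\<omega> \<star> \<psi>) (Lower (paste_square t' s')) (Lower (paste_square t s)) B Y"
    using nat_cell_hcomp[OF C(3) D(3)] nat_cell_hcomp[OF C(4) D(4)] by (simp_all add: paste_square_def)
  interpret D: category D by (rule functor_from_toD(5)[OF q])
  interpret Y: category Y by (rule functor_from_toD(5)[OF r])
  have "Filler (paste_square t' s') = (r \<rhd> (\<chi> \<star> \<phi>)) \<cdot> Filler (paste_square t s) \<cdot> ((\<omega> \<star> \<psi>) \<lhd> p)"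
  proof (rule nat_cell_eqI[OF lax_squareD(4)[OF ts' p r] whiskered_filler_cell[OF p r ts u l]])
    fix a assume a: "a \<in> Obj A"
    let ?fa = "OMap (Upper s) a" and ?fa' = "OMap (Upper s') a" and ?pa = "OMap p a"
    note fa = functor_OMap[OF S(1) a] and fa' = functor_OMap[OF S'(1) a] and pa = functor_OMap[OF p a]
    note al = filler_at[OF p q C(1) a] and ph = nat_cell_at[OF C(3) a]
      and ps = nat_cell_at[OF C(4) pa]
    note qph = functor_AMap[OF q ph]
    note qpal = D.Comp_in_hom[OF al qph]
    note ga = filler_at[OF q r D(1) fa] and ga' = filler_at[OF q r D(1) fa']
    note om = nat_cell_at[OF D(4) functor_OMap[OF q fa']]
      and om0 = nat_cell_at[OF D(4) functor_OMap[OF S(2) pa]]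
    note ch = nat_cell_at[OF D(3) fa']
    note rch = functor_AMap[OF r ch] and rhph = functor_AMap[OF r functor_AMap[OF T(1) ph]]
    note kps = functor_AMap[OF T'(2) ps] and k'al = functor_AMap[OF T'(2) qpal]
      and kal = functor_AMap[OF T(2) al] and kqph = functor_AMap[OF T(2) qph]
    have al': "NAt (Filler s') a = Comp D (Comp D (AMap q (NAt \<phi> a)) (NAt (Filler s) a)) (NAt \<psi> ?pa)"
      using NAt_whiskered_filler[OF p q C(1) C(3,4) a] C(5) D.hom_assoc[OF ps al qph] by simp
    have "NAt (Filler (paste_square t' s')) a =
        Comp Y (Comp Y (AMap r (NAt \<chi> ?fa')) (Comp Y (NAt (Filler t) ?fa') (NAt \<omega> (OMap q ?fa'))))
          (Comp Y (AMap (Lower t') (Comp D (AMap q (NAt \<phi> a)) (NAt (Filler s) a)))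
            (AMap (Lower t') (NAt \<psi> ?pa)))"
      using NAt_whiskered_filler[OF q r D(1) D(3,4) fa'] D(5) functor_Comp[OF T'(2) ps qpal]
      by (simp add: NAt_paste_square[OF p q r C(2) D(2) a] al')
    also have "\<dots> = Comp Y (AMap r (NAt \<chi> ?fa')) (Comp Y (NAt (Filler t) ?fa')
        (Comp Y (Comp Y (NAt \<omega> (OMap q ?fa')) (AMap (Lower t') (Comp D (AMap q (NAt \<phi> a)) (NAt
            (Filler s) a))))
          (AMap (Lower t') (NAt \<psi> ?pa))))"
      by (simp add: Y.hom_assoc[OF kps k'al om] Y.hom_assoc[OF Y.Comp_in_hom[OF kps k'al] om ga']
          Y.hom_assoc[OF Y.Comp_in_hom[OF kps k'al] Y.Comp_in_hom[OF om ga'] rch])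
    also have "\<dots> = Comp Y (AMap r (NAt \<chi> ?fa')) (Comp Y (NAt (Filler t) ?fa')
        (Comp Y (Comp Y (Comp Y (AMap (Lower t) (AMap q (NAt \<phi> a))) (AMap (Lower t) (NAt (Filler s) a)))
          (NAt \<omega> (OMap (Lower s) ?pa))) (AMap (Lower t') (NAt \<psi> ?pa))))"
      by (simp add: nat_cell_natural[OF D(4) qpal] functor_Comp[OF T(2) al qph])
    also have "\<dots> = Comp Y (AMap r (NAt \<chi> ?fa')) (Comp Y (Comp Y (NAt (Filler t) ?fa')
        (AMap (Lower t) (AMap q (NAt \<phi> a)))) (Comp Y (AMap (Lower t) (NAt (Filler s) a))
          (Comp Y (NAt \<omega> (OMap (Lower s) ?pa)) (AMap (Lower t') (NAt \<psi> ?pa)))))"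
      by (simp add: Y.hom_assoc[OF kps om0 Y.Comp_in_hom[OF kal kqph]]
          Y.hom_assoc[OF Y.Comp_in_hom[OF kps om0] kal kqph]
          Y.hom_assoc[OF Y.Comp_in_hom[OF Y.Comp_in_hom[OF kps om0] kal] kqph ga'])
    also have "\<dots> = Comp Y (AMap r (NAt \<chi> ?fa')) (Comp Y (Comp Y (AMap r (AMap (Upper t) (NAt \<phi> a)))
        (NAt (Filler t) ?fa)) (Comp Y (AMap (Lower t) (NAt (Filler s) a))
          (Comp Y (NAt \<omega> (OMap (Lower s) ?pa)) (AMap (Lower t') (NAt \<psi> ?pa)))))"
      by (simp add: filler_natural[OF q r D(1) ph])
    also have "\<dots> = Comp Y (Comp Y (AMap r (NAt \<chi> ?fa')) (AMap r (AMap (Upper t) (NAt \<phi> a))))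
        (Comp Y (Comp Y (NAt (Filler t) ?fa) (AMap (Lower t) (NAt (Filler s) a)))
          (Comp Y (NAt \<omega> (OMap (Lower s) ?pa)) (AMap (Lower t') (NAt \<psi> ?pa))))"
      by (simp add: Y.hom_assoc[OF Y.Comp_in_hom[OF Y.Comp_in_hom[OF kps om0] kal] ga rhph]
          Y.hom_assoc[OF Y.Comp_in_hom[OF kps om0] kal ga]
          Y.hom_assoc[OF Y.Comp_in_hom[OF Y.Comp_in_hom[OF Y.Comp_in_hom[OF kps om0] kal] ga] rhph rch])
    also have "\<dots> = NAt ((r \<rhd> (\<chi> \<star> \<phi>)) \<cdot> Filler (paste_square t s) \<cdot> ((\<omega> \<star> \<psi>) \<lhd> p)) a"
      using functor_Comp[OF r functor_AMap[OF T(1) ph] ch]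
      by (simp add: NAt_whiskered_filler[OF p r ts u l a] NAt_hcomp[OF C(3) D(3) a]
          NAt_hcomp[OF C(4) D(4) pa] NAt_paste_square[OF p q r C(1) D(1) a])
    finally show "NAt (Filler (paste_square t' s')) a =
        NAt ((r \<rhd> (\<chi> \<star> \<phi>)) \<cdot> Filler (paste_square t s) \<cdot> ((\<omega> \<star> \<psi>) \<lhd> p)) a" .
  qed
  then show ?thesis
    unfolding is_square_cell_iff[OF p r] hcomp_cell_def square_cell.simps defs[symmetric]
    using ts ts' u l by simp
qed

lemma FIB_fib_Obj: "s \<in> Obj (FIB_fib_hom p q) \<longleftrightarrow> is_lax_square p q s"
  by (simp add: FIB_fib_hom_def Let_def)

lemma FIB_fib_Arr: "c \<in> Arr (FIB_fib_hom p q) \<longleftrightarrow> is_square_cell p q c"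
  by (simp add: FIB_fib_hom_def Let_def)

lemma FIB_fib_in_hom:
  "c \<in> hom (FIB_fib_hom p q) s t \<longleftrightarrow> is_square_cell p q c \<and> CSrc c = s \<and> CTrg c = t"
  by (auto simp: FIB_fib_hom_def Let_def hom_def)

lemma FIB_fib_Ident: "is_lax_square p q s \<Longrightarrow> Ident (FIB_fib_hom p q) s = id_cell s"
  by (simp add: FIB_fib_hom_def Let_def)

lemma FIB_fib_Comp:
  "c \<in> hom (FIB_fib_hom p q) s t \<Longrightarrow> d \<in> hom (FIB_fib_hom p q) t u \<Longrightarrow>
    Comp (FIB_fib_hom p q) d c = vcomp_cell d c"
  by (auto simp: FIB_fib_hom_def Let_def hom_def)

lemma vcomp_cell_simps:
  "CSrc (vcomp_cell d c) = CSrc c" "CTrg (vcomp_cell d c) = CTrg d"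
  "UpperCell (vcomp_cell d c) = UpperCell d \<cdot> UpperCell c"
  "LowerCell (vcomp_cell d c) = LowerCell c \<cdot> LowerCell d"
  by (simp_all add: vcomp_cell_def)

lemma id_cell_simps:
  "CSrc (id_cell s) = s" "CTrg (id_cell s) = s"
  "UpperCell (id_cell s) = id_nt (Upper s)" "LowerCell (id_cell s) = id_nt (Lower s)"
  by (simp_all add: id_cell_def)

lemma FIB_fib_hom_category:
  assumes p: "functor_from_to p A B" and q: "functor_from_to q C D"
  shows "category (FIB_fib_hom p q)"
proof (rule categoryI, goal_cases)
  case (4 c s t)
  then show ?case using square_cellD[OF _ p q] by (auto simp: FIB_fib_in_hom FIB_fib_Obj)
next
  case (5 s)
  then show ?case
    by (simp add: FIB_fib_in_hom FIB_fib_Obj FIB_fib_Ident id_cell_square[OF p q] id_cell_simps)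
next
  case (6 c d)
  then show ?case by (auto simp: composable_def FIB_fib_hom_def Let_def)
next
  case (7 c d s t u)
  then show ?case
    unfolding FIB_fib_Comp[OF 7]
    by (simp add: FIB_fib_in_hom vcomp_cell_square[OF p q] vcomp_cell_simps)
next
  case (8 c s t)
  then have c: "is_square_cell p q c" "CSrc c = s" "CTrg c = t" by (simp_all add: FIB_fib_in_hom)
  note C = square_cellD[OF c(1) p q]
  have i: "id_cell t \<in> hom (FIB_fib_hom p q) t t"
    using C(2) c id_cell_square[OF p q, of t] by (simp add: FIB_fib_in_hom id_cell_simps)
  show ?case
    using C(2) c vcomp_id_left[OF C(3)] vcomp_id_right[OF C(4)]
    by (simp add: FIB_fib_Ident FIB_fib_Comp[OF 8 i]) (auto simp: vcomp_cell_def id_cell_def)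
next
  case (9 c s t)
  then have c: "is_square_cell p q c" "CSrc c = s" "CTrg c = t" by (simp_all add: FIB_fib_in_hom)
  note C = square_cellD[OF c(1) p q]
  have i: "id_cell s \<in> hom (FIB_fib_hom p q) s s"
    using C(1) c id_cell_square[OF p q, of s] by (simp add: FIB_fib_in_hom id_cell_simps)
  show ?case
    using C(1) c vcomp_id_right[OF C(3)] vcomp_id_left[OF C(4)]
    by (simp add: FIB_fib_Ident FIB_fib_Comp[OF i 9]) (auto simp: vcomp_cell_def id_cell_def)
next
  case (10 c d e s t u v)
  then have h: "is_square_cell p q c" "CSrc c = s" "CTrg c = t" "is_square_cell p q d" "CSrc d = t"
    "CTrg d = u" "is_square_cell p q e" "CSrc e = u" "CTrg e = v"
    by (simp_all add: FIB_fib_in_hom)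
  note C = square_cellD[OF h(1) p q, unfolded h] and D = square_cellD[OF h(4) p q, unfolded h]
    and E = square_cellD[OF h(7) p q, unfolded h]
  have dc: "vcomp_cell d c \<in> hom (FIB_fib_hom p q) s u" and ed: "vcomp_cell e d \<in> hom (FIB_fib_hom p
      q) t v"
    using h by (simp_all add: FIB_fib_in_hom vcomp_cell_square[OF p q] vcomp_cell_simps)
  show ?case
    using vcomp_assoc[OF C(3) D(3) E(3)] vcomp_assoc[OF E(4) D(4) C(4)]
    by (simp add: FIB_fib_Comp[OF 10(1,2)] FIB_fib_Comp[OF 10(2,3)] FIB_fib_Comp[OF dc 10(3)]
        FIB_fib_Comp[OF 10(1) ed])
      (simp add: vcomp_cell_def)
qed (auto simp: FIB_fib_hom_def Let_def)

lemma FIB_fib_simps: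
  "Obj2 FIB_fib = {p. fibration p}" "Hom2 FIB_fib = FIB_fib_hom" "Unit2 FIB_fib = id_square"
  by (simp_all add: FIB_fib_def)

lemma FIB_fib_comp1:
  "is_lax_square p q s \<Longrightarrow> is_lax_square q r t \<Longrightarrow> comp1 FIB_fib p q r t s = paste_square t s"
  by (simp add: comp1_def FIB_fib_def Let_def prod_cat_simps FIB_fib_Obj)

lemma FIB_fib_comp2:
  "is_square_cell p q c \<Longrightarrow> is_square_cell q r d \<Longrightarrow> comp2 FIB_fib p q r d c = hcomp_cell d c"
  by (simp add: comp2_def FIB_fib_def Let_def prod_cat_simps FIB_fib_Arr)

lemma FIB_fib_Comp2_functor:
  assumes p: "functor_from_to p A B" and q: "functor_from_to q C D" and r: "functor_from_to r X Y"
  shows "functor_from_to (Comp2 FIB_fib p q r)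
    (prod_cat (FIB_fib_hom q r) (FIB_fib_hom p q)) (FIB_fib_hom p r)"
  unfolding FIB_fib_def Let_def two_cat.simps
proof (rule functor_from_to_restrictI[OF prod_cat_category[OF FIB_fib_hom_category[OF q r]
        FIB_fib_hom_category[OF p q]] FIB_fib_hom_category[OF p r]], goal_cases)
  case (1 x)
  then show ?case
    by (auto simp: prod_cat_simps FIB_fib_Obj paste_square_lax[OF p q r])
next
  case (2 f x y)
  obtain d c t s t' s' where e: "f = (d, c)" "x = (t, s)" "y = (t', s')" by (metis surj_pair)
  show ?case
    using 2 hcomp_cell_square[OF p q r, of c d]
    by (auto simp: e prod_cat_hom FIB_fib_in_hom) (simp_all add: hcomp_cell_def)
next
  case (3 x)
  obtain t s where e: "x = (t, s)" by (metis surj_pair)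
  have c: "is_lax_square q r t" "is_lax_square p q s"
    using 3 by (simp_all add: e prod_cat_simps FIB_fib_Obj)
  note S = lax_squareD[OF c(2) p q] and T = lax_squareD[OF c(1) q r]
  show ?case
    using c paste_square_lax[OF p q r c(2,1)] hcomp_id_nt[OF S(1) T(1)] hcomp_id_nt[OF S(2) T(2)]
    by (simp add: e prod_cat_Ident FIB_fib_Obj FIB_fib_Ident)
      (simp add: hcomp_cell_def id_cell_def paste_square_def)
next
  case (4 f g x y z)
  obtain d c t s t' s' d' c' t'' s''
    where e: "f = (d, c)" "x = (t, s)" "y = (t', s')" "g = (d', c')" "z = (t'', s'')"
    by (metis surj_pair)
  have h: "d \<in> hom (FIB_fib_hom q r) t t'" "c \<in> hom (FIB_fib_hom p q) s s'"
    "d' \<in> hom (FIB_fib_hom q r) t' t''" "c' \<in> hom (FIB_fib_hom p q) s' s''"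
    using 4 by (simp_all add: e prod_cat_hom)
  then have i: "is_square_cell q r d" "CSrc d = t" "CTrg d = t'" "is_square_cell p q c" "CSrc c = s"
    "CTrg c = s'" "is_square_cell q r d'" "CSrc d' = t'" "CTrg d' = t''" "is_square_cell p q c'"
    "CSrc c' = s'" "CTrg c' = s''"
    by (simp_all add: FIB_fib_in_hom)
  note D = square_cellD[OF i(1) q r, unfolded i] and D' = square_cellD[OF i(7) q r, unfolded i]
    and C = square_cellD[OF i(4) p q, unfolded i] and C' = square_cellD[OF i(10) p q, unfolded i]
  have "hcomp_cell d c \<in> hom (FIB_fib_hom p r) (paste_square t s) (paste_square t' s')"
    "hcomp_cell d' c' \<in> hom (FIB_fib_hom p r) (paste_square t' s') (paste_square t'' s'')"
    using hcomp_cell_square[OF p q r] i by (auto simp: FIB_fib_in_hom) (simp_all add: hcomp_cell_def)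
  from FIB_fib_Comp[OF this] show ?case
    using interchange[OF C(3) C'(3) D(3) D'(3)] interchange[OF C'(4) C(4) D'(4) D(4)] i
    by (simp add: e prod_cat_Comp[OF h(1,3) h(2,4)] FIB_fib_Comp[OF h(1,3)] FIB_fib_Comp[OF h(2,4)])
      (simp add: hcomp_cell_def vcomp_cell_def)
qed

lemma hcomp_cell_assoc:
  assumes p: "functor_from_to p A B" and q: "functor_from_to q C D" and r: "functor_from_to r X Y"
    and v: "functor_from_to v U V"
    and c: "is_square_cell p q c" and d: "is_square_cell q r d" and e: "is_square_cell r v e"
  shows "hcomp_cell e (hcomp_cell d c) = hcomp_cell (hcomp_cell e d) c"
proof -
  note C = square_cellD[OF c p q] and D = square_cellD[OF d q r] and E = square_cellD[OF e r v]
  show ?thesis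
    using paste_square_assoc[OF p q r v C(1) D(1) E(1)] paste_square_assoc[OF p q r v C(2) D(2) E(2)]
      hcomp_assoc[OF C(3) D(3) E(3)] hcomp_assoc[OF C(4) D(4) E(4)]
    by (simp add: hcomp_cell_def)
qed

lemma FIB_fib_two_category: "two_category FIB_fib"
proof (rule two_category.intro, goal_cases)
  case 1 then show ?case
    by (simp add: FIB_fib_simps FIB_fib_hom_category[OF fibration_functor fibration_functor])
next
  case 2 then show ?case
    by (simp add: FIB_fib_simps FIB_fib_Obj id_square_lax[OF _ fibration_functor])
next
  case 3 then show ?case
    by (simp add: FIB_fib_simps FIB_fib_Comp2_functor[OF fibration_functor fibration_functor
        fibration_functor])
next
  case (4 w x y z f g h)
  then have f: "functor_from_to w (Src w) (Trg w)" "functor_from_to x (Src x) (Trg x)"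
    "functor_from_to y (Src y) (Trg y)" "functor_from_to z (Src z) (Trg z)"
    and o: "is_lax_square w x f" "is_lax_square x y g" "is_lax_square y z h"
    by (simp_all add: FIB_fib_simps FIB_fib_Obj fibration_functor)
  show ?case
    using paste_square_assoc[OF f o] paste_square_lax[OF f(1-3) o(1,2)]
      paste_square_lax[OF f(2-4) o(2,3)] o
    by (simp add: FIB_fib_comp1)
next
  case (5 w x y z \<rho> \<sigma> \<tau>)
  then have f: "functor_from_to w (Src w) (Trg w)" "functor_from_to x (Src x) (Trg x)"
    "functor_from_to y (Src y) (Trg y)" "functor_from_to z (Src z) (Trg z)"
    and o: "is_square_cell w x \<rho>" "is_square_cell x y \<sigma>" "is_square_cell y z \<tau>"
    by (simp_all add: FIB_fib_simps FIB_fib_Arr fibration_functor)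
  show ?case
    using hcomp_cell_assoc[OF f o] hcomp_cell_square[OF f(1-3) o(1,2)]
      hcomp_cell_square[OF f(2-4) o(2,3)] o
    by (simp add: FIB_fib_comp2)
next
  case (6 x y f)
  then have p: "functor_from_to x (Src x) (Trg x)" "functor_from_to y (Src y) (Trg y)" "fibration y"
    and f: "is_lax_square x y f" by (simp_all add: FIB_fib_simps FIB_fib_Obj fibration_functor)
  show ?case
    using f paste_id_square_left[OF p(1,2) f] id_square_lax[OF p(3,2)]
    by (simp add: FIB_fib_simps FIB_fib_comp1)
next
  case (7 x y f)
  then have p: "functor_from_to x (Src x) (Trg x)" "functor_from_to y (Src y) (Trg y)" "fibration x"
    and f: "is_lax_square x y f" by (simp_all add: FIB_fib_simps FIB_fib_Obj fibration_functor)
  show ?case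
    using f paste_id_square_right[OF p(1,2) f] id_square_lax[OF p(3,1)]
    by (simp add: FIB_fib_simps FIB_fib_comp1)
next
  case (8 x y \<sigma>)
  then have p: "functor_from_to x (Src x) (Trg x)" "functor_from_to y (Src y) (Trg y)" "fibration y"
    and c: "is_square_cell x y \<sigma>" by (simp_all add: FIB_fib_simps FIB_fib_Arr fibration_functor)
  note C = square_cellD[OF c p(1,2)]
  note i = id_square_lax[OF p(3,2)]
  have "hcomp_cell (id_cell (id_square y)) \<sigma> = \<sigma>"
    using paste_id_square_left[OF p(1,2) C(1)] paste_id_square_left[OF p(1,2) C(2)]
      hcomp_unit_left[OF C(3)] hcomp_unit_left[OF C(4)]
    by (simp add: hcomp_cell_def id_cell_def) (simp add: id_square_def)
  then show ?case
    using c id_cell_square[OF p(2,2) i]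
    by (simp add: FIB_fib_simps unit_cell_def FIB_fib_Ident[OF i] FIB_fib_comp2)
next
  case (9 x y \<sigma>)
  then have p: "functor_from_to x (Src x) (Trg x)" "functor_from_to y (Src y) (Trg y)" "fibration x"
    and c: "is_square_cell x y \<sigma>" by (simp_all add: FIB_fib_simps FIB_fib_Arr fibration_functor)
  note C = square_cellD[OF c p(1,2)]
  note i = id_square_lax[OF p(3,1)]
  have "hcomp_cell \<sigma> (id_cell (id_square x)) = \<sigma>"
    using paste_id_square_right[OF p(1,2) C(1)] paste_id_square_right[OF p(1,2) C(2)]
      hcomp_unit_right[OF C(3)] hcomp_unit_right[OF C(4)]
    by (simp add: hcomp_cell_def id_cell_def) (simp add: id_square_def)
  then show ?case
    using c id_cell_square[OF p(1,1) i]
    by (simp add: FIB_fib_simps unit_cell_def FIB_fib_Ident[OF i] FIB_fib_comp2)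
qed

section \<open>The codomain 2-functor\<close>

lemma cod_2functor_simps:
  "OMap2 cod_2functor p = Trg p"
  "is_lax_square p q s \<Longrightarrow> OMap (HomMap2 cod_2functor p q) s = Lower s"
  "is_square_cell p q c \<Longrightarrow> AMap (HomMap2 cod_2functor p q) c = LowerCell c"
  by (simp_all add: cod_2functor_def FIB_fib_Obj FIB_fib_Arr)

lemma square_cell_LowerCell:
  assumes p: "functor_from_to p A B" and q: "functor_from_to q C D"
    and c: "c \<in> hom (FIB_fib_hom p q) s t"
  shows "LowerCell c \<in> hom (Cat_co_fib_hom B D) (Lower s) (Lower t)"
  using c square_cellD(4)[OF _ p q, of c] lax_squareD(3)[OF square_cellD(1)[OF _ p q] p q, of c]
    lax_squareD(3)[OF square_cellD(2)[OF _ p q] p q, of c]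
  by (auto simp: FIB_fib_in_hom Cat_co_fib_in_hom)

lemma cod_2functor_HomMap2:
  assumes p: "functor_from_to p A B" and q: "functor_from_to q C D"
  shows "functor_from_to (HomMap2 cod_2functor p q) (FIB_fib_hom p q) (Cat_co_fib_hom B D)"
  unfolding cod_2functor_def two_ftor.simps functor_from_toD(3)[OF p] functor_from_toD(3)[OF q]
proof (rule functor_from_to_restrictI[OF FIB_fib_hom_category[OF p q] Cat_co_fib_hom_category],
    goal_cases)
  case (1 s)
  then show ?case using lax_squareD(2,3)[OF _ p q] by (simp add: FIB_fib_Obj Cat_co_fib_Obj)
next
  case (2 c s t)
  then show ?case by (rule square_cell_LowerCell[OF p q])
next
  case (3 s)
  then show ?case
    using lax_squareD(2,3)[OF _ p q, of s]
    by (simp add: FIB_fib_Obj Cat_co_fib_Obj FIB_fib_Ident Cat_co_fib_Ident id_cell_simps)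
next
  case (4 c d s t u)
  then show ?case
    using Cat_co_fib_Comp[OF square_cell_LowerCell[OF p q 4(1)] square_cell_LowerCell[OF p q 4(2)]]
    by (simp add: FIB_fib_Comp[OF 4] vcomp_cell_simps)
qed

lemma cod_2functor_two_functor: "two_functor FIB_fib Cat_co_fib cod_2functor"
proof (rule two_functor.intro[OF FIB_fib_two_category Cat_co_fib_two_category], goal_cases)
  case (1 x)
  then show ?case
    using functor_from_toD(5)[OF fibration_functor, of x]
    by (simp add: FIB_fib_simps Cat_co_fib_simps cod_2functor_simps)
next
  case 2 then show ?case
    by (simp add: FIB_fib_simps Cat_co_fib_simps cod_2functor_simps
        cod_2functor_HomMap2[OF fibration_functor fibration_functor])
next
  case 3 then show ?case
    by (simp add: FIB_fib_simps Cat_co_fib_simps cod_2functor_simps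
        id_square_lax[OF _ fibration_functor])
      (simp add: id_square_def)
next
  case (4 x y z f g)
  then have p: "functor_from_to x (Src x) (Trg x)" "functor_from_to y (Src y) (Trg y)"
    "functor_from_to z (Src z) (Trg z)" and o: "is_lax_square x y f" "is_lax_square y z g"
    by (simp_all add: FIB_fib_simps FIB_fib_Obj fibration_functor)
  have "Lower f \<in> Obj (Cat_co_fib_hom (Trg x) (Trg y))" "Lower g \<in> Obj (Cat_co_fib_hom (Trg y) (Trg z))"
    using lax_squareD(2,3)[OF o(1) p(1,2)] lax_squareD(2,3)[OF o(2) p(2,3)]
    by (simp_all add: Cat_co_fib_Obj)
  then show ?case
    using o paste_square_lax[OF p o]
    by (simp add: FIB_fib_comp1 cod_2functor_simps Cat_co_fib_comp1) (simp add: paste_square_def)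
next
  case (5 x y z \<sigma> \<tau>)
  then have p: "functor_from_to x (Src x) (Trg x)" "functor_from_to y (Src y) (Trg y)"
    "functor_from_to z (Src z) (Trg z)" and o: "is_square_cell x y \<sigma>" "is_square_cell y z \<tau>"
    by (simp_all add: FIB_fib_simps FIB_fib_Arr fibration_functor)
  have "LowerCell \<sigma> \<in> Arr (Cat_co_fib_hom (Trg x) (Trg y))" "LowerCell \<tau> \<in> Arr (Cat_co_fib_hom (Trg
      y) (Trg z))"
    using in_homD(1)[OF square_cell_LowerCell[OF p(1,2)], of \<sigma>]
      in_homD(1)[OF square_cell_LowerCell[OF p(2,3)], of \<tau>] o by (simp_all add: FIB_fib_in_hom)
  then show ?case
    using o hcomp_cell_square[OF p o]
    by (simp add: FIB_fib_comp2 cod_2functor_simps Cat_co_fib_comp2) (simp add: hcomp_cell_def)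
qed

section \<open>Opcartesian 1-cells\<close>

lemma precomp_functor:
  assumes "two_category E" "x \<in> Obj2 E" "y \<in> Obj2 E" "z \<in> Obj2 E" "h \<in> Obj (Hom2 E x y)"
  shows "functor_from_to (precomp E x y z h) (Hom2 E y z) (Hom2 E x z)"
proof -
  interpret two_category E by (rule assms(1))
  interpret XY: category "Hom2 E x y" by (rule Hom2_category[OF assms(2,3)])
  interpret YZ: category "Hom2 E y z" by (rule Hom2_category[OF assms(3,4)])
  note F = Comp2_functor[OF assms(2-4)] and h = assms(5)
  note i = XY.Ident_hom[OF h]
  show ?thesis
    unfolding precomp_def comp1_def comp2_def
  proof (rule functor_from_to_restrictI[OF YZ.category_axioms Hom2_category[OF assms(2,4)]], goal_cases)
    case (1 g)
    then show ?case using h functor_OMap[OF F, of "(g, h)"] by (simp add: prod_cat_simps)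
  next
    case (2 \<tau> g g')
    then show ?case using functor_AMap[OF F, of "(\<tau>, Ident (Hom2 E x y) h)"] i
      by (simp add: prod_cat_hom)
  next
    case (3 g)
    then show ?case using h functor_Ident[OF F, of "(g, h)"] by (simp add: prod_cat_simps
        prod_cat_Ident)
  next
    case (4 \<tau> \<tau>' g g' g'')
    then show ?case
      using functor_Comp[OF F, of "(\<tau>, Ident (Hom2 E x y) h)" "(g, h)" "(g', h)"
          "(\<tau>', Ident (Hom2 E x y) h)" "(g'', h)"] i
      by (simp add: prod_cat_hom prod_cat_Comp[OF 4 i i] XY.hom_Ident_left[OF i])
  qed
qed

text \<open>
  The opcartesian lift of \<open>f\<close> at \<open>p\<close>.
\<close>

definition pushforward_square :: "('o, 'm, 'o, 'm) ftor \<Rightarrow> ('o, 'm, 'o, 'm) ftor \<Rightarrow> ('o, 'm)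
    lax_square" where
  "pushforward_square f p = \<lparr> Upper = id_functor (Src p), Lower = f, Filler = id_nt (f \<circ>\<^sub>F p) \<rparr>"

lemma pushforward_square_lax:
  assumes p: "functor_from_to p A B" and f: "functor_from_to f B D" "fibration f"
  shows "is_lax_square p (f \<circ>\<^sub>F p) (pushforward_square f p)"
  unfolding is_lax_square_iff[OF p functor_comp_from_to[OF p f(1)]]
  using f nat_cell_id[OF functor_comp_from_to[OF p f(1)]] id_functor_right[OF
      functor_comp_from_to[OF p f(1)]]
    id_functor_from_to[OF functor_from_toD(4)[OF p]] functor_from_toD(2)[OF p]
  by (simp add: pushforward_square_def)

text \<open>
  One factor of the pasted filler is the image of an identity, and the other is the filler of \<open>t\<close>
  restricted along an identity functor. This makes precomposition invertible up to the lower
  functor.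
\<close>

lemma paste_pushforward_square:
  assumes p: "functor_from_to p A B" and f: "functor_from_to f B D" and z: "functor_from_to z X Y"
    and t: "is_lax_square (f \<circ>\<^sub>F p) z t"
  shows "paste_square t (pushforward_square f p) =
    \<lparr> Upper = Upper t, Lower = Lower t \<circ>\<^sub>F f, Filler = Filler t \<rparr>"
proof -
  note T = lax_squareD[OF t functor_comp_from_to[OF p f] z]
  show ?thesis
    using functor_from_toD(2)[OF p] id_functor_right[OF T(1)] whisker_right_unit[OF T(4)]
      whisker_left_id_nt[OF functor_comp_from_to[OF p f] T(2)] vcomp_id_right[OF T(4)]
    by (simp add: paste_square_def pushforward_square_def)
qed

lemma hcomp_pushforward_square:
  assumes p: "functor_from_to p A B" and f: "functor_from_to f B D" and z: "functor_from_to z X Y"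
    and d: "is_square_cell (f \<circ>\<^sub>F p) z d"
  shows "hcomp_cell d (id_cell (pushforward_square f p)) =
    \<lparr> CSrc = paste_square (CSrc d) (pushforward_square f p),
      CTrg = paste_square (CTrg d) (pushforward_square f p),
      UpperCell = UpperCell d, LowerCell = LowerCell d \<lhd> f \<rparr>"
proof -
  note D = square_cellD[OF d functor_comp_from_to[OF p f] z]
  show ?thesis
    using functor_from_toD(2)[OF p] hcomp_unit_right[OF D(3)] hcomp_id_right[OF f D(4)]
    by (simp add: hcomp_cell_def id_cell_def) (simp add: pushforward_square_def)
qed

text \<open>
  The converse of the pasting formula: strict associativity turns the source of the filler of \<open>s\<close>
  into \<open>g \<circ>\<^sub>F (f \<circ>\<^sub>F p)\<close> without changing the filler.
\<close>

lemma lax_square_factor_pushforward: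
  assumes p: "functor_from_to p A B" and f: "functor_from_to f B D" and z: "functor_from_to z X Y"
    and s: "is_lax_square p z s" and g: "functor_from_to g D Y" "fibration g" and eq: "Lower s = g
        \<circ>\<^sub>F f"
  shows "is_lax_square (f \<circ>\<^sub>F p) z \<lparr> Upper = Upper s, Lower = g, Filler = Filler s \<rparr>"
  using lax_squareD[OF s p z] g
  by (simp add: is_lax_square_iff[OF functor_comp_from_to[OF p f] z] eq
      functor_comp_assoc_from_to[OF p f])

lemma pushforward_square_opcartesian:
  assumes p: "fibration p" "functor_from_to p A B" and f: "fibration f" "functor_from_to f B D"
  shows "opcartesian_1cell FIB_fib Cat_co_fib cod_2functor p (f \<circ>\<^sub>F p) (pushforward_square f p)"
proof -
  let ?h = "pushforward_square f p"
  note y = fibration_comp[OF p f] and fp = functor_comp_from_to[OF p(2) f(2)]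
  note h = pushforward_square_lax[OF p(2) f(2,1)]
  have Lh: "Lower ?h = f" by (simp add: pushforward_square_def)
  have fO: "f \<in> Obj (Cat_co_fib_hom B D)" using f by (simp add: Cat_co_fib_Obj)
  have cats: "category B" "category D" using functor_from_toD(4,5)[OF f(2)] by auto
  have "strict_pullback (precomp FIB_fib p (f \<circ>\<^sub>F p) z ?h) (HomMap2 cod_2functor (f \<circ>\<^sub>F p) z)
      (HomMap2 cod_2functor p z) (precomp Cat_co_fib B D (Trg z) f)"
    if z: "fibration z" for z
  proof -
    note fz = fibration_functor[OF z]
    have Y: "category (Trg z)" using functor_from_toD(5)[OF fz] .
    let ?T = "precomp FIB_fib p (f \<circ>\<^sub>F p) z ?h" and ?L = "HomMap2 cod_2functor (f \<circ>\<^sub>F p) z"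
      and ?R = "HomMap2 cod_2functor p z" and ?B = "precomp Cat_co_fib B D (Trg z) f"
    have T: "functor_from_to ?T (FIB_fib_hom (f \<circ>\<^sub>F p) z) (FIB_fib_hom p z)"
      using precomp_functor[OF FIB_fib_two_category, of p "f \<circ>\<^sub>F p" z ?h] p y z h
      by (simp add: FIB_fib_simps FIB_fib_Obj)
    have B: "functor_from_to ?B (Cat_co_fib_hom D (Trg z)) (Cat_co_fib_hom B (Trg z))"
      using precomp_functor[OF Cat_co_fib_two_category, of B D "Trg z" f] cats Y fO
      by (simp add: Cat_co_fib_simps)
    have TO: "OMap ?T t = \<lparr> Upper = Upper t, Lower = Lower t \<circ>\<^sub>F f, Filler = Filler t \<rparr>"
      if "is_lax_square (f \<circ>\<^sub>F p) z t" for t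
      using that paste_pushforward_square[OF p(2) f(2) fz that] h
      by (simp add: precomp_def FIB_fib_simps FIB_fib_Obj FIB_fib_comp1)
    have TA: "AMap ?T d = \<lparr> CSrc = OMap ?T (CSrc d), CTrg = OMap ?T (CTrg d),
        UpperCell = UpperCell d, LowerCell = LowerCell d \<lhd> f \<rparr>" if d: "is_square_cell (f \<circ>\<^sub>F p) z d"
            for d
      using d hcomp_pushforward_square[OF p(2) f(2) fz d] h id_cell_square[OF p(2) fp h]
        TO[OF square_cellD(1)[OF d fp fz]] TO[OF square_cellD(2)[OF d fp fz]]
        paste_pushforward_square[OF p(2) f(2) fz square_cellD(1)[OF d fp fz]]
        paste_pushforward_square[OF p(2) f(2) fz square_cellD(2)[OF d fp fz]]
      by (simp add: precomp_def FIB_fib_simps FIB_fib_Obj FIB_fib_Arr FIB_fib_comp2 FIB_fib_Ident)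
    have BO: "OMap ?B g = g \<circ>\<^sub>F f" if "g \<in> Obj (Cat_co_fib_hom D (Trg z))" for g
      using that fO by (simp add: precomp_def Cat_co_fib_simps Cat_co_fib_comp1)
    have BA: "AMap ?B \<psi> = \<psi> \<lhd> f" if \<psi>: "\<psi> \<in> Arr (Cat_co_fib_hom D (Trg z))" for \<psi>
    proof -
      obtain g g' where "nat_cell \<psi> g' g D (Trg z)" using Cat_co_fib_Arr[OF \<psi>] by blast
      moreover have "id_nt f \<in> Arr (Cat_co_fib_hom B D)"
        using f nat_cell_id[OF f(2)] in_homD(1)[of "id_nt f" "Cat_co_fib_hom B D" f f]
        by (simp add: Cat_co_fib_in_hom)
      ultimately show ?thesis
        using \<psi> fO hcomp_id_right[OF f(2)]
        by (simp add: precomp_def Cat_co_fib_simps Cat_co_fib_Ident Cat_co_fib_comp2)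
    qed
    show ?thesis
    \<comment> \<open>A compatible pair consists of a cell out of \<open>p\<close> and a factorization of its lower part through
        \<open>f\<close>;
      replacing the lower part by the given factor is the unique preimage.\<close>
    proof (rule strict_pullbackI[OF T cod_2functor_HomMap2[OF fp fz] cod_2functor_HomMap2[OF p(2)
        fz] B])
      fix t assume "t \<in> Obj (FIB_fib_hom (f \<circ>\<^sub>F p) z)"
      then have t: "is_lax_square (f \<circ>\<^sub>F p) z t" by (simp add: FIB_fib_Obj)
      have "is_lax_square p z (OMap ?T t)"
        using functor_OMap[OF T, of t] t by (simp add: FIB_fib_Obj)
      then show "OMap ?R (OMap ?T t) = OMap ?B (OMap ?L t)"
        using t lax_squareD(2,3)[OF t fp fz] by (simp add: cod_2functor_simps BO Cat_co_fib_Obj)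
            (simp add: TO)
    next
      fix d assume "d \<in> Arr (FIB_fib_hom (f \<circ>\<^sub>F p) z)"
      then have d: "is_square_cell (f \<circ>\<^sub>F p) z d" by (simp add: FIB_fib_Arr)
      have d': "is_square_cell p z (AMap ?T d)"
        using functor_AMap[OF T, of d] d by (simp add: FIB_fib_in_hom)
      have "LowerCell d \<in> Arr (Cat_co_fib_hom D (Trg z))"
        using in_homD(1)[OF square_cell_LowerCell[OF fp fz]] d by (auto simp: FIB_fib_in_hom)
      then show "AMap ?R (AMap ?T d) = AMap ?B (AMap ?L d)"
        using d d' by (simp add: cod_2functor_simps BA) (simp add: TA)
    next
      fix s g assume "s \<in> Obj (FIB_fib_hom p z)" and "g \<in> Obj (Cat_co_fib_hom D (Trg z))"
        and eq: "OMap ?R s = OMap ?B g"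
      then have s: "is_lax_square p z s" and g: "functor_from_to g D (Trg z)" "fibration g"
        and gO: "g \<in> Obj (Cat_co_fib_hom D (Trg z))"
        by (simp_all add: FIB_fib_Obj Cat_co_fib_Obj)
      have low: "Lower s = g \<circ>\<^sub>F f" using eq s gO by (simp add: cod_2functor_simps BO)
      have t: "is_lax_square (f \<circ>\<^sub>F p) z \<lparr> Upper = Upper s, Lower = g, Filler = Filler s \<rparr>"
        by (rule lax_square_factor_pushforward[OF p(2) f(2) fz s g low])
      show "\<exists>!t. t \<in> Obj (FIB_fib_hom (f \<circ>\<^sub>F p) z) \<and> OMap ?T t = s \<and> OMap ?L t = g"
      proof (rule ex1I)
        show "\<lparr> Upper = Upper s, Lower = g, Filler = Filler s \<rparr> \<in> Obj (FIB_fib_hom (f \<circ>\<^sub>F p) z) \<and>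
            OMap ?T \<lparr> Upper = Upper s, Lower = g, Filler = Filler s \<rparr> = s \<and>
            OMap ?L \<lparr> Upper = Upper s, Lower = g, Filler = Filler s \<rparr> = g"
          using t low[symmetric] by (simp add: FIB_fib_Obj TO cod_2functor_simps)
      next
        fix t assume "t \<in> Obj (FIB_fib_hom (f \<circ>\<^sub>F p) z) \<and> OMap ?T t = s \<and> OMap ?L t = g"
        then show "t = \<lparr> Upper = Upper s, Lower = g, Filler = Filler s \<rparr>"
          by (auto simp: FIB_fib_Obj TO cod_2functor_simps)
      qed
    next
      fix c \<psi> assume "c \<in> Arr (FIB_fib_hom p z)" and \<psi>A: "\<psi> \<in> Arr (Cat_co_fib_hom D (Trg z))"
        and eq: "AMap ?R c = AMap ?B \<psi>"
      then have c: "is_square_cell p z c" and low: "LowerCell c = \<psi> \<lhd> f"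
        by (simp_all add: FIB_fib_Arr cod_2functor_simps BA)
      note C = square_cellD[OF c p(2) fz]
      obtain g g' where \<psi>: "nat_cell \<psi> g' g D (Trg z)" and fib: "fibration g" "fibration g'"
        using Cat_co_fib_Arr[OF \<psi>A] by blast
      have lows: "Lower (CSrc c) = g \<circ>\<^sub>F f" "Lower (CTrg c) = g' \<circ>\<^sub>F f"
        using nat_cellD(5,6)[OF C(4)] nat_cellD(5,6)[OF nat_cell_whisker_right[OF f(2) \<psi>]] low by auto
      let ?s = "\<lparr> Upper = Upper (CSrc c), Lower = g, Filler = Filler (CSrc c) \<rparr>"
      let ?t = "\<lparr> Upper = Upper (CTrg c), Lower = g', Filler = Filler (CTrg c) \<rparr>"
      let ?d = "\<lparr> CSrc = ?s, CTrg = ?t, UpperCell = UpperCell c, LowerCell = \<psi> \<rparr>"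
      have s: "is_lax_square (f \<circ>\<^sub>F p) z ?s" and t: "is_lax_square (f \<circ>\<^sub>F p) z ?t"
        using lax_square_factor_pushforward[OF p(2) f(2) fz C(1) nat_cellD(2)[OF \<psi>] fib(1) lows(1)]
          lax_square_factor_pushforward[OF p(2) f(2) fz C(2) nat_cellD(1)[OF \<psi>] fib(2) lows(2)] by auto
      have d: "is_square_cell (f \<circ>\<^sub>F p) z ?d"
        unfolding is_square_cell_iff[OF fp fz]
        using s t C(3,5) \<psi> whisker_right_comp[OF p(2) f(2) \<psi>] low by simp
      show "\<exists>!d. d \<in> Arr (FIB_fib_hom (f \<circ>\<^sub>F p) z) \<and> AMap ?T d = c \<and> AMap ?L d = \<psi>"
      proof (rule ex1I)
        show "?d \<in> Arr (FIB_fib_hom (f \<circ>\<^sub>F p) z) \<and> AMap ?T ?d = c \<and> AMap ?L ?d = \<psi>"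
          using d s t lows[symmetric] low[symmetric] by (simp add: FIB_fib_Arr TA TO cod_2functor_simps)
      next
        fix d assume "d \<in> Arr (FIB_fib_hom (f \<circ>\<^sub>F p) z) \<and> AMap ?T d = c \<and> AMap ?L d = \<psi>"
        then have d: "is_square_cell (f \<circ>\<^sub>F p) z d" and c_eq: "c = AMap ?T d" and \<psi>_eq: "LowerCell d
            = \<psi>"
          by (auto simp: FIB_fib_Arr cod_2functor_simps)
        note E = square_cellD[OF d fp fz]
        have "Lower (CSrc d) = g" "Lower (CTrg d) = g'"
          using nat_cellD(5,6)[OF E(4)] nat_cellD(5,6)[OF \<psi>] \<psi>_eq by auto
        then show "d = ?d"
          using \<psi>_eq by (simp add: c_eq TA[OF d] TO[OF E(1)] TO[OF E(2)])
      qed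
    qed
  qed
  then show ?thesis
    using h p f Lh functor_from_toD(3)[OF p(2)] functor_from_toD(3)[OF fp]
    by (simp add: opcartesian_1cell_def FIB_fib_simps FIB_fib_Obj cod_2functor_simps)
qed

section \<open>Opcartesian 2-cells\<close>

lemma opcartesian_arrowD:
  assumes "opcartesian_arrow p f" and "functor_from_to p A B"
    and "f \<in> hom A a b" "g \<in> hom A a c" "u \<in> hom B (OMap p b) (OMap p c)"
    and "Comp B u (AMap p f) = AMap p g"
  shows "\<exists>!v. v \<in> hom A b c \<and> AMap p v = u \<and> Comp A v f = g"
proof -
  have "\<forall>g u. g \<in> Arr A \<and> Dom A g = Dom A f \<and> u \<in> hom B (OMap p (Cod A f)) (OMap p (Cod A g)) \<and>
        Comp B u (AMap p f) = AMap p g \<longrightarrow>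
        (\<exists>!v. v \<in> hom A (Cod A f) (Cod A g) \<and> AMap p v = u \<and> Comp A v f = g)"
    using assms(1,2) by (simp add: opcartesian_arrow_def functor_from_to_def)
  from this[rule_format, of g u] show ?thesis using assms(3-6) by (auto simp: hom_def)
qed

lemma opcartesian_arrowI:
  assumes "functor_from_to p A B" and "f \<in> hom A a b"
    and "\<And>g c u. g \<in> hom A a c \<Longrightarrow> u \<in> hom B (OMap p b) (OMap p c) \<Longrightarrow>
      Comp B u (AMap p f) = AMap p g \<Longrightarrow> \<exists>!v. v \<in> hom A b c \<and> AMap p v = u \<and> Comp A v f = g"
  shows "opcartesian_arrow p f"
proof -
  have "\<exists>!v. v \<in> hom A b (Cod A g) \<and> AMap p v = u \<and> Comp A v f = g"
    if "g \<in> Arr A" "Dom A g = a" "u \<in> hom B (OMap p b) (OMap p (Cod A g))"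
      "Comp B u (AMap p f) = AMap p g" for g u
    using that assms(3)[of g "Cod A g" u] by (simp add: hom_def)
  then show ?thesis using assms(1,2) in_homD[OF assms(2)]
    by (simp add: opcartesian_arrow_def functor_from_to_def)
qed

text \<open>
  Source and target are read off from \<open>\<sigma>\<close>, so that the notion applies to the upper part of a 2-cell
  without naming categories or functors.
\<close>

definition invertible_nt :: "('o1, 'm1, 'o2, 'm2) nt \<Rightarrow> bool" where
  "invertible_nt \<sigma> \<longleftrightarrow> (\<exists>\<tau>. nat_trans_from_to \<tau> (NTrg \<sigma>) (NSrc \<sigma>) \<and>
     \<tau> \<cdot> \<sigma> = id_nt (NSrc \<sigma>) \<and> \<sigma> \<cdot> \<tau> = id_nt (NTrg \<sigma>))"

lemma invertible_nt_iff:
  assumes s: "nat_cell \<sigma> F G A B"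
  shows "invertible_nt \<sigma> \<longleftrightarrow> (\<exists>\<tau>. nat_cell \<tau> G F A B \<and> \<tau> \<cdot> \<sigma> = id_nt F \<and> \<sigma> \<cdot> \<tau> = id_nt G)"
  using nat_cellD(5,6)[OF s] nat_cell_iff_src[OF nat_cellD(2)[OF s]]
  by (simp add: invertible_nt_def)

lemma invertible_hcomp:
  assumes s: "nat_cell \<sigma> F F' A B" "invertible_nt \<sigma>" and t: "nat_cell \<tau> G G' B C" "invertible_nt \<tau>"
  shows "invertible_nt (\<tau> \<star> \<sigma>)"
proof -
  obtain \<sigma>' where s': "nat_cell \<sigma>' F' F A B" "\<sigma>' \<cdot> \<sigma> = id_nt F" "\<sigma> \<cdot> \<sigma>' = id_nt F'"
    using s(2) unfolding invertible_nt_iff[OF s(1)] by blast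
  obtain \<tau>' where t': "nat_cell \<tau>' G' G B C" "\<tau>' \<cdot> \<tau> = id_nt G" "\<tau> \<cdot> \<tau>' = id_nt G'"
    using t(2) unfolding invertible_nt_iff[OF t(1)] by blast
  have "(\<tau>' \<star> \<sigma>') \<cdot> (\<tau> \<star> \<sigma>) = id_nt (G \<circ>\<^sub>F F)" "(\<tau> \<star> \<sigma>) \<cdot> (\<tau>' \<star> \<sigma>') = id_nt (G' \<circ>\<^sub>F F')"
    using interchange[OF s(1) s'(1) t(1) t'(1)] interchange[OF s'(1) s(1) t'(1) t(1)] s' t'
      hcomp_id_nt[OF nat_cellD(1)[OF s(1)] nat_cellD(1)[OF t(1)]]
      hcomp_id_nt[OF nat_cellD(2)[OF s(1)] nat_cellD(2)[OF t(1)]] by simp_all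
  then show ?thesis
    unfolding invertible_nt_iff[OF nat_cell_hcomp[OF s(1) t(1)]]
    using nat_cell_hcomp[OF s'(1) t'(1)] by blast
qed

text \<open>
  Let \<open>\<theta>\<close> be the inverse of the upper cell of \<open>c\<close>. A factorization of a cell \<open>d\<close> through \<open>c\<close> can only
  have the upper cell \<open>UpperCell d \<cdot> \<theta>\<close>. That this choice is a 2-cell follows from the equation
  of \<open>d\<close>, since \<open>UpperCell d\<close> is \<open>(UpperCell d \<cdot> \<theta>) \<cdot> UpperCell c\<close> and the factor \<open>UpperCell c\<close> is
  absorbed by the equation of \<open>c\<close>.
\<close>

lemma opcartesian_if_invertible:
  assumes p: "functor_from_to p A B" and q: "functor_from_to q C D"
    and c: "is_square_cell p q c" and inv: "invertible_nt (UpperCell c)"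
  shows "opcartesian_arrow (HomMap2 cod_2functor p q) c"
proof (rule opcartesian_arrowI[OF cod_2functor_HomMap2[OF p q]])
  note C' = square_cellD[OF c p q]
  note F = lax_squareD(4)[OF C'(1) p q]
  obtain \<theta> where th: "nat_cell \<theta> (Upper (CTrg c)) (Upper (CSrc c)) A C"
    "\<theta> \<cdot> UpperCell c = id_nt (Upper (CSrc c))" "UpperCell c \<cdot> \<theta> = id_nt (Upper (CTrg c))"
    using inv unfolding invertible_nt_iff[OF C'(3)] by blast
  show ch: "c \<in> hom (FIB_fib_hom p q) (CSrc c) (CTrg c)" using c by (simp add: FIB_fib_in_hom)
  fix d t u
  assume dh: "d \<in> hom (FIB_fib_hom p q) (CSrc c) t"
    and "u \<in> hom (Cat_co_fib_hom B D) (OMap (HomMap2 cod_2functor p q) (CTrg c)) (OMap (HomMap2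
        cod_2functor p q) t)"
    and eq: "Comp (Cat_co_fib_hom B D) u (AMap (HomMap2 cod_2functor p q) c) = AMap (HomMap2
        cod_2functor p q) d"
  from dh have d: "is_square_cell p q d" "CSrc d = CSrc c" "CTrg d = t" by (simp_all add:
      FIB_fib_in_hom)
  note D' = square_cellD[OF d(1) p q, unfolded d(2,3)]
  have uh: "u \<in> hom (Cat_co_fib_hom B D) (Lower (CTrg c)) (Lower t)"
    using \<open>u \<in> _\<close> C'(2) D'(2) by (simp add: cod_2functor_simps)
  then have u: "nat_cell u (Lower t) (Lower (CTrg c)) B D" by (simp add: Cat_co_fib_in_hom)
  have low: "LowerCell c \<cdot> u = LowerCell d"
    using eq c d(1) Cat_co_fib_Comp[OF square_cell_LowerCell[OF p q ch] uh] by (simp add: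
        cod_2functor_simps)
  define v where "v = \<lparr> CSrc = CTrg c, CTrg = t, UpperCell = UpperCell d \<cdot> \<theta>, LowerCell = u \<rparr>"
  note up = nat_cell_vcomp[OF th(1) D'(3)]
  have v: "is_square_cell p q v"
  proof -
    note qd = nat_cell_whisker_left[OF D'(3) q] and qth = nat_cell_whisker_left[OF th(1) q]
      and qc = nat_cell_whisker_left[OF C'(3) q] and cp = nat_cell_whisker_right[OF p C'(4)]
      and up' = nat_cell_whisker_right[OF p u]
    have "UpperCell d = (UpperCell d \<cdot> \<theta>) \<cdot> UpperCell c"
      using vcomp_assoc[OF C'(3) th(1) D'(3)] th(2) vcomp_id_right[OF D'(3)] by simp
    then have "Filler t = ((q \<rhd> (UpperCell d \<cdot> \<theta>)) \<cdot> (q \<rhd> UpperCell c)) \<cdot> Filler (CSrc c)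
        \<cdot> (LowerCell c \<lhd> p) \<cdot> (u \<lhd> p)"
      using D'(5) whisker_left_vcomp[OF C'(3) up q] whisker_right_vcomp[OF p u C'(4)] low by simp
    also have "\<dots> = (q \<rhd> (UpperCell d \<cdot> \<theta>)) \<cdot> Filler (CTrg c) \<cdot> (u \<lhd> p)"
      using C'(5) vcomp_assoc[OF nat_cell_vcomp[OF nat_cell_vcomp[OF up' cp] F] qc
          nat_cell_whisker_left[OF up q]]
        vcomp_assoc[OF up' nat_cell_vcomp[OF cp F] qc] vcomp_assoc[OF up' cp F] by simp
    finally show ?thesis
      unfolding is_square_cell_iff[OF p q] v_def using C'(2) D'(2) up u by simp
  qed
  then have vh: "v \<in> hom (FIB_fib_hom p q) (CTrg c) t" by (simp add: FIB_fib_in_hom v_def)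
  show "\<exists>!v. v \<in> hom (FIB_fib_hom p q) (CTrg c) t \<and> AMap (HomMap2 cod_2functor p q) v = u \<and>
      Comp (FIB_fib_hom p q) v c = d"
  proof (rule ex1I)
    have "vcomp_cell v c = d"
      using vcomp_assoc[OF C'(3) th(1) D'(3)] th(2) vcomp_id_right[OF D'(3)] low d(2,3)
      by (simp add: vcomp_cell_def v_def)
    then show "v \<in> hom (FIB_fib_hom p q) (CTrg c) t \<and> AMap (HomMap2 cod_2functor p q) v = u \<and>
        Comp (FIB_fib_hom p q) v c = d"
      using vh v by (simp add: cod_2functor_simps FIB_fib_Comp[OF ch]) (simp add: v_def)
  next
    fix w assume w: "w \<in> hom (FIB_fib_hom p q) (CTrg c) t \<and> AMap (HomMap2 cod_2functor p q) w = u \<and>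
      Comp (FIB_fib_hom p q) w c = d"
    then have w': "is_square_cell p q w" "CSrc w = CTrg c" "CTrg w = t" "LowerCell w = u"
      and wc: "vcomp_cell w c = d"
      using FIB_fib_Comp[OF ch] by (auto simp: FIB_fib_in_hom cod_2functor_simps)
    note W = square_cellD[OF w'(1) p q, unfolded w'(2,3)]
    have "UpperCell w = (UpperCell w \<cdot> UpperCell c) \<cdot> \<theta>"
      using vcomp_assoc[OF th(1) C'(3) W(3)] th(3) vcomp_id_right[OF W(3)] by simp
    also have "UpperCell w \<cdot> UpperCell c = UpperCell d" using wc by (auto simp: vcomp_cell_def)
    finally show "w = v" using w' by (simp add: v_def)
  qed
qed

text \<open>
  The chosen opcartesian lift of \<open>\<psi>\<close> at \<open>s\<close>: the upper functor stays fixed, and the equation for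
  2-cells then determines the filler of the target.
\<close>

definition lift_cell :: "('o, 'm, 'o, 'm) ftor \<Rightarrow> ('o, 'm) lax_square \<Rightarrow> ('o, 'm, 'o, 'm) nt \<Rightarrow>
    ('o, 'm) square_cell" where
  "lift_cell p s \<psi> = \<lparr> CSrc = s,
     CTrg = \<lparr> Upper = Upper s, Lower = NSrc \<psi>, Filler = Filler s \<cdot> (\<psi> \<lhd> p) \<rparr>,
     UpperCell = id_nt (Upper s), LowerCell = \<psi> \<rparr>"

lemma lift_cell_square:
  assumes p: "functor_from_to p A B" and q: "functor_from_to q C D" and s: "is_lax_square p q s"
    and \<psi>: "nat_cell \<psi> g (Lower s) B D" and g: "fibration g"
  shows "is_square_cell p q (lift_cell p s \<psi>)"
proof -
  note S = lax_squareD[OF s p q]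
  note F = nat_cell_vcomp[OF nat_cell_whisker_right[OF p \<psi>] S(4)]
  have "is_lax_square p q \<lparr> Upper = Upper s, Lower = g, Filler = Filler s \<cdot> (\<psi> \<lhd> p) \<rparr>"
    unfolding is_lax_square_iff[OF p q] using S(1) F g nat_cellD(1)[OF \<psi>] by simp
  then show ?thesis
    unfolding is_square_cell_iff[OF p q]
    using s \<psi> nat_cell_id[OF S(1)] whisker_left_id_nt[OF S(1) q] vcomp_id_left[OF F] nat_cellD(5)[OF \<psi>]
    by (simp add: lift_cell_def)
qed

lemma id_nt_invertible:
  assumes F: "functor_from_to F A B" shows "invertible_nt (id_nt F)"
  unfolding invertible_nt_iff[OF nat_cell_id[OF F]]
  using nat_cell_id[OF F] vcomp_id_left[OF nat_cell_id[OF F]] by blast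

lemma lift_cell_opcartesian:
  assumes p: "functor_from_to p A B" and q: "functor_from_to q C D" and s: "is_lax_square p q s"
    and \<psi>: "nat_cell \<psi> g (Lower s) B D" and g: "fibration g"
  shows "opcartesian_arrow (HomMap2 cod_2functor p q) (lift_cell p s \<psi>)"
  using opcartesian_if_invertible[OF p q lift_cell_square[OF assms]]
    id_nt_invertible[OF lax_squareD(1)[OF s p q]]
  by (simp add: lift_cell_def)

text \<open>
  The cell \<open>c\<close> and the lift of its lower part at the same source are opcartesian over the same 2-cell,
  so each factors through the other over an identity. The upper part of the lift is an identity;
  hence the factorization of \<open>c\<close> through the lift has the upper part of \<open>c\<close>, and the factorization of
  the lift through \<open>c\<close> is its inverse.
\<close>

lemma invertible_if_opcartesian:
  assumes p: "functor_from_to p A B" and q: "functor_from_to q C D"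
    and opc: "opcartesian_arrow (HomMap2 cod_2functor p q) c"
  shows "is_square_cell p q c" "invertible_nt (UpperCell c)"
proof -
  let ?P = "HomMap2 cod_2functor p q"
  note P = cod_2functor_HomMap2[OF p q]
  interpret K: category "FIB_fib_hom p q" by (rule FIB_fib_hom_category[OF p q])
  interpret L: category "Cat_co_fib_hom B D" by (rule Cat_co_fib_hom_category)
  show c: "is_square_cell p q c"
    using opc functor_from_toD(2)[OF P] by (simp add: opcartesian_arrow_def FIB_fib_Arr)
  define s t where "s = CSrc c" and "t = CTrg c"
  note C' = square_cellD[OF c p q, folded s_def t_def]
  note g = lax_squareD(3)[OF C'(2) p q]
  let ?l = "lift_cell p s (LowerCell c)"
  define s' where "s' = CTrg ?l"
  have l: "is_square_cell p q ?l" by (rule lift_cell_square[OF p q C'(1,4) g])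
  have ch: "c \<in> hom (FIB_fib_hom p q) s t" and lh: "?l \<in> hom (FIB_fib_hom p q) s s'"
    using c l by (simp_all add: FIB_fib_in_hom s_def t_def s'_def) (simp add: lift_cell_def)
  have s': "is_lax_square p q s'" using square_cellD(2)[OF l p q] by (simp add: s'_def)
  have same: "AMap ?P ?l = AMap ?P c" using l c by (simp add: cod_2functor_simps) (simp add:
      lift_cell_def)
  have low: "OMap ?P s' = OMap ?P t"
    using s' C'(2) nat_cellD(5)[OF C'(4)] by (simp add: cod_2functor_simps) (simp add: s'_def
        lift_cell_def)
  let ?i = "Ident (Cat_co_fib_hom B D) (OMap ?P t)"
  have i: "?i \<in> hom (Cat_co_fib_hom B D) (OMap ?P t) (OMap ?P t)"
    using functor_OMap[OF P, of t] C'(2) by (intro L.Ident_hom) (simp add: FIB_fib_Obj)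
  have unit: "Comp (Cat_co_fib_hom B D) ?i (AMap ?P c) = AMap ?P c"
    by (rule L.hom_Ident_left[OF functor_AMap[OF P ch]])
  obtain v where v: "v \<in> hom (FIB_fib_hom p q) t s'" "AMap ?P v = ?i" "Comp (FIB_fib_hom p q) v c = ?l"
    using opcartesian_arrowD[OF opc P ch lh, of ?i] i unit same low by auto
  obtain w where w: "w \<in> hom (FIB_fib_hom p q) s' t" "AMap ?P w = ?i" "Comp (FIB_fib_hom p q) w ?l = c"
    using opcartesian_arrowD[OF lift_cell_opcartesian[OF p q C'(1,4) g] P lh ch, of ?i] i unit same
        low by auto
  \<comment> \<open>The composite \<open>w v\<close> and the identity both factor \<open>c\<close> through itself over an identity, so the
    uniqueness in the opcartesian property of \<open>c\<close> identifies them.\<close>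
  have wvc: "Comp (FIB_fib_hom p q) (Comp (FIB_fib_hom p q) w v) c = c"
    using K.hom_assoc[OF ch v(1) w(1)] v(3) w(3) by simp
  have "AMap ?P (Comp (FIB_fib_hom p q) w v) = ?i"
    using functor_Comp[OF P v(1) w(1)] v(2) w(2) L.hom_Ident_left[OF i] by simp
  then have wv: "Comp (FIB_fib_hom p q) w v = Ident (FIB_fib_hom p q) t"
    using opcartesian_arrowD[OF opc P ch ch i unit] wvc K.Comp_in_hom[OF v(1) w(1)]
      K.Ident_hom[OF K.hom_Obj(2)[OF ch]] functor_Ident[OF P K.hom_Obj(2)[OF ch]]
      K.hom_Ident_left[OF ch] by blast
  have V: "is_square_cell p q v" "CSrc v = t" "CTrg v = s'" and W: "is_square_cell p q w" "CSrc w =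
      s'" "CTrg w = t"
    using v(1) w(1) by (simp_all add: FIB_fib_in_hom)
  have up: "Upper s' = Upper s" "UpperCell ?l = id_nt (Upper s)" by (simp_all add: s'_def lift_cell_def)
  note V' = square_cellD(3)[OF V(1) p q, unfolded V up] and W' = square_cellD(3)[OF W(1) p q,
      unfolded W up]
  have 1: "UpperCell v \<cdot> UpperCell c = id_nt (Upper s)"
    using v(3) up FIB_fib_Comp[OF ch v(1)] vcomp_cell_simps(3)[of v c] by simp
  have "UpperCell w \<cdot> id_nt (Upper s) = UpperCell c"
    using w(3) up FIB_fib_Comp[OF lh w(1)] vcomp_cell_simps(3)[of w ?l] by simp
  then have "UpperCell w = UpperCell c" using vcomp_id_right[OF W'] by simp
  then have 2: "UpperCell c \<cdot> UpperCell v = id_nt (Upper t)"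
    using wv FIB_fib_Comp[OF v(1) w(1)] vcomp_cell_simps(3)[of w v] FIB_fib_Ident[OF C'(2)]
      id_cell_simps(3)[of t] by simp
  show "invertible_nt (UpperCell c)"
    unfolding invertible_nt_iff[OF C'(3)] using V' 1 2 by blast
qed

lemma cod_2functor_local_opfibration:
  assumes p: "functor_from_to p A B" and q: "functor_from_to q C D"
  shows "opfibration (HomMap2 cod_2functor p q)"
  unfolding opfibration_def functor_from_toD(2,3)[OF cod_2functor_HomMap2[OF p q]]
proof (intro conjI ballI impI functor_from_toD(1)[OF cod_2functor_HomMap2[OF p q]])
  fix s \<psi> assume "s \<in> Obj (FIB_fib_hom p q)" and \<psi>A: "\<psi> \<in> Arr (Cat_co_fib_hom B D)"
    and dom: "Dom (Cat_co_fib_hom B D) \<psi> = OMap (HomMap2 cod_2functor p q) s"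
  then have s: "is_lax_square p q s" by (simp add: FIB_fib_Obj)
  have "\<psi> \<in> hom (Cat_co_fib_hom B D) (Lower s) (Cod (Cat_co_fib_hom B D) \<psi>)"
    using in_homI[OF \<psi>A] dom s by (simp add: cod_2functor_simps)
  then obtain g where \<psi>: "nat_cell \<psi> g (Lower s) B D" and g: "fibration g" by (auto simp:
      Cat_co_fib_in_hom)
  have l: "is_square_cell p q (lift_cell p s \<psi>)" by (rule lift_cell_square[OF p q s \<psi> g])
  then have "lift_cell p s \<psi> \<in> hom (FIB_fib_hom p q) s (CTrg (lift_cell p s \<psi>))"
    by (simp add: FIB_fib_in_hom) (simp add: lift_cell_def)
  then have "Dom (FIB_fib_hom p q) (lift_cell p s \<psi>) = s" by (rule in_homD)
  moreover have "AMap (HomMap2 cod_2functor p q) (lift_cell p s \<psi>) = \<psi>"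
    using l by (simp add: cod_2functor_simps) (simp add: lift_cell_def)
  ultimately show "\<exists>c. opcartesian_arrow (HomMap2 cod_2functor p q) c \<and> Dom (FIB_fib_hom p q) c = s \<and>
      AMap (HomMap2 cod_2functor p q) c = \<psi>"
    using lift_cell_opcartesian[OF p q s \<psi> g] by blast
qed

lemma opcartesian_hcomp_cell:
  assumes p: "functor_from_to p A B" and q: "functor_from_to q C D" and r: "functor_from_to r X Y"
    and c: "opcartesian_arrow (HomMap2 cod_2functor p q) c"
    and d: "opcartesian_arrow (HomMap2 cod_2functor q r) d"
  shows "opcartesian_arrow (HomMap2 cod_2functor p r) (comp2 FIB_fib p q r d c)"
proof -
  note c' = invertible_if_opcartesian[OF p q c] and d' = invertible_if_opcartesian[OF q r d]
  have "invertible_nt (UpperCell (hcomp_cell d c))"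
    using invertible_hcomp[OF square_cellD(3)[OF c'(1) p q] c'(2) square_cellD(3)[OF d'(1) q r] d'(2)]
    by (simp add: hcomp_cell_def)
  then show ?thesis
    using opcartesian_if_invertible[OF p r hcomp_cell_square[OF p q r c'(1) d'(1)]] c'(1) d'(1)
    by (simp add: FIB_fib_comp2)
qed

theorem corollary6p7:
  shows "two_opfibration
    (FIB_fib :: (('o, 'm, 'o, 'm) ftor, ('o, 'm) lax_square, ('o, 'm) square_cell) two_cat)
    (Cat_co_fib :: (('o, 'm) cat, ('o, 'm, 'o, 'm) ftor, ('o, 'm, 'o, 'm) nt) two_cat)
    cod_2functor"
  unfolding two_opfibration_def FIB_fib_simps Cat_co_fib_simps cod_2functor_simps(1) mem_Collect_eq
      Ball_def
proof (intro conjI allI impI cod_2functor_two_functor)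
  fix p :: "('o, 'm, 'o, 'm) ftor" and D :: "('o, 'm) cat" and f
  assume p: "fibration p" and f: "f \<in> Obj (Cat_co_fib_hom (Trg p) D)"
  note fp = fibration_functor[OF p]
  have f': "functor_from_to f (Trg p) D" "fibration f" using f by (simp_all add: Cat_co_fib_Obj)
  note h = pushforward_square_lax[OF fp f']
  show "\<exists>y\<in>{p. fibration p}. \<exists>h. opcartesian_1cell FIB_fib Cat_co_fib cod_2functor p y h \<and>
      Trg y = D \<and> OMap (HomMap2 cod_2functor p y) h = f"
  proof (intro bexI exI conjI)
    show "opcartesian_1cell FIB_fib Cat_co_fib cod_2functor p (f \<circ>\<^sub>F p) (pushforward_square f p)"
      by (rule pushforward_square_opcartesian[OF p fp f'(2,1)])
    show "Trg (f \<circ>\<^sub>F p) = D" by (rule functor_from_toD(3)[OF functor_comp_from_to[OF fp f'(1)]])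
    show "OMap (HomMap2 cod_2functor p (f \<circ>\<^sub>F p)) (pushforward_square f p) = f"
      using h by (simp add: cod_2functor_simps) (simp add: pushforward_square_def)
    show "f \<circ>\<^sub>F p \<in> {p. fibration p}" using fibration_comp[OF p fp f'(2,1)] by simp
  qed
qed (auto intro: cod_2functor_local_opfibration opcartesian_hcomp_cell fibration_functor)

end
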